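(* Let $n\ge m$ be positive integers. In the commutative diagram with rows $$\boldsymbol\pi_{n,n+1}:\boldsymbol\zeta(n+1)^{(m)}\to\boldsymbol\zeta(n)^{(m)},\qquad \mathbf{i}_{n+1,n}:\boldsymbol\zeta(n)^{(m)}\to\boldsymbol\zeta(n+1)^{(m)},$$ $$\boldsymbol\pi^*_{n,n+1}:\Lambda^*(n+1)^{(m)}\to\Lambda^*(n)^{(m)},\qquad \mathbf{i}^*_{n+1,n}:\Lambda^*(n)^{(m)}\to\Lambda^*(n+1)^{(m)},$$ and columns the Harish-Chandra isomorphisms $\chi_n:\boldsymbol\zeta(n)^{(m)}\to\Lambda^*(n)^{(m)}$ and $\chi_{n+1}:\boldsymbol\zeta(n+1)^{(m)}\to\Lambda^*(n+1)^{(m)}$, the pairs of horizontal arrows are mutually inverse isomorphisms; that is, $\boldsymbol\pi_{n,n+1}$ and $\mathbf{i}_{n+1,n}$ restricted to the $m$-th filtration elements are mutually inverse isomorphisms, and so are $\boldsymbol\pi^*_{n,n+1}$ and $\mathbf{i}^*_{n+1,n}$.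
   Context: $\boldsymbol\zeta(n)$ is the center of $\mathbf{U}(gl(n))$, $gl(n)=gl(n,\mathbb C)$ with standard basis $e_{i,j}$; $\boldsymbol\zeta(n)^{(m)}$ is the $m$-th element of the filtration induced by the standard filtration of $\mathbf{U}(gl(n))$. With $\mathbf{cdet}(A)=\sum_\sigma(-1)^{|\sigma|}a_{\sigma(1),1}\cdots a_{\sigma(k),k}$, put $\mathbf{H}_k(n)=\sum_{1\le i_1<\cdots<i_k\le n}\mathbf{cdet}[e_{i_a,i_b}+\delta_{ab}(k-a)]_{a,b=1,\dots,k}$; $\mathbf{H}_1(n),\dots,\mathbf{H}_n(n)$ are algebraically independent generators of $\boldsymbol\zeta(n)$ (Capelli). $\mathbf{i}_{n+1,n}:\boldsymbol\zeta(n)\to\boldsymbol\zeta(n+1)$ is the algebra map with $\mathbf{H}_k(n)\mapsto\mathbf{H}_k(n+1)$ ($1\le k\le n$); $\boldsymbol\pi_{n,n+1}:\boldsymbol\zeta(n+1)\to\boldsymbol\zeta(n)$ is the algebra map with $\mathbf{H}_k(n+1)\mapsto\mathbf{H}_k(n)$ ($1\le k\le n$), $\mathbf{H}_{n+1}(n+1)\mapsto0$. $\Lambda^*(n)$ is the algebra of shifted symmetric polynomials: complex polynomials $f(x_1,\dots,x_n)$ with $f(\dots,x_i,x_{i+1},\dots)=f(\dots,x_{i+1}-1,x_i+1,\dots)$ for $i=1,\dots,n-1$; $\Lambda^*(n)^{(m)}$ is the subspace of elements of degree at most $m$. Put $\mathbf{e}^*_k(x_1,\dots,x_n)=\sum_{1\le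 i_1<\cdots<i_k\le n}(x_{i_1}+k-1)(x_{i_2}+k-2)\cdots x_{i_k}$; $\mathbf{e}^*_1,\dots,\mathbf{e}^*_n$ freely generate $\Lambda^*(n)$. $\mathbf{i}^*_{n+1,n}:\Lambda^*(n)\to\Lambda^*(n+1)$ is the algebra map with $\mathbf{e}^*_k(x_1,\dots,x_n)\mapsto\mathbf{e}^*_k(x_1,\dots,x_{n+1})$ ($1\le k\le n$); $\boldsymbol\pi^*_{n,n+1}:\Lambda^*(n+1)\to\Lambda^*(n)$ is $f(x_1,\dots,x_{n+1})\mapsto f(x_1,\dots,x_n,0)$. The Harish-Chandra isomorphism $\chi_n:\boldsymbol\zeta(n)\to\Lambda^*(n)$ sends $A$ to the shifted symmetric polynomial such that $\chi_n(A)(\mu_1,\dots,\mu_n)$ is the eigenvalue of $A$ on the highest weight module $V_\mu$ of highest weight $\mu=(\mu_1,\dots,\mu_n)$; in particular $\chi_n(\mathbf{H}_k(n))=\mathbf{e}^*_k(x_1,\dots,x_n)$. *)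

theory Defs
  imports
    Complex_Main
    "HOL-Library.Poly_Mapping"
    "HOL-Library.FuncSet"
    "HOL-Combinatorics.Permutations"
    "HOL-Algebra.Ideal"
    "HOL-Algebra.QuotRing"
    "HOL-Algebra.Module"
begin

section \<open>Complex algebras\<close>

text \<open>
  A complex algebra is a record of type \<open>(complex, 'a) module\<close>: a (not necessarily commutative)
  ring together with a scalar multiplication \<open>c \<odot> x\<close>.
\<close>

definition alg_hom ::
    "(complex, 'a) module \<Rightarrow> (complex, 'b) module \<Rightarrow> ('a \<Rightarrow> 'b) set"
  where "alg_hom R S =
    {h \<in> ring_hom R S. \<forall>c. \<forall>x\<in>carrier R. h (c \<odot>\<^bsub>R\<^esub> x) = c \<odot>\<^bsub>S\<^esub> h x}"

definition linear_between ::
    "(complex, 'a) module \<Rightarrow> 'a set \<Rightarrow> (complex, 'b) module \<Rightarrow> 'b set \<Rightarrow> ('a \<Rightarrow> 'b) \<Rightarrow> bool"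
  where "linear_between R V S W h \<longleftrightarrow>
    h \<in> V \<rightarrow> W \<and>
    (\<forall>x\<in>V. \<forall>y\<in>V. h (x \<oplus>\<^bsub>R\<^esub> y) = h x \<oplus>\<^bsub>S\<^esub> h y) \<and>
    (\<forall>c. \<forall>x\<in>V. h (c \<odot>\<^bsub>R\<^esub> x) = c \<odot>\<^bsub>S\<^esub> h x)"

definition linear_iso_between ::
    "(complex, 'a) module \<Rightarrow> 'a set \<Rightarrow> (complex, 'b) module \<Rightarrow> 'b set \<Rightarrow> ('a \<Rightarrow> 'b) \<Rightarrow> bool"
  where "linear_iso_between R V S W h \<longleftrightarrow> linear_between R V S W h \<and> bij_betw h V W"

definition mutually_inverse_isos ::
    "(complex, 'a) module \<Rightarrow> 'a set \<Rightarrow> (complex, 'b) module \<Rightarrow> 'b set \<Rightarrow>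
     ('a \<Rightarrow> 'b) \<Rightarrow> ('b \<Rightarrow> 'a) \<Rightarrow> bool"
  where "mutually_inverse_isos R V S W f g \<longleftrightarrow>
    linear_iso_between R V S W f \<and> linear_iso_between S W R V g \<and>
    (\<forall>x\<in>V. g (f x) = x) \<and> (\<forall>y\<in>W. f (g y) = y)"

text \<open>
  For a monoid \<open>'k\<close> (written additively), \<open>'k \<Rightarrow>\<^sub>0 complex\<close> is its monoid algebra;
  \<open>Poly_Mapping.single 0 c\<close> is the constant \<open>c\<close>.  Below, \<open>'k\<close> is a monoid of words
  (free algebra) or of commutative monomials (polynomials).
\<close>

definition monoid_subalg ::
    "('k::monoid_add \<Rightarrow>\<^sub>0 complex) set \<Rightarrow> (complex, 'k \<Rightarrow>\<^sub>0 complex) module"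
  where "monoid_subalg A =
    \<lparr>carrier = A, monoid.mult = (*), one = 1, ring.zero = 0, add = (+),
     smult = (\<lambda>c p. Poly_Mapping.single 0 c * p)\<rparr>"


section \<open>The enveloping algebra of $gl(n)$\<close>

instantiation list :: (type) monoid_add
begin
definition zero_list :: "'a list" where "zero_list = []"
definition plus_list :: "'a list \<Rightarrow> 'a list \<Rightarrow> 'a list" where "plus_list = (@)"
instance by standard (simp_all add: zero_list_def plus_list_def)
end

type_synonym tensor = "(nat \<times> nat) list \<Rightarrow>\<^sub>0 complex"

text \<open>
  The tensor algebra of the vector space \<open>gl(n)\<close>, as the algebra of noncommutative polynomials
  in the basis \<open>e\<^sub>i\<^sub>j\<close>, where \<open>1 \<le> i, j \<le> n\<close>: the word \<open>[(i\<^sub>1,j\<^sub>1), \<dots>, (i\<^sub>r,j\<^sub>r)]\<close> stands for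
  the tensor product of the corresponding basis elements.
\<close>

definition tensor_alg :: "nat \<Rightarrow> (complex, tensor) module"
  where "tensor_alg n =
    monoid_subalg {p. \<forall>w\<in>Poly_Mapping.keys p. set w \<subseteq> {1..n} \<times> {1..n}}"

definition e_tensor :: "nat \<Rightarrow> nat \<Rightarrow> tensor"
  where "e_tensor i j = Poly_Mapping.single [(i, j)] 1"

text \<open>
  An element of \<open>gl(n)\<close> is a matrix with rows and columns indexed by \<open>{1..n}\<close>
  (entries outside this range are ignored); \<open>gl_tensor n A\<close> is its image in degree 1.
\<close>

definition gl_tensor :: "nat \<Rightarrow> (nat \<Rightarrow> nat \<Rightarrow> complex) \<Rightarrow> tensor"
  where "gl_tensor n A = (\<Sum>i=1..n. \<Sum>j=1..n. Poly_Mapping.single [(i, j)] (A i j))"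

definition gl_bracket ::
    "nat \<Rightarrow> (nat \<Rightarrow> nat \<Rightarrow> complex) \<Rightarrow> (nat \<Rightarrow> nat \<Rightarrow> complex) \<Rightarrow> nat \<Rightarrow> nat \<Rightarrow> complex"
  where "gl_bracket n A B = (\<lambda>i j. (\<Sum>k=1..n. A i k * B k j) - (\<Sum>k=1..n. B i k * A k j))"

definition ugl_ideal :: "nat \<Rightarrow> tensor set"
  where "ugl_ideal n = Idl\<^bsub>tensor_alg n\<^esub>
    {gl_tensor n A * gl_tensor n B - gl_tensor n B * gl_tensor n A
       - gl_tensor n (gl_bracket n A B) | A B. True}"

definition ugl_class :: "nat \<Rightarrow> tensor \<Rightarrow> tensor set"
  where "ugl_class n p = ugl_ideal n +>\<^bsub>tensor_alg n\<^esub> p"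

definition ugl :: "nat \<Rightarrow> (complex, tensor set) module"
  where "ugl n = (let Q = tensor_alg n Quot ugl_ideal n in
    \<lparr>carrier = carrier Q, monoid.mult = monoid.mult Q, one = one Q, ring.zero = ring.zero Q,
     add = add Q, smult = (\<lambda>c u. ugl_class n (Poly_Mapping.single 0 c) \<otimes>\<^bsub>Q\<^esub> u)\<rparr>)"

text \<open>Standard filtration: the span of the products of at most \<open>m\<close> elements of \<open>gl(n)\<close>.\<close>

definition ugl_filt :: "nat \<Rightarrow> nat \<Rightarrow> tensor set set"
  where "ugl_filt n m =
    ugl_class n ` {p \<in> carrier (tensor_alg n). \<forall>w\<in>Poly_Mapping.keys p. length w \<le> m}"

definition zeta :: "nat \<Rightarrow> (complex, tensor set) module"
  where "zeta n = (ugl n)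
    \<lparr>carrier := {z \<in> carrier (ugl n). \<forall>u\<in>carrier (ugl n). z \<otimes>\<^bsub>ugl n\<^esub> u = u \<otimes>\<^bsub>ugl n\<^esub> z}\<rparr>"

definition zeta_filt :: "nat \<Rightarrow> nat \<Rightarrow> tensor set set"
  where "zeta_filt n m = carrier (zeta n) \<inter> ugl_filt n m"


section \<open>The Capelli generators\<close>

definition cdet :: "nat \<Rightarrow> (nat \<Rightarrow> nat \<Rightarrow> 'a::ring_1) \<Rightarrow> 'a"
  where "cdet k a =
    (\<Sum>\<sigma> | \<sigma> permutes {1..k}. of_int (sign \<sigma>) * prod_list (map (\<lambda>j. a (\<sigma> j) j) [1..<Suc k]))"

text \<open>
  The sequences \<open>1 \<le> i\<^sub>1 < \<dots> < i\<^sub>k \<le> n\<close>, as lists; note that \<open>i\<^sub>a\<close> is \<open>is ! (a - 1)\<close>.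
\<close>

definition incr_seqs :: "nat \<Rightarrow> nat \<Rightarrow> nat list set"
  where "incr_seqs n k = {is. length is = k \<and> sorted_wrt (<) is \<and> set is \<subseteq> {1..n}}"

text \<open>
  The column determinants are computed on representatives in the tensor algebra and then
  mapped to the quotient.
\<close>

definition capelli_H :: "nat \<Rightarrow> nat \<Rightarrow> tensor set"
  where "capelli_H n k = ugl_class n
    (\<Sum>is\<in>incr_seqs n k. cdet k (\<lambda>a b.
       e_tensor (is ! (a - 1)) (is ! (b - 1)) + (if a = b then of_nat (k - a) else 0)))"

definition zeta_incl :: "nat \<Rightarrow> tensor set \<Rightarrow> tensor set"
  where "zeta_incl n = (THE h.
    h \<in> alg_hom (zeta n) (zeta (Suc n)) \<and> h \<in> extensional (carrier (zeta n)) \<and>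
    (\<forall>k\<in>{1..n}. h (capelli_H n k) = capelli_H (Suc n) k))"

definition zeta_proj :: "nat \<Rightarrow> tensor set \<Rightarrow> tensor set"
  where "zeta_proj n = (THE h.
    h \<in> alg_hom (zeta (Suc n)) (zeta n) \<and> h \<in> extensional (carrier (zeta (Suc n))) \<and>
    (\<forall>k\<in>{1..n}. h (capelli_H (Suc n) k) = capelli_H n k) \<and> h (capelli_H (Suc n) (Suc n)) = \<zero>\<^bsub>zeta n\<^esub>)"


section \<open>Shifted symmetric polynomials\<close>

text \<open>Polynomials in the variables \<open>x\<^sub>0, x\<^sub>1, \<dots>\<close>; monomials are finitely supported exponents.\<close>

type_synonym mpoly = "(nat \<Rightarrow>\<^sub>0 nat) \<Rightarrow>\<^sub>0 complex"

definition mp_var :: "nat \<Rightarrow> mpoly"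
  where "mp_var i = Poly_Mapping.single (Poly_Mapping.single i 1) 1"

text \<open>
  Evaluation at \<open>x\<^sub>i = g i\<close> in a commutative ring whose structure map from the complex
  numbers is \<open>\<kappa>\<close>.
\<close>

definition mp_eval :: "(complex \<Rightarrow> 'b::comm_ring_1) \<Rightarrow> (nat \<Rightarrow> 'b) \<Rightarrow> mpoly \<Rightarrow> 'b"
  where "mp_eval \<kappa> g p =
    (\<Sum>a\<in>Poly_Mapping.keys p. \<kappa> (Poly_Mapping.lookup p a) *
       (\<Prod>i\<in>Poly_Mapping.keys a. g i ^ Poly_Mapping.lookup a i))"

definition mp_value :: "mpoly \<Rightarrow> (nat \<Rightarrow> complex) \<Rightarrow> complex"
  where "mp_value p x = mp_eval (\<lambda>c. c) x p"

definition mp_subst :: "(nat \<Rightarrow> mpoly) \<Rightarrow> mpoly \<Rightarrow> mpoly"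
  where "mp_subst g p = mp_eval (Poly_Mapping.single 0) g p"

definition Lambda_star :: "nat \<Rightarrow> (complex, mpoly) module"
  where "Lambda_star n = monoid_subalg
    {f. (\<forall>a\<in>Poly_Mapping.keys f. Poly_Mapping.keys a \<subseteq> {1..n}) \<and>
        (\<forall>i\<in>{1..<n}. mp_subst (mp_var(i := mp_var (Suc i) - 1, Suc i := mp_var i + 1)) f = f)}"

definition Lambda_star_filt :: "nat \<Rightarrow> nat \<Rightarrow> mpoly set"
  where "Lambda_star_filt n m =
    {f \<in> carrier (Lambda_star n).
       \<forall>a\<in>Poly_Mapping.keys f. (\<Sum>i\<in>Poly_Mapping.keys a. Poly_Mapping.lookup a i) \<le> m}"

definition e_star :: "nat \<Rightarrow> nat \<Rightarrow> mpoly"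
  where "e_star n k = (\<Sum>is\<in>incr_seqs n k. \<Prod>a=1..k. mp_var (is ! (a - 1)) + of_nat (k - a))"

definition Lambda_star_incl :: "nat \<Rightarrow> mpoly \<Rightarrow> mpoly"
  where "Lambda_star_incl n = (THE h.
    h \<in> alg_hom (Lambda_star n) (Lambda_star (Suc n)) \<and>
    h \<in> extensional (carrier (Lambda_star n)) \<and>
    (\<forall>k\<in>{1..n}. h (e_star n k) = e_star (Suc n) k))"

definition Lambda_star_proj :: "nat \<Rightarrow> mpoly \<Rightarrow> mpoly"
  where "Lambda_star_proj n f = mp_subst (mp_var(Suc n := 0)) f"


section \<open>Highest weight modules and the Harish-Chandra isomorphism\<close>

text \<open>
  Modules over \<open>ugl n\<close> are carried by a subspace \<open>V\<close> of \<open>nat \<Rightarrow>\<^sub>0 complex\<close>.  As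
  \<open>ugl n\<close> has countable dimension, so does every cyclic module; hence every highest weight
  module is isomorphic to one of this form.
\<close>

type_synonym vec = "nat \<Rightarrow>\<^sub>0 complex"

definition vec_scale :: "complex \<Rightarrow> vec \<Rightarrow> vec"
  where "vec_scale c v = Poly_Mapping.map ((*) c) v"

definition ugl_module :: "nat \<Rightarrow> vec set \<Rightarrow> (tensor set \<Rightarrow> vec \<Rightarrow> vec) \<Rightarrow> bool"
  where "ugl_module n V act \<longleftrightarrow>
    0 \<in> V \<and> (\<forall>v\<in>V. \<forall>w\<in>V. v + w \<in> V) \<and> (\<forall>c. \<forall>v\<in>V. vec_scale c v \<in> V) \<and>
    (\<forall>u\<in>carrier (ugl n). \<forall>v\<in>V. act u v \<in> V) \<and>
    (\<forall>u\<in>carrier (ugl n). \<forall>v\<in>V. \<forall>w\<in>V. act u (v + w) = act u v + act u w) \<and>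
    (\<forall>u\<in>carrier (ugl n). \<forall>c. \<forall>v\<in>V. act u (vec_scale c v) = vec_scale c (act u v)) \<and>
    (\<forall>u\<in>carrier (ugl n). \<forall>u'\<in>carrier (ugl n). \<forall>v\<in>V.
       act (u \<oplus>\<^bsub>ugl n\<^esub> u') v = act u v + act u' v) \<and>
    (\<forall>c. \<forall>u\<in>carrier (ugl n). \<forall>v\<in>V. act (c \<odot>\<^bsub>ugl n\<^esub> u) v = vec_scale c (act u v)) \<and>
    (\<forall>u\<in>carrier (ugl n). \<forall>u'\<in>carrier (ugl n). \<forall>v\<in>V.
       act (u \<otimes>\<^bsub>ugl n\<^esub> u') v = act u (act u' v)) \<and>
    (\<forall>v\<in>V. act \<one>\<^bsub>ugl n\<^esub> v = v)"

definition highest_weight_module ::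
    "nat \<Rightarrow> (nat \<Rightarrow> complex) \<Rightarrow> vec set \<Rightarrow> (tensor set \<Rightarrow> vec \<Rightarrow> vec) \<Rightarrow> bool"
  where "highest_weight_module n \<mu> V act \<longleftrightarrow> ugl_module n V act \<and>
    (\<exists>v\<in>V. v \<noteq> 0 \<and>
       (\<forall>i\<in>{1..n}. \<forall>j\<in>{1..n}. i < j \<longrightarrow> act (ugl_class n (e_tensor i j)) v = 0) \<and>
       (\<forall>i\<in>{1..n}. act (ugl_class n (e_tensor i i)) v = vec_scale (\<mu> i) v) \<and>
       V = (\<lambda>u. act u v) ` carrier (ugl n))"

definition chi :: "nat \<Rightarrow> tensor set \<Rightarrow> mpoly"
  where "chi n A = (THE f. f \<in> carrier (Lambda_star n) \<and>
    (\<forall>\<mu> V act. highest_weight_module n \<mu> V act \<longrightarrow>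
       (\<forall>v\<in>V. act A v = vec_scale (mp_value f \<mu>) v)))"

end

theory Submission
  imports
    Defs
    "HOL-Computational_Algebra.Polynomial"
    "HOL-Library.Multiset"
    "HOL-Library.Nat_Bijection"
    "HOL-Combinatorics.Multiset_Permutations"
    "HOL-Analysis.Derivative"
    "Jordan_Normal_Form.Spectral_Radius"
begin

text \<open>
  All six maps become the identity in suitable coordinates: both \<open>zeta n\<close> and \<open>Lambda_star n\<close> are
  polynomial algebras in \<open>n\<close> generators, the \<open>k\<close>-th one of filtration degree \<open>k\<close>, and the filtrations
  are the ones by weight.  A polynomial of weight at most \<open>m \<le> n\<close> does not see the generator of weight
  \<open>n + 1\<close>.

  For \<open>Lambda_star n\<close>, a polynomial that vanishes at \<open>x\<^sub>n = 0\<close> is by its shifted symmetry a multiple of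
  \<open>e_star n n\<close>, so generation and independence follow by induction on \<open>n\<close> and on the degree.

  For \<open>zeta n\<close>, the operators \<open>D\<^sub>i\<^sub>j + x\<^sub>i\<^sub>j\<close>, with \<open>D\<^sub>i\<^sub>j\<close> a polarisation operator on the polynomials in the
  entries of a matrix, represent the enveloping algebra faithfully (Poincare-Birkhoff-Witt), and a
  calculus of column determinants shows that the Capelli elements are central.  The leading symbol of a central
  element is a conjugation invariant polynomial on matrices.  Almost every matrix can be triangularised by
  transvections, and invariance under the torus then removes the entries above the diagonal; so the symbol is
  determined by its restriction to the diagonal, which is a symmetric polynomial, hence the symbol of a
  polynomial in the Capelli elements.  Induction on the filtration degree gives generation.

  Products of leading minors are highest weight vectors for the polarisation operators.  Their weights are
  the dominant integral ones, which are Zariski dense; this makes the eigenvalue polynomials unique and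
  \<open>chi n\<close> injective, multiplicative and filtered.
\<close>

section \<open>Evaluation of elements of a monoid algebra\<close>

text \<open>\<open>chi\<close>, \<open>zeta_incl\<close>, \<open>zeta_proj\<close> and
  \<open>Lambda_star_incl\<close> are definite descriptions, so nothing can be computed before
  existence and uniqueness are known; free generation gives them for the three algebra maps. The
  obstacle on the enveloping side is that \<open>zeta n\<close> consists of cosets in a
  noncommutative tensor algebra and forms no ring type. Identities are therefore checked for
  operators, which do form a type of class \<open>ring_1\<close>, and pulled back along the faithful
  representation \<open>pbw_op\<close>; the representation \<open>polar_op\<close> supplies the
  highest weight modules. A polynomial in the Capelli elements is a linear map
  \<open>capelli_poly\<close> into the tensor algebra with a chosen order of the factors, and its
  multiplicativity modulo the ideal is read off from eigenvalues. The parameter \<open>c\<close>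
  lets one argument serve twice: \<open>c = 1\<close> gives shifted symmetric polynomials,
  \<open>c = 0\<close> the symmetric ones that arise as symbols on diagonal matrices. Centrality
  yields only infinitesimal invariance of a symbol. For transvections it is integrated along a
  polynomial flow; for the torus it is used directly, as a statement about the degree in an
  auxiliary variable.\<close>

lemma poly_mapping_sum_single:
  "p = (\<Sum>a\<in>Poly_Mapping.keys p. Poly_Mapping.single a (Poly_Mapping.lookup p a))"
  by (rule poly_mapping_eqI)
    (simp add: lookup_sum lookup_single when_def sum.delta not_in_keys_iff_lookup_eq_zero)

lemma poly_mapping_single_induct [consumes 1, case_names zero single add]:
  fixes p :: "'k \<Rightarrow>\<^sub>0 'c::comm_monoid_add"
  assumes "Poly_Mapping.keys p \<subseteq> S" and "P 0"
    and "\<And>a c. a \<in> S \<Longrightarrow> P (Poly_Mapping.single a c)"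
    and "\<And>p q. P p \<Longrightarrow> P q \<Longrightarrow> P (p + q)"
  shows "P p"
proof -
  have "P (\<Sum>a\<in>K. Poly_Mapping.single a (Poly_Mapping.lookup p a))" if "finite K" "K \<subseteq> S" for K
    using that by (induction K) (auto intro: assms)
  then show ?thesis
    using assms(1) poly_mapping_sum_single[of p] by (metis finite_keys)
qed

text \<open>One evaluation for all monoid algebras: words give maps out of the tensor algebra,
  exponent vectors give maps out of \<open>mpoly\<close>. The structure map \<open>\<kappa>\<close>
  may lead into constants, polynomials or operators.\<close>

definition meval :: "('c::zero \<Rightarrow> 'b) \<Rightarrow> ('k \<Rightarrow> 'b) \<Rightarrow> ('k \<Rightarrow>\<^sub>0 'c) \<Rightarrow> 'b::semiring_0"
  where "meval \<kappa> h p = (\<Sum>a\<in>Poly_Mapping.keys p. \<kappa> (Poly_Mapping.lookup p a) * h a)"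

text \<open>Kept apart from \<open>algebra_eval\<close> because \<open>capelli_poly\<close> is
  linear without being multiplicative on representatives.\<close>

locale coeff_hom =
  fixes \<kappa> :: "'c::ring_1 \<Rightarrow> 'b::ring_1"
  assumes add: "\<kappa> (c + d) = \<kappa> c + \<kappa> d"
begin

lemma zero [simp]: "\<kappa> 0 = 0"
  using add[of 0 0] by simp

lemma meval_superset:
  assumes "finite S" "Poly_Mapping.keys p \<subseteq> S"
  shows "meval \<kappa> h p = (\<Sum>a\<in>S. \<kappa> (Poly_Mapping.lookup p a) * h a)"
  unfolding meval_def using assms by (intro sum.mono_neutral_left) (auto simp: not_in_keys_iff_lookup_eq_zero)

lemma meval_zero [simp]: "meval \<kappa> h 0 = 0"
  by (simp add: meval_def)

lemma meval_add: "meval \<kappa> h (p + q) = meval \<kappa> h p + meval \<kappa> h q"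
proof -
  let ?S = "Poly_Mapping.keys p \<union> Poly_Mapping.keys q"
  have "meval \<kappa> h (p + q) = (\<Sum>a\<in>?S. \<kappa> (Poly_Mapping.lookup (p + q) a) * h a)"
    by (rule meval_superset) (use Poly_Mapping.keys_add[of p q] in auto)
  also have "\<dots> = (\<Sum>a\<in>?S. \<kappa> (Poly_Mapping.lookup p a) * h a)
      + (\<Sum>a\<in>?S. \<kappa> (Poly_Mapping.lookup q a) * h a)"
    by (simp add: lookup_add add distrib_right sum.distrib)
  also have "\<dots> = meval \<kappa> h p + meval \<kappa> h q"
    by (simp add: meval_superset[of ?S p] meval_superset[of ?S q])
  finally show ?thesis .
qed

lemma meval_minus: "meval \<kappa> h (- p) = - meval \<kappa> h p"
  using meval_add[of h "-p" p] by (simp add: eq_neg_iff_add_eq_0)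

lemma meval_diff: "meval \<kappa> h (p - q) = meval \<kappa> h p - meval \<kappa> h q"
  using meval_add[of h p "-q"] by (simp add: meval_minus)

lemma meval_sum: "meval \<kappa> h (sum f I) = (\<Sum>i\<in>I. meval \<kappa> h (f i))"
  by (induction I rule: infinite_finite_induct) (simp_all add: meval_add)

lemma meval_single [simp]: "meval \<kappa> h (Poly_Mapping.single a c) = \<kappa> c * h a"
  by (cases "c = 0") (simp_all add: meval_def)

end

text \<open>Assumption \<open>comm\<close> takes the place of commutativity of the target: only
  scalars have to commute with the images of the basis.\<close>

locale algebra_eval = coeff_hom \<kappa> for \<kappa> :: "'c::ring_1 \<Rightarrow> 'b::ring_1" +
  fixes h :: "'k::monoid_add \<Rightarrow> 'b"
  assumes mult: "\<kappa> (c * d) = \<kappa> c * \<kappa> d"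
    and one [simp]: "\<kappa> 1 = 1"
    and h_zero [simp]: "h 0 = 1"
    and h_add: "h (a + b) = h a * h b"
    and comm: "h a * \<kappa> c = \<kappa> c * h a"
begin

lemma meval_mult: "meval \<kappa> h (p * q) = meval \<kappa> h p * meval \<kappa> h q"
proof (induction p rule: poly_mapping_single_induct[OF subset_UNIV])
  case (2 a c)
  show ?case
  proof (induction q rule: poly_mapping_single_induct[OF subset_UNIV])
    case (2 b d)
    have "\<kappa> c * \<kappa> d * (h a * h b) = \<kappa> c * (h a * \<kappa> d) * h b"
      by (simp add: comm mult.assoc)
    then show ?case
      by (simp add: mult_single mult h_add mult.assoc)
  qed (simp_all add: distrib_left meval_add)
qed (simp_all add: distrib_right meval_add)

lemma meval_one [simp]: "meval \<kappa> h 1 = 1"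
  using meval_single[of h 0 1] by simp

lemma meval_const [simp]: "meval \<kappa> h (Poly_Mapping.single 0 c) = \<kappa> c"
  by simp

lemma meval_prod_list: "meval \<kappa> h (prod_list ps) = prod_list (map (meval \<kappa> h) ps)"
  by (induction ps) (simp_all add: meval_mult)

lemma meval_power: "meval \<kappa> h (p ^ n) = meval \<kappa> h p ^ n"
  by (induction n) (simp_all add: meval_mult)

lemma meval_of_nat [simp]: "meval \<kappa> h (of_nat n) = of_nat n"
  by (induction n) (simp_all add: meval_add)

lemma meval_of_int [simp]: "meval \<kappa> h (of_int n) = of_int n"
  by (cases n rule: int_diff_cases) (simp add: meval_diff)

end

section \<open>Commutative monomials and polynomial substitution\<close>

definition mon_eval :: "('v \<Rightarrow> 'b) \<Rightarrow> ('v \<Rightarrow>\<^sub>0 nat) \<Rightarrow> 'b::comm_monoid_mult"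
  where "mon_eval g a = (\<Prod>i\<in>Poly_Mapping.keys a. g i ^ Poly_Mapping.lookup a i)"

lemma mon_eval_superset:
  assumes "finite S" "Poly_Mapping.keys a \<subseteq> S"
  shows "mon_eval g a = (\<Prod>i\<in>S. g i ^ Poly_Mapping.lookup a i)"
  unfolding mon_eval_def using assms by (intro prod.mono_neutral_left) (auto simp: not_in_keys_iff_lookup_eq_zero)

lemma mon_eval_zero [simp]: "mon_eval g 0 = 1"
  by (simp add: mon_eval_def)

lemma mon_eval_add: "mon_eval g (a + b) = mon_eval g a * mon_eval g b"
proof -
  let ?S = "Poly_Mapping.keys a \<union> Poly_Mapping.keys b"
  have "mon_eval g (a + b) = (\<Prod>i\<in>?S. g i ^ Poly_Mapping.lookup (a + b) i)"
    by (rule mon_eval_superset) (use Poly_Mapping.keys_add[of a b] in auto)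
  also have "\<dots> = mon_eval g a * mon_eval g b"
    by (simp add: mon_eval_superset[of ?S a] mon_eval_superset[of ?S b] lookup_add power_add
        prod.distrib)
  finally show ?thesis .
qed

lemma mon_eval_single [simp]: "mon_eval g (Poly_Mapping.single i k) = g i ^ k"
  by (cases "k = 0") (simp_all add: mon_eval_def)

lemma mon_eval_cong:
  "(\<And>i. i \<in> Poly_Mapping.keys a \<Longrightarrow> g i = g' i) \<Longrightarrow> mon_eval g a = mon_eval g' a"
  by (simp add: mon_eval_def)

lemma mp_eval_eq_meval: "mp_eval \<kappa> g = meval \<kappa> (mon_eval g)"
  by (simp add: fun_eq_iff mp_eval_def meval_def mon_eval_def)

lemma monomial_induct [consumes 1, case_names zero var add]:
  fixes a :: "'v \<Rightarrow>\<^sub>0 nat"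
  assumes "Poly_Mapping.keys a \<subseteq> S" "P 0"
    and "\<And>i. i \<in> S \<Longrightarrow> P (Poly_Mapping.single i 1)"
    and "\<And>a b. P a \<Longrightarrow> P b \<Longrightarrow> P (a + b)"
  shows "P a"
  using assms(1)
proof (induction rule: poly_mapping_single_induct)
  case (single i c)
  show ?case
  proof (induction c)
    case (Suc c)
    have "P (Poly_Mapping.single i 1 + Poly_Mapping.single i c)"
      by (intro assms(4) assms(3) single Suc)
    then show ?case
      by (simp flip: single_add)
  qed (simp add: assms(2))
qed (fact assms)+

locale ring_hom_1 =
  fixes \<kappa> :: "'c::comm_ring_1 \<Rightarrow> 'b::comm_ring_1"
  assumes \<kappa>_add: "\<kappa> (c + d) = \<kappa> c + \<kappa> d"
    and \<kappa>_mult: "\<kappa> (c * d) = \<kappa> c * \<kappa> d"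
    and \<kappa>_one: "\<kappa> 1 = 1"
begin

lemma algebra_eval: "algebra_eval \<kappa> (mon_eval g)"
  by unfold_locales (simp_all add: \<kappa>_add \<kappa>_mult \<kappa>_one mon_eval_add mult.commute)

sublocale coeff_hom \<kappa>
  by unfold_locales (rule \<kappa>_add)

end

lemma ring_hom_1_id: "ring_hom_1 (\<lambda>c. c)"
  by unfold_locales simp_all

lemma ring_hom_1_const: "ring_hom_1 (Poly_Mapping.single (0::'k::comm_monoid_add) :: 'c::comm_ring_1 \<Rightarrow> _)"
  by unfold_locales (simp_all add: single_add mult_single)

lemma ring_hom_1_pCons: "ring_hom_1 (\<lambda>c::'c::comm_ring_1. [:c:])"
  by unfold_locales (simp_all add: one_pCons)

lemma ring_hom_1_comp: "ring_hom_1 f \<Longrightarrow> ring_hom_1 g \<Longrightarrow> ring_hom_1 (\<lambda>x. f (g x))"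
  by (simp add: ring_hom_1_def)

lemma ring_hom_1_mp_eval:
  assumes "ring_hom_1 \<kappa>"
  shows "ring_hom_1 (mp_eval \<kappa> g)"
proof -
  interpret algebra_eval \<kappa> "mon_eval g"
    using assms by (rule ring_hom_1.algebra_eval)
  show ?thesis
    by unfold_locales (simp_all add: mp_eval_eq_meval meval_add meval_mult)
qed

text \<open>Universal property of the polynomial ring; the composition laws for substitutions follow
  from it without touching the defining sums.\<close>

lemma mp_hom_unique:
  fixes \<phi> :: "mpoly \<Rightarrow> 'b::comm_ring_1"
  assumes "ring_hom_1 \<phi>"
    and "\<And>c. \<phi> (Poly_Mapping.single 0 c) = \<kappa> c"
    and "\<And>i. \<phi> (mp_var i) = g i"
  shows "\<phi> p = mp_eval \<kappa> g p"
proof -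
  interpret \<phi>: ring_hom_1 \<phi> by fact
  have mon: "\<phi> (Poly_Mapping.single a 1) = mon_eval g a" for a
  proof (induction a rule: monomial_induct[OF subset_UNIV])
    case (2 i)
    then show ?case
      using assms(3)[of i] by (simp add: mp_var_def)
  next
    case (3 a b)
    then show ?case
      using \<phi>.\<kappa>_mult[of "Poly_Mapping.single a 1" "Poly_Mapping.single b 1"]
      by (simp add: mult_single mon_eval_add)
  qed (simp add: \<phi>.\<kappa>_one)
  have sg: "\<phi> (Poly_Mapping.single a c) = \<kappa> c * mon_eval g a" for a c
    using \<phi>.\<kappa>_mult[of "Poly_Mapping.single 0 c" "Poly_Mapping.single a 1"]
    by (simp add: mult_single assms(2) mon)
  have "ring_hom_1 \<kappa>"
    using ring_hom_1_comp[OF assms(1) ring_hom_1_const] by (simp add: assms(2))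
  then interpret algebra_eval \<kappa> "mon_eval g"
    by (rule ring_hom_1.algebra_eval)
  show ?thesis
    by (induction p rule: poly_mapping_single_induct[OF subset_UNIV])
      (simp_all add: mp_eval_eq_meval meval_add \<phi>.\<kappa>_add sg)
qed

lemma mp_eval_zero [simp]: "ring_hom_1 \<kappa> \<Longrightarrow> mp_eval \<kappa> g 0 = 0"
  by (simp add: mp_eval_def)

lemma mp_eval_comp:
  assumes "ring_hom_1 \<phi>" "ring_hom_1 \<kappa>"
  shows "\<phi> (mp_eval \<kappa> g p) = mp_eval (\<lambda>c. \<phi> (\<kappa> c)) (\<lambda>i. \<phi> (g i)) p"
proof (rule mp_hom_unique)
  interpret algebra_eval \<kappa> "mon_eval g"
    using assms(2) by (rule ring_hom_1.algebra_eval)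
  show "ring_hom_1 (\<lambda>p. \<phi> (mp_eval \<kappa> g p))"
    by (rule ring_hom_1_comp[OF assms(1) ring_hom_1_mp_eval[OF assms(2)]])
  show "\<phi> (mp_eval \<kappa> g (mp_var i)) = \<phi> (g i)" for i
    by (simp add: mp_eval_eq_meval mp_var_def)
  show "\<phi> (mp_eval \<kappa> g (Poly_Mapping.single 0 c)) = \<phi> (\<kappa> c)" for c
    by (simp add: mp_eval_eq_meval)
qed

lemma mp_subst_var: "mp_subst mp_var p = p"
  using mp_hom_unique[of "\<lambda>p. p" "Poly_Mapping.single 0" mp_var p]
  by (simp add: mp_subst_def ring_hom_1_id)

lemma mp_eval_cong:
  assumes "\<And>i a. a \<in> Poly_Mapping.keys p \<Longrightarrow> i \<in> Poly_Mapping.keys a \<Longrightarrow> g i = g' i"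
  shows "mp_eval \<kappa> g p = mp_eval \<kappa> g' p"
  unfolding mp_eval_eq_meval meval_def
  by (intro sum.cong refl arg_cong2[where f = "(*)"] mon_eval_cong assms)

section \<open>Polynomials in a prescribed set of variables\<close>

definition vars_in :: "nat set \<Rightarrow> mpoly \<Rightarrow> bool"
  where "vars_in V p \<longleftrightarrow> (\<forall>a\<in>Poly_Mapping.keys p. Poly_Mapping.keys a \<subseteq> V)"

lemma vars_in_cong:
  assumes "vars_in V p" "\<And>i. i \<in> V \<Longrightarrow> g i = g' i"
  shows "mp_eval \<kappa> g p = mp_eval \<kappa> g' p"
  using assms by (intro mp_eval_cong) (auto simp: vars_in_def)

lemma vars_in_mono: "vars_in V p \<Longrightarrow> V \<subseteq> W \<Longrightarrow> vars_in W p"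
  by (auto simp: vars_in_def)

lemma vars_in_zero [simp]: "vars_in V 0"
  by (simp add: vars_in_def)

lemma vars_in_one [simp]: "vars_in V 1"
  by (simp add: vars_in_def)

lemma vars_in_const [simp]: "vars_in V (Poly_Mapping.single 0 c)"
  by (simp add: vars_in_def)

lemma vars_in_of_nat [simp]: "vars_in V (of_nat k)"
  by (metis single_of_nat vars_in_const)

lemma vars_in_var [simp]: "vars_in V (mp_var i) \<longleftrightarrow> i \<in> V"
  by (simp add: vars_in_def mp_var_def)

lemma vars_in_add: "vars_in V p \<Longrightarrow> vars_in V q \<Longrightarrow> vars_in V (p + q)"
  using Poly_Mapping.keys_add[of p q] by (auto simp: vars_in_def)

lemma vars_in_minus: "vars_in V p \<Longrightarrow> vars_in V (- p)"
  by (simp add: vars_in_def)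

lemma vars_in_diff: "vars_in V p \<Longrightarrow> vars_in V q \<Longrightarrow> vars_in V (p - q)"
  using vars_in_add[of V p "-q"] by (simp add: vars_in_minus)

lemma vars_in_mult:
  assumes "vars_in V p" "vars_in V q"
  shows "vars_in V (p * q)"
  unfolding vars_in_def
proof (intro ballI subsetI)
  fix a i assume "a \<in> Poly_Mapping.keys (p * q)" "i \<in> Poly_Mapping.keys a"
  moreover from this obtain b d where "b \<in> Poly_Mapping.keys p" "d \<in> Poly_Mapping.keys q" "a = b + d"
    using keys_mult[of p q] by blast
  ultimately show "i \<in> V"
    using assms Poly_Mapping.keys_add[of b d] by (force simp: vars_in_def)
qed

lemma vars_in_sum: "(\<And>i. i \<in> I \<Longrightarrow> vars_in V (f i)) \<Longrightarrow> vars_in V (sum f I)"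
  by (induction I rule: infinite_finite_induct) (auto intro: vars_in_add)

lemma vars_in_prod: "(\<And>i. i \<in> I \<Longrightarrow> vars_in V (f i)) \<Longrightarrow> vars_in V (prod f I)"
  by (induction I rule: infinite_finite_induct) (auto intro: vars_in_mult)

lemma vars_in_power: "vars_in V p \<Longrightarrow> vars_in V (p ^ n)"
  by (induction n) (auto intro: vars_in_mult)

lemma vars_in_mp_subst:
  assumes "vars_in V p" "\<And>i. i \<in> V \<Longrightarrow> vars_in W (g i)"
  shows "vars_in W (mp_subst g p)"
  unfolding mp_subst_def mp_eval_def
  by (intro vars_in_sum vars_in_mult vars_in_prod vars_in_power vars_in_const assms(2))
    (use assms(1) in \<open>auto simp: vars_in_def\<close>)

lemma mp_poly_induct [consumes 1, case_names const var add mult]: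
  assumes "vars_in V p"
    and "\<And>c. P (Poly_Mapping.single 0 c)" "\<And>i. i \<in> V \<Longrightarrow> P (mp_var i)"
    and "\<And>p q. P p \<Longrightarrow> P q \<Longrightarrow> P (p + q)" "\<And>p q. P p \<Longrightarrow> P q \<Longrightarrow> P (p * q)"
  shows "P p"
proof -
  have mon: "P (Poly_Mapping.single a 1)" if "Poly_Mapping.keys a \<subseteq> V" for a
    using that
  proof (induction rule: monomial_induct)
    case (add a b)
    then show ?case
      using assms(5)[of "Poly_Mapping.single a 1" "Poly_Mapping.single b 1"] by (simp add: mult_single)
  qed (use assms(2)[of 1] assms(3) in \<open>auto simp: mp_var_def\<close>)
  have "Poly_Mapping.keys p \<subseteq> {a. Poly_Mapping.keys a \<subseteq> V}"
    using assms(1) by (auto simp: vars_in_def)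
  then show ?thesis
  proof (induction rule: poly_mapping_single_induct)
    case (single a c)
    then show ?case
      using assms(5)[OF assms(2)[of c] mon[of a]] by (simp add: mult_single)
  qed (use assms(2)[of 0] assms(4) in auto)
qed

lemma ring_hom_1_mp_subst: "ring_hom_1 (mp_subst g)"
  using ring_hom_1_mp_eval[OF ring_hom_1_const] by (simp add: mp_subst_def[abs_def])

lemma ring_hom_1_mp_value: "ring_hom_1 (\<lambda>p. mp_value p x)"
  using ring_hom_1_mp_eval[OF ring_hom_1_id] by (simp add: mp_value_def[abs_def])

lemma mp_eval_of_var [simp]:
  assumes "ring_hom_1 \<kappa>"
  shows "mp_eval \<kappa> g (mp_var i) = g i"
proof -
  interpret algebra_eval \<kappa> "mon_eval g"
    using assms by (rule ring_hom_1.algebra_eval)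
  show ?thesis
    by (simp add: mp_eval_eq_meval mp_var_def)
qed

lemma mp_eval_of_const [simp]:
  assumes "ring_hom_1 \<kappa>"
  shows "mp_eval \<kappa> g (Poly_Mapping.single 0 c) = \<kappa> c"
proof -
  interpret algebra_eval \<kappa> "mon_eval g"
    using assms by (rule ring_hom_1.algebra_eval)
  show ?thesis
    by (simp add: mp_eval_eq_meval)
qed

context ring_hom_1
begin

lemma \<kappa>_minus: "\<kappa> (- c) = - \<kappa> c"
  using \<kappa>_add[of c "-c"] by (simp add: eq_neg_iff_add_eq_0 add.commute)

lemma \<kappa>_diff: "\<kappa> (c - d) = \<kappa> c - \<kappa> d"
  using \<kappa>_add[of c "-d"] by (simp add: \<kappa>_minus)

lemma \<kappa>_sum: "\<kappa> (sum f I) = (\<Sum>i\<in>I. \<kappa> (f i))"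
  by (induction I rule: infinite_finite_induct) (simp_all add: \<kappa>_add)

lemma \<kappa>_prod: "\<kappa> (prod f I) = (\<Prod>i\<in>I. \<kappa> (f i))"
  by (induction I rule: infinite_finite_induct) (simp_all add: \<kappa>_mult \<kappa>_one)

lemma \<kappa>_power: "\<kappa> (c ^ n) = \<kappa> c ^ n"
  by (induction n) (simp_all add: \<kappa>_mult \<kappa>_one)

lemma \<kappa>_of_nat: "\<kappa> (of_nat n) = of_nat n"
  by (induction n) (simp_all add: \<kappa>_add \<kappa>_one)

lemmas hom_simps = zero \<kappa>_add \<kappa>_mult \<kappa>_one \<kappa>_minus \<kappa>_diff \<kappa>_sum \<kappa>_prod \<kappa>_power \<kappa>_of_nat

end

lemmas mp_subst_simps = ring_hom_1.hom_simps[OF ring_hom_1_mp_subst]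
lemmas mp_value_simps = ring_hom_1.hom_simps[OF ring_hom_1_mp_value]

lemma mp_subst_of_var [simp]: "mp_subst g (mp_var i) = g i"
  by (simp add: mp_subst_def ring_hom_1_const)

lemma mp_subst_of_const [simp]: "mp_subst g (Poly_Mapping.single 0 c) = Poly_Mapping.single 0 c"
  by (simp add: mp_subst_def ring_hom_1_const)

lemma mp_value_of_var [simp]: "mp_value (mp_var i) x = x i"
  by (simp add: mp_value_def ring_hom_1_id)

lemma mp_value_of_const [simp]: "mp_value (Poly_Mapping.single 0 c) x = c"
  by (simp add: mp_value_def ring_hom_1_id)

lemma hom_mp_subst:
  assumes "ring_hom_1 \<phi>"
  shows "\<phi> (mp_subst g p) = mp_eval (\<lambda>c. \<phi> (Poly_Mapping.single 0 c)) (\<lambda>i. \<phi> (g i)) p"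
  unfolding mp_subst_def by (rule mp_eval_comp[OF assms ring_hom_1_const])

lemma mp_subst_mp_subst: "mp_subst g (mp_subst g' p) = mp_subst (\<lambda>i. mp_subst g (g' i)) p"
  using hom_mp_subst[OF ring_hom_1_mp_subst, of g g' p] by (simp add: mp_subst_def[of _ p])

lemma mp_value_mp_subst: "mp_value (mp_subst g p) x = mp_value p (\<lambda>i. mp_value (g i) x)"
  using hom_mp_subst[OF ring_hom_1_mp_value, of g p x] by (simp add: mp_value_def[of p])

lemma mp_subst_cong:
  "vars_in V p \<Longrightarrow> (\<And>i. i \<in> V \<Longrightarrow> g i = g' i) \<Longrightarrow> mp_subst g p = mp_subst g' p"
  unfolding mp_subst_def by (rule vars_in_cong)

lemma mp_value_cong:
  "vars_in V p \<Longrightarrow> (\<And>i. i \<in> V \<Longrightarrow> x i = y i) \<Longrightarrow> mp_value p x = mp_value p y"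
  unfolding mp_value_def by (rule vars_in_cong)

text \<open>The polynomial is regarded as univariate in \<open>mp_var v\<close> over the domain
  \<open>mpoly\<close>, which makes root counting and synthetic division available.\<close>

definition expand_var :: "nat \<Rightarrow> mpoly \<Rightarrow> mpoly poly"
  where "expand_var v = mp_eval (\<lambda>c. [:Poly_Mapping.single 0 c:]) (\<lambda>i. if i = v then [:0, 1:] else [:mp_var i:])"

lemma ring_hom_1_poly_const: "ring_hom_1 (\<lambda>c. [:Poly_Mapping.single 0 c :: mpoly:])"
  by (rule ring_hom_1_comp[OF ring_hom_1_pCons ring_hom_1_const])

lemma ring_hom_1_expand_var: "ring_hom_1 (expand_var v)"
  unfolding expand_var_def by (rule ring_hom_1_mp_eval[OF ring_hom_1_poly_const])

lemma ring_hom_1_poly: "ring_hom_1 (\<lambda>p. poly p (x::'a::comm_ring_1))"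
  by unfold_locales simp_all

lemma poly_expand_var: "poly (expand_var v p) s = mp_subst (mp_var(v := s)) p"
proof -
  have "poly (expand_var v p) s
      = mp_eval (\<lambda>c. poly [:Poly_Mapping.single 0 c:] s) (\<lambda>i. poly (if i = v then [:0, 1:] else [:mp_var i:]) s) p"
    unfolding expand_var_def by (rule mp_eval_comp[OF ring_hom_1_poly ring_hom_1_poly_const])
  also have "\<dots> = mp_subst (mp_var(v := s)) p"
    unfolding mp_subst_def
    by (simp add: if_distrib[of "\<lambda>q. poly q s"] fun_upd_def cong: if_cong)
  finally show ?thesis .
qed

lemma poly_expand_var_self: "poly (expand_var v p) (mp_var v) = p"
  by (simp add: poly_expand_var mp_subst_var)

lemma vars_in_coeff_expand_var:
  assumes "vars_in V p"
  shows "vars_in (V - {v}) (coeff (expand_var v p) k)"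
  using assms
proof (induction arbitrary: k rule: mp_poly_induct)
  case (const c)
  then show ?case
    by (simp add: expand_var_def ring_hom_1_poly_const coeff_pCons split: nat.split)
next
  case (var i)
  then show ?case
    by (auto simp add: expand_var_def ring_hom_1_poly_const coeff_pCons split: nat.split)
next
  case (add p q)
  then show ?case
    by (simp add: ring_hom_1.\<kappa>_add[OF ring_hom_1_expand_var] vars_in_add)
next
  case (mult p q)
  then show ?case
    by (auto simp: ring_hom_1.\<kappa>_mult[OF ring_hom_1_expand_var] coeff_mult intro!: vars_in_sum vars_in_mult)
qed

lemma poly_map_poly_hom:
  assumes "ring_hom_1 \<phi>"
  shows "poly (map_poly \<phi> p) (\<phi> x) = \<phi> (poly p x)"
proof -
  interpret ring_hom_1 \<phi> by fact
  show ?thesis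
    by (induction p) (simp_all add: map_poly_pCons hom_simps)
qed

lemma mp_zero_by_last_var:
  assumes "vars_in (insert v V) f" "v \<notin> V"
    and inf: "\<And>x. x \<in> A \<Longrightarrow> infinite {t. mp_value f (x(v := t)) = 0}"
    and zero: "\<And>g. vars_in V g \<Longrightarrow> (\<And>x. x \<in> A \<Longrightarrow> mp_value g x = 0) \<Longrightarrow> g = 0"
  shows "f = 0"
proof -
  have "coeff (expand_var v f) k = 0" for k
  proof (rule zero)
    show "vars_in V (coeff (expand_var v f) k)"
      using vars_in_mono[OF vars_in_coeff_expand_var[OF assms(1), of v k], of V] by blast
  next
    fix x assume x: "x \<in> A"
    let ?q = "map_poly (\<lambda>p. mp_value p x) (expand_var v f)"
    have val: "poly ?q t = mp_value f (x(v := t))" for t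
    proof -
      have "poly ?q t = mp_value (poly (expand_var v f) (Poly_Mapping.single 0 t)) x"
        using poly_map_poly_hom[OF ring_hom_1_mp_value, of x "expand_var v f" "Poly_Mapping.single 0 t"]
        by simp
      also have "\<dots> = mp_value f (\<lambda>i. mp_value ((mp_var(v := Poly_Mapping.single 0 t)) i) x)"
        by (simp only: poly_expand_var mp_value_mp_subst)
      also have "(\<lambda>i. mp_value ((mp_var(v := Poly_Mapping.single 0 t)) i) x) = x(v := t)"
        by (auto simp: fun_eq_iff)
      finally show ?thesis .
    qed
    have "?q = 0"
      using inf[OF x] poly_roots_finite[of ?q] by (auto simp: val)
    then show "mp_value (coeff (expand_var v f) k) x = 0"
      using coeff_map_poly[of "\<lambda>p. mp_value p x" "expand_var v f" k] by (simp add: mp_value_simps)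
  qed
  then have "expand_var v f = 0"
    by (simp add: poly_eq_iff)
  then show ?thesis
    using poly_expand_var_self[of v f] by simp
qed

lemma mp_value_eq_zeroD:
  assumes "finite V" "vars_in V f" "\<And>x. mp_value f x = 0"
  shows "f = 0"
  using assms
proof (induction V arbitrary: f rule: finite_induct)
  case empty
  then have "Poly_Mapping.keys f \<subseteq> {0}"
    by (auto simp: vars_in_def)
  have "f = Poly_Mapping.single 0 (Poly_Mapping.lookup f 0)"
  proof (rule poly_mapping_eqI)
    fix a
    show "Poly_Mapping.lookup f a = Poly_Mapping.lookup (Poly_Mapping.single 0 (Poly_Mapping.lookup f 0)) a"
      using \<open>Poly_Mapping.keys f \<subseteq> {0}\<close> not_in_keys_iff_lookup_eq_zero[of a f]
      by (cases "a = 0") (auto simp: lookup_single_not_eq)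
  qed
  then obtain c where "f = Poly_Mapping.single 0 c"
    by blast
  then show ?case
    using empty(2)[of "\<lambda>_. 0"] by simp
next
  case (insert v V)
  show ?case
  proof (rule mp_zero_by_last_var)
    show "vars_in (Set.insert v V) f" "v \<notin> V"
      using insert by auto
    show "infinite {t. mp_value f (x(v := t)) = 0}" if "x \<in> UNIV" for x
      using insert.prems by (simp add: infinite_UNIV_char_0)
    show "g = 0" if "vars_in V g" "\<And>x. x \<in> UNIV \<Longrightarrow> mp_value g x = 0" for g
      using insert.IH that by simp
  qed
qed

lemma finite_vars: "\<exists>V. finite V \<and> vars_in V f"
  by (rule exI[of _ "\<Union>a\<in>Poly_Mapping.keys f. Poly_Mapping.keys a"]) (auto simp: vars_in_def)

lemma mp_value_eqD:
  assumes "\<And>x. mp_value f x = mp_value g x"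
  shows "f = g"
  using finite_vars[of "f - g"] mp_value_eq_zeroD[of _ "f - g"] assms by (auto simp: mp_value_simps)

section \<open>Weighted degree\<close>

definition mon_weight :: "(nat \<Rightarrow> nat) \<Rightarrow> (nat \<Rightarrow>\<^sub>0 nat) \<Rightarrow> nat"
  where "mon_weight w a = (\<Sum>i\<in>Poly_Mapping.keys a. w i * Poly_Mapping.lookup a i)"

lemma mon_weight_superset:
  assumes "finite S" "Poly_Mapping.keys a \<subseteq> S"
  shows "mon_weight w a = (\<Sum>i\<in>S. w i * Poly_Mapping.lookup a i)"
  unfolding mon_weight_def using assms by (intro sum.mono_neutral_left) (auto simp: not_in_keys_iff_lookup_eq_zero)

lemma mon_weight_zero [simp]: "mon_weight w 0 = 0"
  by (simp add: mon_weight_def)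

lemma mon_weight_single [simp]: "mon_weight w (Poly_Mapping.single i k) = w i * k"
  by (cases "k = 0") (simp_all add: mon_weight_def)

lemma mon_weight_add: "mon_weight w (a + b) = mon_weight w a + mon_weight w b"
proof -
  let ?S = "Poly_Mapping.keys a \<union> Poly_Mapping.keys b"
  have "mon_weight w (a + b) = (\<Sum>i\<in>?S. w i * Poly_Mapping.lookup (a + b) i)"
    by (rule mon_weight_superset) (use Poly_Mapping.keys_add[of a b] in auto)
  also have "\<dots> = mon_weight w a + mon_weight w b"
    by (simp add: mon_weight_superset[of ?S a] mon_weight_superset[of ?S b] lookup_add distrib_left
        sum.distrib)
  finally show ?thesis .
qed

text \<open>The weight \<open>\<lambda>_. 1\<close> measures total degree;
  \<open>\<lambda>i. i\<close> measures the filtration degree of a polynomial in generators whose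
  \<open>k\<close>-th one has degree \<open>k\<close>.\<close>

definition weight_le :: "(nat \<Rightarrow> nat) \<Rightarrow> nat \<Rightarrow> mpoly \<Rightarrow> bool"
  where "weight_le w m p \<longleftrightarrow> (\<forall>a\<in>Poly_Mapping.keys p. mon_weight w a \<le> m)"

lemma weight_le_mono: "weight_le w m p \<Longrightarrow> m \<le> k \<Longrightarrow> weight_le w k p"
  by (auto simp: weight_le_def)

lemma weight_le_const [simp]: "weight_le w m (Poly_Mapping.single 0 c)"
  by (simp add: weight_le_def)

lemma weight_le_zero [simp]: "weight_le w m 0"
  by (simp add: weight_le_def)

lemma weight_le_one [simp]: "weight_le w m 1"
  by (simp add: weight_le_def)

lemma weight_le_of_nat [simp]: "weight_le w m (of_nat k)"
  by (metis single_of_nat weight_le_const)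

lemma weight_le_var [simp]: "weight_le w m (mp_var i) \<longleftrightarrow> w i \<le> m"
  by (simp add: weight_le_def mp_var_def)

lemma weight_le_add: "weight_le w m p \<Longrightarrow> weight_le w m q \<Longrightarrow> weight_le w m (p + q)"
  using Poly_Mapping.keys_add[of p q] by (auto simp: weight_le_def)

lemma weight_le_diff: "weight_le w m p \<Longrightarrow> weight_le w m q \<Longrightarrow> weight_le w m (p - q)"
  using weight_le_add[of w m p "-q"] by (simp add: weight_le_def)

lemma weight_le_mult:
  assumes "weight_le w m p" "weight_le w k q"
  shows "weight_le w (m + k) (p * q)"
  unfolding weight_le_def
proof
  fix a assume "a \<in> Poly_Mapping.keys (p * q)"
  then obtain b d where "b \<in> Poly_Mapping.keys p" "d \<in> Poly_Mapping.keys q" "a = b + d"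
    using keys_mult[of p q] by blast
  then show "mon_weight w a \<le> m + k"
    using assms by (auto simp: mon_weight_add weight_le_def intro: add_mono)
qed

lemma weight_le_sum: "(\<And>i. i \<in> I \<Longrightarrow> weight_le w m (f i)) \<Longrightarrow> weight_le w m (sum f I)"
  by (induction I rule: infinite_finite_induct) (auto intro: weight_le_add)

lemma weight_le_prod:
  "(\<And>i. i \<in> I \<Longrightarrow> weight_le w (d i) (f i)) \<Longrightarrow> weight_le w (\<Sum>i\<in>I. d i) (prod f I)"
  by (induction I rule: infinite_finite_induct) (auto intro: weight_le_mult)

lemma weight_le_power: "weight_le w m p \<Longrightarrow> weight_le w (m * n) (p ^ n)"
  by (induction n) (auto intro: weight_le_mult)

lemma weight_le_mp_subst:
  assumes "weight_le w m p" "vars_in V p" "\<And>i. i \<in> V \<Longrightarrow> weight_le u (w i) (g i)"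
  shows "weight_le u m (mp_subst g p)"
  unfolding mp_subst_def mp_eval_def
proof (intro weight_le_sum)
  fix a assume a: "a \<in> Poly_Mapping.keys p"
  have "weight_le u (0 + (\<Sum>i\<in>Poly_Mapping.keys a. w i * Poly_Mapping.lookup a i))
     (Poly_Mapping.single 0 (Poly_Mapping.lookup p a) * (\<Prod>i\<in>Poly_Mapping.keys a. g i ^ Poly_Mapping.lookup a i))"
    using assms(2,3) a
    by (intro weight_le_mult weight_le_const weight_le_prod weight_le_power) (auto simp: vars_in_def)
  then show "weight_le u m (Poly_Mapping.single 0 (Poly_Mapping.lookup p a)
      * (\<Prod>i\<in>Poly_Mapping.keys a. g i ^ Poly_Mapping.lookup a i))"
    using assms(1) a by (elim weight_le_mono) (auto simp: weight_le_def mon_weight_def)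
qed

text \<open>The homogenisation \<open>x\<^sub>i \<mapsto> x\<^sub>i t\<close>, whose degree in \<open>t\<close> is the total degree.\<close>

definition homog :: "mpoly \<Rightarrow> mpoly poly"
  where "homog = mp_eval (\<lambda>c. [:Poly_Mapping.single 0 c:]) (\<lambda>i. monom (mp_var i) 1)"

lemma ring_hom_1_homog: "ring_hom_1 homog"
  unfolding homog_def by (rule ring_hom_1_mp_eval[OF ring_hom_1_poly_const])

lemma mon_eval_homog:
  "mon_eval (\<lambda>i. monom (mp_var i) 1) a = monom (Poly_Mapping.single a 1) (mon_weight (\<lambda>_. 1) a)"
proof (induction a rule: monomial_induct[OF subset_UNIV])
  case (2 i)
  then show ?case by (simp add: mp_var_def)
next
  case (3 a b)
  then show ?case by (simp add: mon_eval_add mon_weight_add mult_monom mult_single)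
qed (simp add: monom_0 one_pCons)

lemma coeff_homog:
  "coeff (homog p) k =
    (\<Sum>a | a \<in> Poly_Mapping.keys p \<and> mon_weight (\<lambda>_. 1) a = k. Poly_Mapping.single a (Poly_Mapping.lookup p a))"
proof -
  have "coeff (homog p) k = (\<Sum>a\<in>Poly_Mapping.keys p.
      if mon_weight (\<lambda>_. 1) a = k then Poly_Mapping.single a (Poly_Mapping.lookup p a) else 0)"
    unfolding homog_def mp_eval_eq_meval meval_def mon_eval_homog coeff_sum
    by (intro sum.cong refl) (simp add: mult_single)
  then show ?thesis
    by (simp add: sum.inter_filter)
qed

lemma lookup_coeff_homog:
  "Poly_Mapping.lookup (coeff (homog p) k) a = (if mon_weight (\<lambda>_. 1) a = k then Poly_Mapping.lookup p a else 0)"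
proof -
  let ?S = "{a \<in> Poly_Mapping.keys p. mon_weight (\<lambda>_. 1) a = k}"
  have "Poly_Mapping.lookup (coeff (homog p) k) a = (\<Sum>b\<in>?S. if b = a then Poly_Mapping.lookup p b else 0)"
    unfolding coeff_homog lookup_sum lookup_single when_def by (rule refl)
  also have "\<dots> = (if a \<in> ?S then Poly_Mapping.lookup p a else 0)"
    by (rule sum.delta) simp
  also have "\<dots> = (if mon_weight (\<lambda>_. 1) a = k then Poly_Mapping.lookup p a else 0)"
    using not_in_keys_iff_lookup_eq_zero[of a p] by auto
  finally show ?thesis .
qed

lemma weight_le_iff_degree: "weight_le (\<lambda>_. 1) m p \<longleftrightarrow> degree (homog p) \<le> m"
proof
  assume *: "weight_le (\<lambda>_. 1) m p"
  show "degree (homog p) \<le> m"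
  proof (rule degree_le, intro allI impI poly_mapping_eqI)
    fix k a assume "m < k"
    then show "Poly_Mapping.lookup (coeff (homog p) k) a = Poly_Mapping.lookup 0 a"
      using * not_in_keys_iff_lookup_eq_zero[of a p] by (auto simp: lookup_coeff_homog weight_le_def)
  qed
next
  assume *: "degree (homog p) \<le> m"
  show "weight_le (\<lambda>_. 1) m p"
    unfolding weight_le_def
  proof
    fix a assume a: "a \<in> Poly_Mapping.keys p"
    then have "Poly_Mapping.lookup (coeff (homog p) (mon_weight (\<lambda>_. 1) a)) a \<noteq> 0"
      by (simp add: lookup_coeff_homog lookup_not_eq_zero_eq_in_keys)
    then show "mon_weight (\<lambda>_. 1) a \<le> m"
      using * by (metis coeff_eq_0 lookup_zero not_le order.strict_trans1)
  qed
qed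

lemma homog_eq_zero_iff [simp]: "homog p = 0 \<longleftrightarrow> p = 0"
proof
  assume "homog p = 0"
  then have "Poly_Mapping.lookup p a = 0" for a
    using lookup_coeff_homog[of p "mon_weight (\<lambda>_. 1) a" a] by simp
  then show "p = 0"
    by (intro poly_mapping_eqI) simp
qed (simp add: homog_def ring_hom_1_poly_const)

text \<open>\<open>homog\<close> is multiplicative with values in polynomials over a domain, so
  total degrees add exactly. This equality later bounds the degree of a quotient.\<close>

lemma degree_homog_mult: "f \<noteq> 0 \<Longrightarrow> g \<noteq> 0 \<Longrightarrow> degree (homog (f * g)) = degree (homog f) + degree (homog g)"
  by (simp add: ring_hom_1.\<kappa>_mult[OF ring_hom_1_homog] degree_mult_eq)

lemma Lambda_star_filt_weight:
  "Lambda_star_filt n m = {f \<in> carrier (Lambda_star n). weight_le (\<lambda>_. 1) m f}"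
  by (simp add: Lambda_star_filt_def weight_le_def mon_weight_def)

text \<open>Synthetic division at the root \<open>- s\<close>, followed by the check that the
  quotient brings in no new variables.\<close>

lemma mp_root_factor:
  assumes "vars_in V f" "mp_subst (mp_var(v := - s)) f = 0" "vars_in V s" "v \<in> V"
  obtains g where "f = (mp_var v + s) * g" "vars_in V g"
proof -
  let ?q = "synthetic_div (expand_var v f) (- s)"
  have ex: "expand_var v f = [:s, 1:] * ?q"
    using synthetic_div_correct'[of "- s" "expand_var v f"] assms(2) by (simp add: poly_expand_var)
  have "f = poly (expand_var v f) (mp_var v)"
    by (simp add: poly_expand_var_self)
  also have "\<dots> = (mp_var v + s) * poly ?q (mp_var v)"
    by (subst ex) (simp add: algebra_simps)
  finally have f: "f = (mp_var v + s) * poly ?q (mp_var v)" .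
  \<comment> \<open>The coefficients of the quotient are Horner values of the tails of the dividend
    at \<open>- s\<close>.\<close>
  have deg: "vars_in V (coeff (synthetic_div q (- s)) k)"
    if "\<And>k. vars_in V (coeff q k)" for q k
    using that
  proof (induction q arbitrary: k)
    case (pCons a q)
    have q: "vars_in V (coeff q k)" for k
      using pCons.prems[of "Suc k"] by simp
    have "vars_in V (poly q (- s))"
      unfolding poly_altdef
      by (intro vars_in_sum vars_in_mult vars_in_power vars_in_minus q assms(3))
    then show ?case
      using pCons.IH[OF q] by (auto simp: coeff_pCons split: nat.split)
  qed simp
  have "vars_in V (poly ?q (mp_var v))"
    unfolding poly_altdef
    by (intro vars_in_sum vars_in_mult vars_in_power deg vars_in_mono[OF vars_in_coeff_expand_var[OF assms(1)]])
      (auto simp: assms(4))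
  with f that show ?thesis by blast
qed

section \<open>Shifted symmetric polynomials\<close>

definition shift_swap :: "nat \<Rightarrow> nat \<Rightarrow> nat \<Rightarrow> mpoly"
  where "shift_swap c i = mp_var(i := mp_var (Suc i) - of_nat c, Suc i := mp_var i + of_nat c)"

text \<open>For \<open>c = 0\<close> these are the symmetric, for \<open>c = 1\<close> the shifted symmetric polynomials.\<close>

definition shift_sym :: "nat \<Rightarrow> nat \<Rightarrow> mpoly \<Rightarrow> bool"
  where "shift_sym c n f \<longleftrightarrow> vars_in {1..n} f \<and> (\<forall>i\<in>{1..<n}. mp_subst (shift_swap c i) f = f)"

lemma carrier_Lambda_star: "carrier (Lambda_star n) = {f. shift_sym 1 n f}"
  by (simp add: Lambda_star_def monoid_subalg_def shift_sym_def vars_in_def shift_swap_def)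

lemma shift_symI:
  "vars_in {1..n} f \<Longrightarrow> (\<And>i. 1 \<le> i \<Longrightarrow> i < n \<Longrightarrow> mp_subst (shift_swap c i) f = f) \<Longrightarrow> shift_sym c n f"
  by (simp add: shift_sym_def)

lemma shift_sym_swap: "shift_sym c n f \<Longrightarrow> 1 \<le> i \<Longrightarrow> i < n \<Longrightarrow> mp_subst (shift_swap c i) f = f"
  by (simp add: shift_sym_def)

lemma shift_sym_const [simp]: "shift_sym c n (Poly_Mapping.single 0 d)"
  by (simp add: shift_sym_def)

lemma shift_sym_add: "shift_sym c n f \<Longrightarrow> shift_sym c n g \<Longrightarrow> shift_sym c n (f + g)"
  by (simp add: shift_sym_def mp_subst_simps vars_in_add)

lemma shift_sym_diff: "shift_sym c n f \<Longrightarrow> shift_sym c n g \<Longrightarrow> shift_sym c n (f - g)"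
  by (simp add: shift_sym_def mp_subst_simps vars_in_diff)

lemma shift_sym_mult: "shift_sym c n f \<Longrightarrow> shift_sym c n g \<Longrightarrow> shift_sym c n (f * g)"
  by (simp add: shift_sym_def mp_subst_simps vars_in_mult)

lemma shift_sym_mp_subst:
  assumes "vars_in V P" "\<And>k. k \<in> V \<Longrightarrow> shift_sym c n (g k)"
  shows "shift_sym c n (mp_subst g P)"
  using assms(1)
  by (induction rule: mp_poly_induct) (simp_all add: mp_subst_simps shift_sym_add shift_sym_mult assms(2))

lemma shift_swap_other: "j \<noteq> i \<Longrightarrow> j \<noteq> Suc i \<Longrightarrow> shift_swap c i j = mp_var j"
  by (simp add: shift_swap_def)

definition shift_all :: "nat \<Rightarrow> mpoly \<Rightarrow> mpoly"
  where "shift_all c = mp_subst (\<lambda>i. mp_var i + of_nat c)"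

text \<open>Recursion on the last variable. In a product ending with \<open>mp_var (Suc n)\<close>
  the other factors stand one place further from the end and are shifted by a further
  \<open>c\<close>. For \<open>c = 1\<close> these are the polynomials
  \<open>e_star\<close>.\<close>

fun shift_elem :: "nat \<Rightarrow> nat \<Rightarrow> nat \<Rightarrow> mpoly" where
  "shift_elem c n 0 = 1"
| "shift_elem c 0 (Suc k) = 0"
| "shift_elem c (Suc n) (Suc k) = shift_elem c n (Suc k) + mp_var (Suc n) * shift_all c (shift_elem c n k)"

lemma shift_all_simps:
  "shift_all c 0 = 0" "shift_all c 1 = 1" "shift_all c (f + g) = shift_all c f + shift_all c g"
  "shift_all c (f * g) = shift_all c f * shift_all c g" "shift_all c (mp_var i) = mp_var i + of_nat c"
  by (simp_all add: shift_all_def mp_subst_simps)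

lemma vars_in_shift_all: "vars_in V f \<Longrightarrow> vars_in V (shift_all c f)"
  unfolding shift_all_def by (erule vars_in_mp_subst) (simp add: vars_in_add)

lemma weight_le_shift_all: "weight_le (\<lambda>_. 1) m f \<Longrightarrow> weight_le (\<lambda>_. 1) m (shift_all c f)"
  unfolding shift_all_def by (erule weight_le_mp_subst[where V = UNIV]) (auto simp: vars_in_def intro: weight_le_add)

lemma shift_elem_eq_0: "n < k \<Longrightarrow> shift_elem c n k = 0"
  by (induction c n k rule: shift_elem.induct) (simp_all add: shift_all_simps)

lemma vars_in_shift_elem: "vars_in {1..n} (shift_elem c n k)"
proof (induction c n k rule: shift_elem.induct)
  case (3 c n k)
  have "{1..n} \<subseteq> {1..Suc n}"
    by auto
  then show ?case
    using 3 by (auto intro!: vars_in_add vars_in_mult vars_in_shift_all elim: vars_in_mono)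
qed simp_all

lemma weight_le_shift_elem: "weight_le (\<lambda>_. 1) k (shift_elem c n k)"
proof (induction c n k rule: shift_elem.induct)
  case (3 c n k)
  have "weight_le (\<lambda>_. 1) (1 + k) (mp_var (Suc n) * shift_all c (shift_elem c n k))"
    by (intro weight_le_mult weight_le_shift_all 3) simp
  then show ?case
    using 3 by (auto intro!: weight_le_add)
qed simp_all

lemma mp_subst_swap_shift_all:
  assumes "mp_subst (shift_swap c i) f = f"
  shows "mp_subst (shift_swap c i) (shift_all c f) = shift_all c f"
proof -
  have "mp_subst (shift_swap c i) (shift_all c f) = shift_all c (mp_subst (shift_swap c i) f)"
    unfolding shift_all_def mp_subst_mp_subst
    by (rule arg_cong[where f = "\<lambda>g. mp_subst g f"]) (auto simp: fun_eq_iff shift_swap_def mp_subst_simps)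
  with assms show ?thesis
    by simp
qed

lemma mp_subst_swap_id:
  assumes "vars_in {1..n} f" "n < i"
  shows "mp_subst (shift_swap c i) f = f"
  using mp_subst_cong[OF assms(1), of "shift_swap c i" mp_var] assms(2)
  by (auto simp: shift_swap_def mp_subst_var)

text \<open>By the recursion only the exchange of the two last variables is new. Unfolding twice
  shows them in the combinations \<open>mp_var n + mp_var (Suc n)\<close> and
  \<open>mp_var (Suc n) * (mp_var n + of_nat c)\<close>, both of which are invariant.\<close>

lemma shift_elem_swap: "1 \<le> i \<Longrightarrow> i < n \<Longrightarrow> mp_subst (shift_swap c i) (shift_elem c n k) = shift_elem c n k"
proof (induction n arbitrary: k)
  case (Suc n)
  show ?case
  proof (cases k)
    case (Suc l)
    show ?thesis
    proof (cases "i < n")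
      case True
      then show ?thesis
        using Suc.IH[of "Suc l"] mp_subst_swap_shift_all[OF Suc.IH[of l]] Suc.prems Suc
        by (simp add: mp_subst_simps shift_swap_other)
    next
      case False
      obtain n' where n': "n = Suc n'"
        using Suc.prems by (cases n) auto
      with False Suc.prems have n: "n = Suc n'" "i = Suc n'"
        by auto
      have inv: "mp_subst (shift_swap c i) (shift_elem c n' j) = shift_elem c n' j" for j
        by (rule mp_subst_swap_id[OF vars_in_shift_elem]) (simp add: n)
      note inv1 = mp_subst_swap_shift_all[OF inv]
      note inv2 = mp_subst_swap_shift_all[OF inv1]
      have v: "shift_swap c i (Suc n) = mp_var n + of_nat c" "shift_swap c i n = mp_var (Suc n) - of_nat c"
        by (simp_all add: n shift_swap_def)
      show ?thesis
      proof (cases l)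
        case 0
        then show ?thesis
          using v inv[of 1] by (simp add: Suc n mp_subst_simps shift_all_simps)
      next
        case (Suc l')
        have "shift_elem c (Suc n) k = shift_elem c n' k
            + (mp_var n + mp_var (Suc n)) * shift_all c (shift_elem c n' l)
            + mp_var (Suc n) * (mp_var n + of_nat c) * shift_all c (shift_all c (shift_elem c n' l'))"
          by (simp add: \<open>k = Suc l\<close> Suc n shift_all_simps algebra_simps)
        moreover have "mp_subst (shift_swap c i) \<dots> = \<dots>"
          by (simp add: mp_subst_simps inv inv1 inv2 v algebra_simps)
        ultimately show ?thesis
          by simp
      qed
    qed
  qed (simp add: mp_subst_simps)
qed simp

lemma shift_sym_shift_elem [simp]: "shift_sym c n (shift_elem c n k)"
  by (intro shift_symI vars_in_shift_elem shift_elem_swap)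

text \<open>Immediate from the recursion, and the reason why \<open>Lambda_star_proj\<close> carries
  generators to generators, the last one to zero.\<close>

lemma shift_elem_last_zero: "mp_subst (mp_var(Suc n := 0)) (shift_elem c (Suc n) k) = shift_elem c n k"
proof (cases k)
  case (Suc l)
  have "mp_subst (mp_var(Suc n := 0)) (shift_elem c n k) = mp_subst mp_var (shift_elem c n k)"
    by (rule mp_subst_cong[OF vars_in_shift_elem]) auto
  then show ?thesis
    using Suc by (simp add: mp_subst_simps mp_subst_var)
qed (simp add: mp_subst_simps)

lemma shift_elem_top: "shift_elem c n n = (\<Prod>i=1..n. mp_var i + of_nat (c * (n - i)))"
proof (induction n)
  case (Suc n)
  have "shift_all c (\<Prod>i=1..n. mp_var i + of_nat (c * (n - i))) = (\<Prod>i=1..n. mp_var i + of_nat (c * (Suc n - i)))"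
    unfolding shift_all_def mp_subst_simps
    by (intro prod.cong refl) (simp add: Suc_diff_le mp_subst_simps add.assoc del: of_nat_diff)
  then show ?case
    using Suc by (simp add: shift_elem_eq_0 mult.commute)
qed simp

lemma single_eq_0_iff: "Poly_Mapping.single a c = 0 \<longleftrightarrow> c = 0"
  by (metis lookup_single_eq lookup_zero single_zero)

lemma not_weight_le_0_linear: "\<not> weight_le (\<lambda>_. 1) 0 (mp_var i + of_nat k)"
proof -
  have "Poly_Mapping.lookup (mp_var i + of_nat k) (Poly_Mapping.single i 1) = 1"
    unfolding mp_var_def lookup_add lookup_of_nat
    by (simp add: when_def single_eq_0_iff)
  then have "Poly_Mapping.single i 1 \<in> Poly_Mapping.keys (mp_var i + of_nat k)"
    using lookup_not_eq_zero_eq_in_keys[of "mp_var i + of_nat k" "Poly_Mapping.single i 1"] by simp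
  then show ?thesis
    unfolding weight_le_def by force
qed

lemma linear_neq_0: "mp_var i + of_nat k \<noteq> (0::mpoly)"
  using not_weight_le_0_linear[of i k] by auto

lemma mp_var_neq_0 [simp]: "mp_var i \<noteq> 0"
  using linear_neq_0[of i 0] by simp

lemma degree_homog_prod_linear:
  "finite I \<Longrightarrow> degree (homog (\<Prod>i\<in>I. mp_var i + of_nat (d i))) \<ge> card I"
proof (induction I rule: finite_induct)
  case (insert i I)
  have "\<not> degree (homog (mp_var i + of_nat (d i))) \<le> 0"
    using not_weight_le_0_linear[of i "d i"] unfolding weight_le_iff_degree .
  then show ?case
    using insert by (simp add: degree_homog_mult linear_neq_0)
qed simp

text \<open>The zero at the last variable travels downwards: on the locus where variable
  \<open>i\<close> equals \<open>- c * (n - i)\<close>, the shifted exchange puts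
  \<open>- c * (n - Suc i)\<close> into position \<open>Suc i\<close>.\<close>

lemma shift_sym_vanish:
  assumes "shift_sym c n f" "mp_subst (mp_var(n := 0)) f = 0" "1 \<le> i" "i \<le> n"
  shows "mp_subst (mp_var(i := - of_nat (c * (n - i)))) f = 0"
  using assms(4,3)
proof (induction rule: inc_induct)
  case base
  then show ?case
    using assms(2) by (simp add: fun_upd_def)
next
  case (step i)
  let ?r = "\<lambda>i. - of_nat (c * (n - i)) :: mpoly"
  let ?h = "\<lambda>j. mp_subst (mp_var(i := ?r i)) (shift_swap c i j)"
  have "mp_subst (mp_var(i := ?r i)) f = mp_subst (mp_var(i := ?r i)) (mp_subst (shift_swap c i) f)"
    using shift_sym_swap[OF assms(1)] step by simp
  also have "\<dots> = mp_subst ?h f"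
    by (rule mp_subst_mp_subst)
  also have "\<dots> = mp_subst ?h (mp_subst (mp_var(Suc i := ?r (Suc i))) f)"
  proof -
    have "n - i = Suc (n - Suc i)"
      using step by simp
    then show ?thesis
      unfolding mp_subst_mp_subst
      by (intro arg_cong[where f = "\<lambda>g. mp_subst g f"])
        (auto simp: fun_eq_iff shift_swap_def mp_subst_simps algebra_simps)
  qed
  also have "mp_subst (mp_var(Suc i := ?r (Suc i))) f = 0"
    by (rule step.IH) simp
  finally show ?case
    by (simp only: mp_subst_simps)
qed

text \<open>Each variable contributes one linear factor from its root, and the product of these
  factors is the top function \<open>shift_elem c n n\<close>. The quotient inherits the symmetry by
  cancelling this nonzero invariant factor.\<close>

lemma shift_sym_divide:
  assumes f: "shift_sym c n f" and 0: "mp_subst (mp_var(n := 0)) f = 0"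
  obtains g where "f = shift_elem c n n * g" "shift_sym c n g"
proof -
  let ?l = "\<lambda>i. mp_var i + of_nat (c * (n - i)) :: mpoly"
  have "\<exists>g. f = (\<Prod>i\<in>I. ?l i) * g \<and> vars_in {1..n} g" if "finite I" "I \<subseteq> {1..n}" for I
    using that
  proof (induction I rule: finite_induct)
    case empty
    then show ?case
      using f by (auto simp: shift_sym_def)
  next
    case (insert v I)
    then obtain g where g: "f = (\<Prod>i\<in>I. ?l i) * g" "vars_in {1..n} g"
      by auto
    let ?s = "mp_subst (mp_var(v := - of_nat (c * (n - v))))"
    \<comment> \<open>The factors already split off do not involve variable \<open>v\<close>; the
      substitution keeps them nonzero and so must annihilate the cofactor.\<close>
    have "?s (\<Prod>i\<in>I. ?l i) = (\<Prod>i\<in>I. ?l i)"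
      unfolding mp_subst_simps using insert.hyps by (intro prod.cong refl) (auto simp: mp_subst_simps)
    then have "(\<Prod>i\<in>I. ?l i) * ?s g = 0"
      using shift_sym_vanish[OF f 0, of v] insert.prems g(1)
      by (simp add: mp_subst_simps del: of_nat_mult of_nat_diff)
    moreover have "(\<Prod>i\<in>I. ?l i) \<noteq> 0"
      using insert.hyps by (simp add: linear_neq_0 del: of_nat_mult of_nat_diff)
    ultimately have "?s g = 0"
      by (simp only: mult_eq_0_iff) simp
    then obtain h where "g = ?l v * h" "vars_in {1..n} h"
      by (rule mp_root_factor[OF g(2)]) (use insert.prems in \<open>auto simp del: of_nat_mult of_nat_diff\<close>)
    then show ?case
      using g insert.hyps by (intro exI[of _ h]) (simp add: algebra_simps)
  qed
  from this[of "{1..n}"] obtain g where g: "f = shift_elem c n n * g" "vars_in {1..n} g"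
    by (auto simp: shift_elem_top)
  have "shift_elem c n n \<noteq> 0"
    by (simp add: shift_elem_top linear_neq_0 del: of_nat_mult)
  moreover have "shift_elem c n n * mp_subst (shift_swap c i) g = shift_elem c n n * g"
    if "1 \<le> i" "i < n" for i
    using shift_sym_swap[OF f that] shift_elem_swap[OF that, of c n] by (simp add: g(1) mp_subst_simps)
  ultimately have "shift_sym c n g"
    using g(2) by (intro shift_symI) auto
  with g that show ?thesis
    by blast
qed

lemma shift_sym_last_zero:
  assumes "shift_sym c (Suc n) f"
  shows "shift_sym c n (mp_subst (mp_var(Suc n := 0)) f)"
proof (rule shift_symI)
  show "vars_in {1..n} (mp_subst (mp_var(Suc n := 0)) f)"
    by (rule vars_in_mp_subst[of "{1..Suc n}"]) (use assms in \<open>auto simp: shift_sym_def\<close>)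
  fix i assume i: "1 \<le> i" "i < n"
  have "mp_subst (shift_swap c i) (mp_subst (mp_var(Suc n := 0)) f)
      = mp_subst (mp_var(Suc n := 0)) (mp_subst (shift_swap c i) f)"
    unfolding mp_subst_mp_subst using i
    by (intro arg_cong[where f = "\<lambda>g. mp_subst g f"]) (auto simp: fun_eq_iff shift_swap_def mp_subst_simps)
  then show "mp_subst (shift_swap c i) (mp_subst (mp_var(Suc n := 0)) f) = mp_subst (mp_var(Suc n := 0)) f"
    using shift_sym_swap[OF assms, of i] i by simp
qed

lemma weight_le_last_zero:
  "weight_le (\<lambda>_. 1) m f \<Longrightarrow> weight_le (\<lambda>_. 1) m (mp_subst (mp_var(n := 0)) f)"
  by (erule weight_le_mp_subst[where V = UNIV]) (auto simp: vars_in_def)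

lemma mp_subst_no_vars: "vars_in {} f \<Longrightarrow> mp_subst g f = f"
  using mp_subst_cong[of "{}" f g mp_var] by (simp add: mp_subst_var)

text \<open>Subtracting the lift of the expression found with the last variable set to zero leaves a
  multiple of the top function. As degrees add, the cofactor has degree at most
  \<open>m - Suc n\<close>; this drives the inner induction and also yields the weight bound on
  \<open>P\<close>, hence equality of filtrations and not just generation.\<close>

theorem shift_sym_generated:
  assumes "shift_sym c n f" "weight_le (\<lambda>_. 1) m f"
  shows "\<exists>P. vars_in {1..n} P \<and> weight_le (\<lambda>i. i) m P \<and> f = mp_subst (shift_elem c n) P"
  using assms
proof (induction n arbitrary: m f)
  case 0
  then have f: "vars_in {} f"
    by (simp add: shift_sym_def)
  then have "weight_le (\<lambda>i. i) m f"
    by (auto simp: weight_le_def vars_in_def)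
  then show ?case
    using f mp_subst_no_vars[OF f] by auto
next
  case (Suc n)
  note IHn = Suc.IH
  show ?case
    using Suc.prems
  proof (induction m arbitrary: f rule: less_induct)
    case (less m)
    obtain P where P: "vars_in {1..n} P" "weight_le (\<lambda>i. i) m P"
        "mp_subst (mp_var(Suc n := 0)) f = mp_subst (shift_elem c n) P"
      using IHn[OF shift_sym_last_zero weight_le_last_zero] less.prems by meson
    have P': "vars_in {1..Suc n} P"
      using P(1) by (rule vars_in_mono) auto
    let ?f = "f - mp_subst (shift_elem c (Suc n)) P"
    have "mp_subst (mp_var(Suc n := 0)) ?f = 0"
      by (simp add: mp_subst_simps P(3) mp_subst_mp_subst shift_elem_last_zero)
    moreover have f': "shift_sym c (Suc n) ?f"
      by (intro shift_sym_diff less.prems shift_sym_mp_subst[OF P']) simp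
    ultimately obtain g where g: "?f = shift_elem c (Suc n) (Suc n) * g" "shift_sym c (Suc n) g"
      using shift_sym_divide by blast
    have f_eq: "f = mp_subst (shift_elem c (Suc n)) P + shift_elem c (Suc n) (Suc n) * g"
      using g(1) by (simp add: algebra_simps)
    show ?case
    proof (cases "g = 0")
      case True
      then show ?thesis
        using P(2) P' f_eq by auto
    next
      case False
      have "weight_le (\<lambda>_. 1) m ?f"
        by (intro weight_le_diff less.prems weight_le_mp_subst[OF P(2) P(1)] weight_le_shift_elem)
      then have "degree (homog (shift_elem c (Suc n) (Suc n))) + degree (homog g) \<le> m"
        using False unfolding g(1) weight_le_iff_degree
        by (subst (asm) degree_homog_mult) (auto simp: shift_elem_top linear_neq_0 simp del: of_nat_mult shift_elem.simps)
      moreover have "Suc n \<le> degree (homog (shift_elem c (Suc n) (Suc n)))"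
        using degree_homog_prod_linear[of "{1..Suc n}" "\<lambda>i. c * (Suc n - i)"]
        by (simp add: shift_elem_top del: of_nat_mult shift_elem.simps)
      ultimately have m: "Suc n \<le> m" "weight_le (\<lambda>_. 1) (m - Suc n) g"
        unfolding weight_le_iff_degree by auto
      then obtain Q where Q: "vars_in {1..Suc n} Q" "weight_le (\<lambda>i. i) (m - Suc n) Q"
          "g = mp_subst (shift_elem c (Suc n)) Q"
        using less.IH[of "m - Suc n" g] g(2) by auto
      have "weight_le (\<lambda>i. i) (Suc n + (m - Suc n)) (mp_var (Suc n) * Q)"
        by (intro weight_le_mult Q) simp
      then have "weight_le (\<lambda>i. i) m (P + mp_var (Suc n) * Q)"
        using m(1) P(2) by (simp add: weight_le_add)
      moreover have "vars_in {1..Suc n} (P + mp_var (Suc n) * Q)"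
        by (intro vars_in_add vars_in_mult P' Q) simp
      moreover have "f = mp_subst (shift_elem c (Suc n)) (P + mp_var (Suc n) * Q)"
        using f_eq by (simp add: mp_subst_simps Q(3) del: shift_elem.simps)
      ultimately show ?thesis
        by blast
    qed
  qed
qed

text \<open>Setting the last variable to zero turns a relation into one among \<open>n\<close>
  generators, which is trivial by induction; so \<open>mp_var (Suc n)\<close> divides
  \<open>P\<close>. Cancelling the top function leaves a relation of smaller degree.\<close>

theorem shift_elem_independent:
  assumes "vars_in {1..n} P" "mp_subst (shift_elem c n) P = 0"
  shows "P = 0"
  using assms
proof (induction n arbitrary: P)
  case 0
  then show ?case
    using mp_subst_no_vars[of P] by simp
next
  case (Suc n)
  note IHn = Suc.IH
  show ?case
    using Suc.prems
  proof (induction "degree (homog P)" arbitrary: P rule: less_induct)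
    case less
    show ?case
    proof (rule ccontr)
      assume "P \<noteq> 0"
      \<comment> \<open>The index \<open>Suc n\<close> fits too, because
        \<open>shift_elem c n (Suc n)\<close> is zero.\<close>
      have "mp_subst (shift_elem c n) ((mp_var(Suc n := 0)) i) = shift_elem c n i" for i
        by (cases "i = Suc n") (simp_all add: mp_subst_simps(1) shift_elem_eq_0)
      then have "mp_subst (shift_elem c n) (mp_subst (mp_var(Suc n := 0)) P)
          = mp_subst (mp_var(Suc n := 0)) (mp_subst (shift_elem c (Suc n)) P)"
        by (simp only: mp_subst_mp_subst shift_elem_last_zero)
      also have "\<dots> = 0"
        by (simp only: less.prems(2) mp_subst_simps(1))
      finally have "mp_subst (shift_elem c n) (mp_subst (mp_var(Suc n := 0)) P) = 0" .
      moreover have "vars_in {1..n} (mp_subst (mp_var(Suc n := 0)) P)"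
        by (rule vars_in_mp_subst[OF less.prems(1)]) auto
      ultimately have "mp_subst (mp_var(Suc n := - 0)) P = 0"
        unfolding minus_zero by (rule IHn[rotated])
      then obtain Q where Q': "P = (mp_var (Suc n) + 0) * Q" "vars_in {1..Suc n} Q"
        by (rule mp_root_factor[OF less.prems(1)]) simp_all
      then have Q: "P = mp_var (Suc n) * Q" "vars_in {1..Suc n} Q"
        by simp_all
      then have "Q \<noteq> 0"
        using \<open>P \<noteq> 0\<close> by auto
      have "shift_elem c (Suc n) (Suc n) * mp_subst (shift_elem c (Suc n)) Q = 0"
        using less.prems(2) by (simp add: Q(1) mp_subst_simps del: shift_elem.simps)
      then have "mp_subst (shift_elem c (Suc n)) Q = 0"
        by (auto simp: shift_elem_top linear_neq_0 simp del: shift_elem.simps of_nat_mult)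
      moreover have "degree (homog Q) < degree (homog P)"
        using degree_homog_prod_linear[of "{Suc n}" "\<lambda>_. 0"] \<open>Q \<noteq> 0\<close>
        unfolding Q(1) by (subst degree_homog_mult) auto
      ultimately show False
        using less.hyps[OF _ Q(2)] \<open>Q \<noteq> 0\<close> by simp
    qed
  qed
qed

section \<open>Increasing sequences and the explicit form of the generators\<close>

lemma incr_seqs_0 [simp]: "incr_seqs n 0 = {[]}"
  by (auto simp: incr_seqs_def)

lemma incr_seqs_0_Suc [simp]: "incr_seqs 0 (Suc k) = {}"
  by (auto simp: incr_seqs_def)

lemma finite_incr_seqs [simp]: "finite (incr_seqs n k)"
  by (rule finite_subset[OF _ finite_lists_length_eq[of "{1..n}" k]]) (auto simp: incr_seqs_def)

lemma incr_seqs_Suc_Suc: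
  "incr_seqs (Suc n) (Suc k) = incr_seqs n (Suc k) \<union> (\<lambda>is. is @ [Suc n]) ` incr_seqs n k"
proof (intro equalityI subsetI)
  fix xs assume xs: "xs \<in> incr_seqs (Suc n) (Suc k)"
  then have "xs \<noteq> []"
    by (auto simp: incr_seqs_def)
  then obtain ys y where ys: "xs = ys @ [y]"
    by (cases xs rule: rev_cases) auto
  have y: "y \<le> Suc n" "\<forall>x\<in>set ys. 1 \<le> x \<and> x < y" "sorted_wrt (<) ys" "length ys = k" "1 \<le> y"
    using xs by (auto simp: ys incr_seqs_def sorted_wrt_append)
  show "xs \<in> incr_seqs n (Suc k) \<union> (\<lambda>is. is @ [Suc n]) ` incr_seqs n k"
  proof (cases "y = Suc n")
    case True
    then show ?thesis
      using y by (intro UnI2 image_eqI[of _ _ ys]) (auto simp: ys incr_seqs_def)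
  next
    case False
    then show ?thesis
      using y by (intro UnI1) (auto simp: ys incr_seqs_def sorted_wrt_append subset_iff)
  qed
qed (auto simp: incr_seqs_def sorted_wrt_append less_Suc_eq_le subset_iff)

lemma shift_elem_eq_sum:
  "shift_elem c n k = (\<Sum>is\<in>incr_seqs n k. \<Prod>a=1..k. mp_var (is ! (a - 1)) + of_nat (c * (k - a)))"
proof (induction c n k rule: shift_elem.induct)
  case (3 c n k)
  let ?f = "\<lambda>k is. \<Prod>a=1..k. mp_var (is ! (a - 1)) + of_nat (c * (k - a)) :: mpoly"
  have disj: "incr_seqs n (Suc k) \<inter> (\<lambda>is. is @ [Suc n]) ` incr_seqs n k = {}"
    by (auto simp: incr_seqs_def)
  have step: "?f (Suc k) (is @ [Suc n]) = mp_var (Suc n) * shift_all c (?f k is)" if "is \<in> incr_seqs n k" for "is"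
  proof -
    have len: "length is = k"
      using that by (simp add: incr_seqs_def)
    have "?f (Suc k) (is @ [Suc n])
        = (\<Prod>a=1..k. mp_var ((is @ [Suc n]) ! (a - 1)) + of_nat (c * (Suc k - a))) * mp_var (Suc n)"
      using len by (simp add: nth_append)
    also have "(\<Prod>a=1..k. mp_var ((is @ [Suc n]) ! (a - 1)) + of_nat (c * (Suc k - a))) = shift_all c (?f k is)"
      unfolding shift_all_def mp_subst_simps
      by (intro prod.cong refl)
        (auto simp: nth_append len Suc_diff_le mp_subst_simps add.assoc simp del: of_nat_diff)
    finally show ?thesis
      by (simp add: mult.commute)
  qed
  have "(\<Sum>is\<in>incr_seqs (Suc n) (Suc k). ?f (Suc k) is)
      = (\<Sum>is\<in>incr_seqs n (Suc k). ?f (Suc k) is) + (\<Sum>is\<in>(\<lambda>is. is @ [Suc n]) ` incr_seqs n k. ?f (Suc k) is)"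
    unfolding incr_seqs_Suc_Suc by (rule sum.union_disjoint) (use disj in auto)
  also have "(\<Sum>is\<in>(\<lambda>is. is @ [Suc n]) ` incr_seqs n k. ?f (Suc k) is)
      = (\<Sum>is\<in>incr_seqs n k. ?f (Suc k) (is @ [Suc n]))"
    by (subst sum.reindex) (auto intro: inj_onI)
  also have "\<dots> = (\<Sum>is\<in>incr_seqs n k. mp_var (Suc n) * shift_all c (?f k is))"
    by (intro sum.cong refl step)
  also have "\<dots> = mp_var (Suc n) * shift_all c (shift_elem c n k)"
    unfolding 3(2) shift_all_def mp_subst_simps(7) sum_distrib_left ..
  finally show ?case
    using 3(1) by simp
qed simp_all

lemma e_star_eq_shift_elem: "e_star n = shift_elem 1 n"
  by (rule ext) (simp add: e_star_def shift_elem_eq_sum)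

section \<open>The enveloping algebra on representatives\<close>

definition tens :: "nat \<Rightarrow> tensor set"
  where "tens n = {p. \<forall>w\<in>Poly_Mapping.keys p. set w \<subseteq> {1..n} \<times> {1..n}}"

text \<open>The bound is strict so that order below \<open>m\<close> can be expressed for
  \<open>m = 0\<close> as well, where only the zero tensor qualifies.\<close>

definition len_lt :: "nat \<Rightarrow> tensor \<Rightarrow> bool"
  where "len_lt m p \<longleftrightarrow> (\<forall>w\<in>Poly_Mapping.keys p. length w < m)"

lemma keys_mult_words:
  fixes p q :: tensor
  assumes "w \<in> Poly_Mapping.keys (p * q)"
  obtains u v where "u \<in> Poly_Mapping.keys p" "v \<in> Poly_Mapping.keys q" "w = u @ v"
  using assms keys_mult[of p q] by (auto simp: plus_list_def)

lemma tens_single [simp]: "Poly_Mapping.single w c \<in> tens n \<longleftrightarrow> c = 0 \<or> set w \<subseteq> {1..n} \<times> {1..n}"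
  by (auto simp: tens_def)

lemma tens_single_0 [simp]: "Poly_Mapping.single 0 c \<in> tens n"
  by (simp add: zero_list_def)

lemma tens_zero [simp]: "0 \<in> tens n"
  by (simp add: tens_def)

lemma tens_one [simp]: "1 \<in> tens n"
  using tens_single_0[of 1 n] by (simp del: tens_single_0)

lemma tens_add [intro]: "p \<in> tens n \<Longrightarrow> q \<in> tens n \<Longrightarrow> p + q \<in> tens n"
  using Poly_Mapping.keys_add[of p q] by (auto simp: tens_def)

lemma tens_minus [intro]: "p \<in> tens n \<Longrightarrow> - p \<in> tens n"
  by (simp add: tens_def)

lemma tens_diff [intro]: "p \<in> tens n \<Longrightarrow> q \<in> tens n \<Longrightarrow> p - q \<in> tens n"
  using tens_add[of p n "-q"] by (simp add: tens_minus)

lemma tens_mult [intro]: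
  assumes "p \<in> tens n" "q \<in> tens n"
  shows "p * q \<in> tens n"
  unfolding tens_def
proof (intro CollectI ballI)
  fix w assume "w \<in> Poly_Mapping.keys (p * q)"
  then obtain u v where "u \<in> Poly_Mapping.keys p" "v \<in> Poly_Mapping.keys q" "w = u @ v"
    by (rule keys_mult_words)
  with assms show "set w \<subseteq> {1..n} \<times> {1..n}"
    by (simp add: tens_def)
qed

lemma tens_of_nat [simp]: "of_nat k \<in> tens n"
  by (induction k) auto

lemma tens_of_int [simp]: "of_int k \<in> tens n"
  by (cases k rule: int_diff_cases) auto

lemma tens_sum: "(\<And>i. i \<in> I \<Longrightarrow> f i \<in> tens n) \<Longrightarrow> sum f I \<in> tens n"
  by (induction I rule: infinite_finite_induct) auto

lemma tens_prod_list: "(\<And>x. x \<in> set xs \<Longrightarrow> x \<in> tens n) \<Longrightarrow> prod_list xs \<in> tens n"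
  by (induction xs) auto

lemma tens_power: "p \<in> tens n \<Longrightarrow> p ^ k \<in> tens n"
  by (induction k) auto

lemma tens_e_tensor: "i \<in> {1..n} \<Longrightarrow> j \<in> {1..n} \<Longrightarrow> e_tensor i j \<in> tens n"
  by (simp add: e_tensor_def)

lemma tens_gl_tensor: "gl_tensor n A \<in> tens n"
  unfolding gl_tensor_def by (intro tens_sum) auto

lemma len_lt_mono: "len_lt m p \<Longrightarrow> m \<le> k \<Longrightarrow> len_lt k p"
  by (auto simp: len_lt_def)

lemma len_lt_single [simp]: "len_lt m (Poly_Mapping.single w c) \<longleftrightarrow> c = 0 \<or> length w < m"
  by (auto simp: len_lt_def)

lemma len_lt_zero [simp]: "len_lt m 0"
  by (simp add: len_lt_def)

lemma len_lt_add [intro]: "len_lt m p \<Longrightarrow> len_lt m q \<Longrightarrow> len_lt m (p + q)"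
  using Poly_Mapping.keys_add[of p q] by (auto simp: len_lt_def)

lemma len_lt_diff [intro]: "len_lt m p \<Longrightarrow> len_lt m q \<Longrightarrow> len_lt m (p - q)"
  using len_lt_add[of m p "-q"] by (simp add: len_lt_def)

lemma len_lt_sum: "(\<And>i. i \<in> I \<Longrightarrow> len_lt m (f i)) \<Longrightarrow> len_lt m (sum f I)"
  by (induction I rule: infinite_finite_induct) auto

lemma len_lt_mult:
  assumes "len_lt (Suc a) p" "len_lt b q"
  shows "len_lt (a + b) (p * q)"
  unfolding len_lt_def
proof
  fix w assume "w \<in> Poly_Mapping.keys (p * q)"
  then obtain u v where "u \<in> Poly_Mapping.keys p" "v \<in> Poly_Mapping.keys q" "w = u @ v"
    by (rule keys_mult_words)
  with assms show "length w < a + b"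
    by (fastforce simp: len_lt_def)
qed

lemma len_lt_const [simp]: "len_lt (Suc m) (Poly_Mapping.single 0 c)"
  by (simp add: zero_list_def)

lemma len_lt_one [simp]: "len_lt (Suc m) 1"
  using len_lt_const[of m 1] by (simp del: len_lt_const)

lemma len_lt_scale: "len_lt m p \<Longrightarrow> len_lt m (Poly_Mapping.single 0 c * p)"
  using len_lt_mult[OF len_lt_const[of 0 c], of m p] by simp

lemma len_lt_power: "len_lt (Suc a) p \<Longrightarrow> len_lt (Suc (a * k)) (p ^ k)"
proof (induction k)
  case (Suc k)
  then show ?case
    using len_lt_mult[of a p "Suc (a * k)" "p ^ k"] by simp
qed simp

lemma len_lt_prod_list:
  "(\<And>x. x \<in> set xs \<Longrightarrow> len_lt (Suc (d x)) (f x)) \<Longrightarrow> len_lt (Suc (\<Sum>x\<leftarrow>xs. d x)) (\<Prod>x\<leftarrow>xs. f x)"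
proof (induction xs)
  case (Cons x xs)
  then show ?case
    using len_lt_mult[of "d x" "f x" "Suc (\<Sum>x\<leftarrow>xs. d x)" "\<Prod>x\<leftarrow>xs. f x"] by simp
qed simp

section \<open>The quotient algebra, its centre and its filtration\<close>

lemma tensor_alg_simps [simp]:
  "carrier (tensor_alg n) = tens n" "mult (tensor_alg n) = (*)" "add (tensor_alg n) = (+)"
  "one (tensor_alg n) = 1" "ring.zero (tensor_alg n) = 0"
  by (simp_all add: tensor_alg_def monoid_subalg_def tens_def)

lemma ring_tensor_alg: "ring (tensor_alg n)"
proof (intro ringI abelian_groupI monoidI)
  show "\<exists>y\<in>carrier (tensor_alg n). y \<oplus>\<^bsub>tensor_alg n\<^esub> x = \<zero>\<^bsub>tensor_alg n\<^esub>"
    if "x \<in> carrier (tensor_alg n)" for x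
    using that by (intro bexI[of _ "- x"]) (auto simp: tens_minus)
qed (auto simp: algebra_simps)

lemma a_inv_tensor_alg: "p \<in> tens n \<Longrightarrow> \<ominus>\<^bsub>tensor_alg n\<^esub> p = - p"
  by (intro abelian_group.minus_equality ring.is_abelian_group ring_tensor_alg) (auto simp: tens_minus)

lemma a_minus_tensor_alg: "p \<in> tens n \<Longrightarrow> q \<in> tens n \<Longrightarrow> p \<ominus>\<^bsub>tensor_alg n\<^esub> q = p - q"
  by (simp add: a_minus_def a_inv_tensor_alg)

definition gl_relations :: "nat \<Rightarrow> tensor set"
  where "gl_relations n = {gl_tensor n A * gl_tensor n B - gl_tensor n B * gl_tensor n A
       - gl_tensor n (gl_bracket n A B) | A B. True}"

lemma gl_relations_subset: "gl_relations n \<subseteq> tens n"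
  by (auto simp: gl_relations_def tens_gl_tensor intro!: tens_diff tens_mult)

lemma ideal_ugl_ideal: "ideal (ugl_ideal n) (tensor_alg n)"
  using ring.genideal_ideal[OF ring_tensor_alg] gl_relations_subset
  by (simp add: ugl_ideal_def gl_relations_def)

lemma ugl_ideal_subset: "ugl_ideal n \<subseteq> tens n"
  using additive_subgroup.a_subset[OF ideal.axioms(1)[OF ideal_ugl_ideal]] by simp

lemma ugl_ideal_zero [simp]: "0 \<in> ugl_ideal n"
  using additive_subgroup.zero_closed[OF ideal.axioms(1)[OF ideal_ugl_ideal], of n] by simp

lemma ugl_ideal_add: "p \<in> ugl_ideal n \<Longrightarrow> q \<in> ugl_ideal n \<Longrightarrow> p + q \<in> ugl_ideal n"
  using additive_subgroup.a_closed[OF ideal.axioms(1)[OF ideal_ugl_ideal], of p n q] by simp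

lemma ugl_ideal_mult_left: "p \<in> tens n \<Longrightarrow> q \<in> ugl_ideal n \<Longrightarrow> p * q \<in> ugl_ideal n"
  using ideal.I_l_closed[OF ideal_ugl_ideal, of q n p] by simp

lemma ugl_ideal_mult_right: "p \<in> ugl_ideal n \<Longrightarrow> q \<in> tens n \<Longrightarrow> p * q \<in> ugl_ideal n"
  using ideal.I_r_closed[OF ideal_ugl_ideal, of p n q] by simp

lemma ugl_ideal_minus: "p \<in> ugl_ideal n \<Longrightarrow> - p \<in> ugl_ideal n"
  using ugl_ideal_mult_left[of "- 1" n p] by (simp add: tens_minus)

lemma ugl_ideal_diff: "p \<in> ugl_ideal n \<Longrightarrow> q \<in> ugl_ideal n \<Longrightarrow> p - q \<in> ugl_ideal n"
  using ugl_ideal_add[of p n "-q"] by (simp add: ugl_ideal_minus)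

lemma ugl_ideal_sum: "(\<And>i. i \<in> I \<Longrightarrow> f i \<in> ugl_ideal n) \<Longrightarrow> sum f I \<in> ugl_ideal n"
  by (induction I rule: infinite_finite_induct) (auto intro: ugl_ideal_add)

lemma ugl_class_eq_iff:
  "p \<in> tens n \<Longrightarrow> q \<in> tens n \<Longrightarrow> ugl_class n p = ugl_class n q \<longleftrightarrow> p - q \<in> ugl_ideal n"
  using ring.quotient_eq_iff_same_a_r_cos[OF ring_tensor_alg ideal_ugl_ideal, of p n q]
  by (simp add: ugl_class_def a_minus_tensor_alg)

lemma carrier_ugl: "carrier (ugl n) = ugl_class n ` tens n"
  by (auto simp: ugl_def Let_def FactRing_def A_RCOSETS_def' ugl_class_def)

lemma ugl_class_carrier [simp]: "p \<in> tens n \<Longrightarrow> ugl_class n p \<in> carrier (ugl n)"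
  by (auto simp: carrier_ugl)

lemma ugl_mult:
  "p \<in> tens n \<Longrightarrow> q \<in> tens n \<Longrightarrow> ugl_class n p \<otimes>\<^bsub>ugl n\<^esub> ugl_class n q = ugl_class n (p * q)"
  using ideal.rcoset_mult_add[OF ideal_ugl_ideal, of p n q]
  by (simp add: ugl_def Let_def FactRing_def ugl_class_def)

lemma ugl_add:
  "p \<in> tens n \<Longrightarrow> q \<in> tens n \<Longrightarrow> ugl_class n p \<oplus>\<^bsub>ugl n\<^esub> ugl_class n q = ugl_class n (p + q)"
  using ideal.a_rcos_sum[OF ideal_ugl_ideal, of p n q]
  by (simp add: ugl_def Let_def FactRing_def ugl_class_def)

lemma ugl_one: "\<one>\<^bsub>ugl n\<^esub> = ugl_class n 1"
  by (simp add: ugl_def Let_def FactRing_def ugl_class_def)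

lemma ugl_zero: "\<zero>\<^bsub>ugl n\<^esub> = ugl_class n 0"
proof -
  have "(\<lambda>h. h + 0) ` ugl_ideal n = ugl_ideal n"
    by simp
  then show ?thesis
    by (auto simp: ugl_def Let_def FactRing_def ugl_class_def a_r_coset_def' )
qed

lemma ugl_smult:
  "p \<in> tens n \<Longrightarrow> c \<odot>\<^bsub>ugl n\<^esub> ugl_class n p = ugl_class n (Poly_Mapping.single 0 c * p)"
  using ugl_mult[OF tens_single_0, of p n c] by (simp add: ugl_def Let_def)

lemma zeta_simps [simp]:
  "mult (zeta n) = mult (ugl n)" "add (zeta n) = add (ugl n)" "one (zeta n) = one (ugl n)"
  "ring.zero (zeta n) = ring.zero (ugl n)" "c \<odot>\<^bsub>zeta n\<^esub> x = c \<odot>\<^bsub>ugl n\<^esub> x"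
  by (simp_all add: zeta_def)

lemma class_in_zeta_iff:
  assumes "p \<in> tens n"
  shows "ugl_class n p \<in> carrier (zeta n) \<longleftrightarrow> (\<forall>q\<in>tens n. p * q - q * p \<in> ugl_ideal n)"
  using assms by (auto simp: zeta_def carrier_ugl ugl_mult ugl_class_eq_iff tens_mult)

lemma zeta_subset: "carrier (zeta n) \<subseteq> carrier (ugl n)"
  by (auto simp: zeta_def)

lemma ugl_filt_iff: "ugl_filt n m = ugl_class n ` {p \<in> tens n. len_lt (Suc m) p}"
  by (auto simp: ugl_filt_def len_lt_def less_Suc_eq_le)

lemma gl_tensor_unit:
  assumes "i \<in> {1..n}" "j \<in> {1..n}"
  shows "gl_tensor n (\<lambda>a b. if a = i \<and> b = j then c else 0) = Poly_Mapping.single [(i, j)] c"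
proof -
  have "gl_tensor n (\<lambda>a b. if a = i \<and> b = j then c else 0)
      = (\<Sum>a=1..n. \<Sum>b=1..n. if b = j then (if a = i then Poly_Mapping.single [(i, j)] c else 0) else 0)"
    unfolding gl_tensor_def by (intro sum.cong refl) auto
  also have "\<dots> = Poly_Mapping.single [(i, j)] c"
    using assms by simp
  finally show ?thesis .
qed

definition gl_comm :: "nat \<Rightarrow> nat \<Rightarrow> nat \<Rightarrow> nat \<Rightarrow> tensor"
  where "gl_comm i j k l = (if j = k then e_tensor i l else 0) - (if l = i then e_tensor k j else 0)"

lemma e_tensor_comm:
  assumes "i \<in> {1..n}" "j \<in> {1..n}" "k \<in> {1..n}" "l \<in> {1..n}"
  shows "e_tensor i j * e_tensor k l - e_tensor k l * e_tensor i j - gl_comm i j k l \<in> ugl_ideal n"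
proof -
  define U :: "nat \<Rightarrow> nat \<Rightarrow> nat \<Rightarrow> nat \<Rightarrow> complex" where
    "U i j = (\<lambda>a b. if a = i \<and> b = j then 1 else 0)" for i j
  have U: "gl_tensor n (U i j) = e_tensor i j" if "i \<in> {1..n}" "j \<in> {1..n}" for i j
    unfolding U_def e_tensor_def by (rule gl_tensor_unit[OF that])
  have prod: "(\<Sum>c=1..n. U i j a c * U k l c b) = (if j = k then U i l a b else 0)"
    if "j \<in> {1..n}" for a b i j k l
  proof -
    have "(\<Sum>c=1..n. U i j a c * U k l c b) = (\<Sum>c=1..n. if c = j then (if j = k then U i l a b else 0) else 0)"
      by (intro sum.cong refl) (auto simp: U_def)
    also have "\<dots> = (if j = k then U i l a b else 0)"
      using that by simp
    finally show ?thesis .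
  qed
  have "gl_tensor n (gl_bracket n (U i j) (U k l))
      = gl_tensor n (\<lambda>a b. (if j = k then U i l a b else 0) - (if l = i then U k j a b else 0))"
    unfolding gl_bracket_def by (simp only: prod[OF assms(2)] prod[OF assms(4)])
  also have "\<dots> = gl_tensor n (\<lambda>a b. if j = k then U i l a b else 0) - gl_tensor n (\<lambda>a b. if l = i then U k j a b else 0)"
    by (simp add: gl_tensor_def single_diff sum_subtractf)
  also have "gl_tensor n (\<lambda>a b. if j = k then U i l a b else 0) = (if j = k then e_tensor i l else 0)"
    using assms by (cases "j = k") (auto simp: U gl_tensor_def[of n "\<lambda>a b. 0"])
  also have "gl_tensor n (\<lambda>a b. if l = i then U k j a b else 0) = (if l = i then e_tensor k j else 0)"
    using assms by (cases "l = i") (auto simp: U gl_tensor_def[of n "\<lambda>a b. 0"])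
  finally have br: "gl_tensor n (gl_bracket n (U i j) (U k l)) = gl_comm i j k l"
    by (simp add: gl_comm_def)
  have "gl_relations n \<subseteq> ugl_ideal n"
    using ring.genideal_self[OF ring_tensor_alg] gl_relations_subset
    by (simp add: ugl_ideal_def gl_relations_def)
  moreover have "gl_tensor n (U i j) * gl_tensor n (U k l) - gl_tensor n (U k l) * gl_tensor n (U i j)
      - gl_tensor n (gl_bracket n (U i j) (U k l)) \<in> gl_relations n"
    unfolding gl_relations_def by blast
  ultimately show ?thesis
    using assms by (auto simp: U br)
qed

text \<open>The indices are unbounded: the operator families in use are indexed by all natural
  numbers, and one family serves every \<open>n\<close>.\<close>

locale gl_family =
  fixes E :: "nat \<Rightarrow> nat \<Rightarrow> 'r::ring_1"
  assumes gl_commute: "E i j * E k l - E k l * E i j = (if j = k then E i l else 0) - (if l = i then E k j else 0)"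

definition word_eval :: "(nat \<Rightarrow> nat \<Rightarrow> 'r) \<Rightarrow> (nat \<times> nat) list \<Rightarrow> 'r::monoid_mult"
  where "word_eval E w = prod_list (map (\<lambda>(i, j). E i j) w)"

lemma word_eval_simps [simp]:
  "word_eval E 0 = 1" "word_eval E [] = 1" "word_eval E ((i, j) # w) = E i j * word_eval E w"
  "word_eval E (u @ v) = word_eval E u * word_eval E v"
  "word_eval E (u + v) = word_eval E u * word_eval E v"
  by (simp_all add: word_eval_def zero_list_def plus_list_def)

locale gl_hom = gl_family E for E :: "nat \<Rightarrow> nat \<Rightarrow> 'r::ring_1" +
  fixes \<kappa> :: "complex \<Rightarrow> 'r"
  assumes \<kappa>_add: "\<kappa> (c + d) = \<kappa> c + \<kappa> d"
    and \<kappa>_mult: "\<kappa> (c * d) = \<kappa> c * \<kappa> d"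
    and \<kappa>_one: "\<kappa> 1 = 1"
    and \<kappa>_comm: "x * \<kappa> c = \<kappa> c * x"
begin

sublocale algebra_eval \<kappa> "word_eval E"
  by unfold_locales (rule \<kappa>_add \<kappa>_mult \<kappa>_one \<kappa>_comm word_eval_simps)+

abbreviation "eval \<equiv> meval \<kappa> (word_eval E)"

lemma eval_e_tensor [simp]: "eval (e_tensor i j) = E i j"
  by (simp add: e_tensor_def \<kappa>_one)

lemma eval_gl_tensor: "eval (gl_tensor n A) = (\<Sum>i=1..n. \<Sum>j=1..n. \<kappa> (A i j) * E i j)"
  by (simp add: gl_tensor_def meval_sum)

lemma \<kappa>_sum: "\<kappa> (sum f I) = (\<Sum>i\<in>I. \<kappa> (f i))"
  by (induction I rule: infinite_finite_induct) (simp_all add: \<kappa>_add)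

lemma \<kappa>_diff: "\<kappa> (c - d) = \<kappa> c - \<kappa> d"
  using \<kappa>_add[of "c - d" d] by (simp add: algebra_simps)

lemma eval_gl_mult: "eval (gl_tensor n A) * eval (gl_tensor n B)
    = (\<Sum>i=1..n. \<Sum>j=1..n. \<Sum>k=1..n. \<Sum>l=1..n. \<kappa> (A i j * B k l) * (E i j * E k l))"
proof -
  have "\<kappa> (A i j) * E i j * (\<kappa> (B k l) * E k l) = \<kappa> (A i j * B k l) * (E i j * E k l)" for i j k l
  proof -
    have "\<kappa> (A i j) * E i j * (\<kappa> (B k l) * E k l) = \<kappa> (A i j) * (E i j * \<kappa> (B k l)) * E k l"
      by (simp only: mult.assoc)
    also have "E i j * \<kappa> (B k l) = \<kappa> (B k l) * E i j"
      by (rule \<kappa>_comm)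
    finally show ?thesis
      by (simp only: \<kappa>_mult mult.assoc)
  qed
  then show ?thesis
    unfolding eval_gl_tensor unfolding sum_distrib_right unfolding sum_distrib_left by simp
qed

text \<open>The ideal is generated by relations for arbitrary matrices; bilinearity reduces them to
  the relation \<open>gl_commute\<close> for matrix units.\<close>

lemma eval_relation:
  "eval (gl_tensor n A * gl_tensor n B - gl_tensor n B * gl_tensor n A - gl_tensor n (gl_bracket n A B)) = 0"
proof -
  let ?I = "{1..n}"
  have "eval (gl_tensor n B) * eval (gl_tensor n A)
      = (\<Sum>k\<in>?I. \<Sum>l\<in>?I. \<Sum>i\<in>?I. \<Sum>j\<in>?I. \<kappa> (B k l * A i j) * (E k l * E i j))"
    by (rule eval_gl_mult)
  also have "\<dots> = (\<Sum>k\<in>?I. \<Sum>i\<in>?I. \<Sum>l\<in>?I. \<Sum>j\<in>?I. \<kappa> (B k l * A i j) * (E k l * E i j))"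
    by (rule sum.cong[OF refl], rule sum.swap)
  also have "\<dots> = (\<Sum>i\<in>?I. \<Sum>k\<in>?I. \<Sum>l\<in>?I. \<Sum>j\<in>?I. \<kappa> (B k l * A i j) * (E k l * E i j))"
    by (rule sum.swap)
  also have "\<dots> = (\<Sum>i\<in>?I. \<Sum>k\<in>?I. \<Sum>j\<in>?I. \<Sum>l\<in>?I. \<kappa> (B k l * A i j) * (E k l * E i j))"
    by (rule sum.cong[OF refl], rule sum.cong[OF refl], rule sum.swap)
  also have "\<dots> = (\<Sum>i\<in>?I. \<Sum>j\<in>?I. \<Sum>k\<in>?I. \<Sum>l\<in>?I. \<kappa> (B k l * A i j) * (E k l * E i j))"
    by (rule sum.cong[OF refl], rule sum.swap)
  also have "\<dots> = (\<Sum>i\<in>?I. \<Sum>j\<in>?I. \<Sum>k\<in>?I. \<Sum>l\<in>?I. \<kappa> (A i j * B k l) * (E k l * E i j))"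
    by (simp only: mult.commute)
  finally have BA: "eval (gl_tensor n B) * eval (gl_tensor n A)
      = (\<Sum>i\<in>?I. \<Sum>j\<in>?I. \<Sum>k\<in>?I. \<Sum>l\<in>?I. \<kappa> (A i j * B k l) * (E k l * E i j))" .
  have inner: "(\<Sum>k\<in>?I. \<Sum>l\<in>?I. if k = j then \<kappa> (A i j * B k l) * E i l else 0)
      = (\<Sum>l\<in>?I. \<kappa> (A i j * B j l) * E i l)" if "j \<in> ?I" for i j
  proof -
    have "(\<Sum>k\<in>?I. \<Sum>l\<in>?I. if k = j then \<kappa> (A i j * B k l) * E i l else 0)
        = (\<Sum>k\<in>?I. if k = j then \<Sum>l\<in>?I. \<kappa> (A i j * B k l) * E i l else 0)"
      by (rule sum.cong[OF refl]) simp
    with that show ?thesis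
      by simp
  qed
  have "eval (gl_tensor n A) * eval (gl_tensor n B) - eval (gl_tensor n B) * eval (gl_tensor n A)
      = (\<Sum>i\<in>?I. \<Sum>j\<in>?I. \<Sum>k\<in>?I. \<Sum>l\<in>?I. \<kappa> (A i j * B k l) * (E i j * E k l - E k l * E i j))"
    unfolding BA unfolding eval_gl_mult[of n A B] by (simp only: sum_subtractf right_diff_distrib)
  also have "\<dots> = (\<Sum>i\<in>?I. \<Sum>j\<in>?I. \<Sum>k\<in>?I. \<Sum>l\<in>?I. if k = j then \<kappa> (A i j * B k l) * E i l else 0)
      - (\<Sum>i\<in>?I. \<Sum>j\<in>?I. \<Sum>k\<in>?I. \<Sum>l\<in>?I. if l = i then \<kappa> (A i j * B k l) * E k j else 0)"
    unfolding gl_commute sum_subtractf[symmetric] by (intro sum.cong refl) (auto simp: right_diff_distrib)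
  also have "(\<Sum>i\<in>?I. \<Sum>j\<in>?I. \<Sum>k\<in>?I. \<Sum>l\<in>?I. if k = j then \<kappa> (A i j * B k l) * E i l else 0)
      = (\<Sum>i\<in>?I. \<Sum>j\<in>?I. \<Sum>l\<in>?I. \<kappa> (A i j * B j l) * E i l)"
    by (rule sum.cong[OF refl], rule sum.cong[OF refl], rule inner)
  also have "\<dots> = (\<Sum>i\<in>?I. \<Sum>l\<in>?I. \<kappa> (\<Sum>j\<in>?I. A i j * B j l) * E i l)"
    unfolding \<kappa>_sum sum_distrib_right by (rule sum.cong[OF refl], rule sum.swap)
  also have "(\<Sum>i\<in>?I. \<Sum>j\<in>?I. \<Sum>k\<in>?I. \<Sum>l\<in>?I. if l = i then \<kappa> (A i j * B k l) * E k j else 0)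
      = (\<Sum>i\<in>?I. \<Sum>j\<in>?I. \<Sum>k\<in>?I. \<kappa> (B k i * A i j) * E k j)"
    by (intro sum.cong refl) (simp add: mult.commute)
  also have "\<dots> = (\<Sum>i\<in>?I. \<Sum>k\<in>?I. \<Sum>j\<in>?I. \<kappa> (B k i * A i j) * E k j)"
    by (rule sum.cong[OF refl], rule sum.swap)
  also have "\<dots> = (\<Sum>k\<in>?I. \<Sum>i\<in>?I. \<Sum>j\<in>?I. \<kappa> (B k i * A i j) * E k j)"
    by (rule sum.swap)
  also have "\<dots> = (\<Sum>k\<in>?I. \<Sum>j\<in>?I. \<kappa> (\<Sum>i\<in>?I. B k i * A i j) * E k j)"
    unfolding \<kappa>_sum sum_distrib_right by (rule sum.cong[OF refl], rule sum.swap)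
  finally have "eval (gl_tensor n A) * eval (gl_tensor n B) - eval (gl_tensor n B) * eval (gl_tensor n A)
      = eval (gl_tensor n (gl_bracket n A B))"
    unfolding eval_gl_tensor gl_bracket_def \<kappa>_diff left_diff_distrib sum_subtractf .
  then show ?thesis
    by (simp add: meval_diff meval_mult)
qed

lemma ideal_kernel: "ideal {p \<in> tens n. eval p = 0} (tensor_alg n)"
proof (intro idealI ring_tensor_alg subgroup.intro)
  fix p assume "p \<in> {p \<in> tens n. eval p = 0}"
  then show "inv\<^bsub>add_monoid (tensor_alg n)\<^esub> p \<in> {p \<in> tens n. eval p = 0}"
    using a_inv_tensor_alg[of p n] by (auto simp: a_inv_def meval_minus tens_minus)
qed (auto simp: meval_add meval_mult)

text \<open>The kernel within \<open>tens n\<close> is an ideal containing the relations, so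
  minimality of the generated ideal lets the evaluation factor through the enveloping
  algebra.\<close>

lemma eval_ugl_ideal: "p \<in> ugl_ideal n \<Longrightarrow> eval p = 0"
proof -
  have "gl_relations n \<subseteq> {p \<in> tens n. eval p = 0}"
    using gl_relations_subset[of n] by (auto simp: gl_relations_def eval_relation)
  then have "ugl_ideal n \<subseteq> {p \<in> tens n. eval p = 0}"
    using ring.genideal_minimal[OF ring_tensor_alg ideal_kernel, of "gl_relations n" n]
    by (simp add: ugl_ideal_def gl_relations_def)
  then show "p \<in> ugl_ideal n \<Longrightarrow> eval p = 0"
    by auto
qed

end

section \<open>Linear operators on polynomials\<close>

text \<open>Operators are made a type because \<open>gl_hom\<close> and the calculus of column
  determinants are formulated for types of class \<open>ring_1\<close>.\<close>

typedef endo = "{f :: mpoly \<Rightarrow> mpoly. (\<forall>p q. f (p + q) = f p + f q)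
    \<and> (\<forall>c p. f (Poly_Mapping.single 0 c * p) = Poly_Mapping.single 0 c * f p)}"
  morphisms endo_app Endo
  by (rule exI[of _ "\<lambda>_. 0"]) simp

setup_lifting type_definition_endo

instantiation endo :: ring_1
begin

lift_definition zero_endo :: endo is "\<lambda>_. 0" by simp
lift_definition one_endo :: endo is "\<lambda>p. p" by simp
lift_definition plus_endo :: "endo \<Rightarrow> endo \<Rightarrow> endo" is "\<lambda>f g p. f p + g p" by (simp add: algebra_simps)
lift_definition minus_endo :: "endo \<Rightarrow> endo \<Rightarrow> endo" is "\<lambda>f g p. f p - g p" by (simp add: algebra_simps)
lift_definition uminus_endo :: "endo \<Rightarrow> endo" is "\<lambda>f p. - f p" by simp
lift_definition times_endo :: "endo \<Rightarrow> endo \<Rightarrow> endo" is "\<lambda>f g p. f (g p)" by simp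

instance
proof
  show "(0::endo) \<noteq> 1"
    by transfer (auto simp: fun_eq_iff intro!: exI[of _ 1])
qed (transfer, simp add: fun_eq_iff algebra_simps)+

end

lemma endo_app_simps [simp]:
  "endo_app 0 p = 0" "endo_app 1 p = p" "endo_app (f + g) p = endo_app f p + endo_app g p"
  "endo_app (f - g) p = endo_app f p - endo_app g p" "endo_app (- f) p = - endo_app f p"
  "endo_app (f * g) p = endo_app f (endo_app g p)"
  by (simp_all add: zero_endo.rep_eq one_endo.rep_eq plus_endo.rep_eq minus_endo.rep_eq
      uminus_endo.rep_eq times_endo.rep_eq)

lemma endo_app_add: "endo_app f (p + q) = endo_app f p + endo_app f q"
  by transfer simp

lemma endo_app_scale: "endo_app f (Poly_Mapping.single 0 c * p) = Poly_Mapping.single 0 c * endo_app f p"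
  by transfer simp

lemma endo_app_sum: "endo_app (sum F I) p = (\<Sum>i\<in>I. endo_app (F i) p)"
  by (induction I rule: infinite_finite_induct) simp_all

lemma endo_eqI: "(\<And>p. endo_app f p = endo_app g p) \<Longrightarrow> f = g"
  by transfer auto

lift_definition endo_const :: "complex \<Rightarrow> endo" is "\<lambda>c p. Poly_Mapping.single 0 c * p"
  by (simp add: algebra_simps)

lemma endo_app_const [simp]: "endo_app (endo_const c) p = Poly_Mapping.single 0 c * p"
  by transfer simp

lemma gl_hom_endo: "gl_family E \<Longrightarrow> gl_hom E endo_const"
  unfolding gl_hom_def gl_hom_axioms_def
  by (auto intro!: endo_eqI simp: single_add distrib_right mult_single endo_app_scale simp flip: mult.assoc)
    (simp add: mult.commute)

text \<open>The derivation with values \<open>d i\<close> on the variables is read off a homomorphism to dual numbers.\<close>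

definition dual_eval :: "(nat \<Rightarrow> mpoly) \<Rightarrow> mpoly \<Rightarrow> mpoly poly"
  where "dual_eval d = mp_eval (\<lambda>c. [:Poly_Mapping.single 0 c:]) (\<lambda>i. [:mp_var i, d i:])"

definition derivation :: "(nat \<Rightarrow> mpoly) \<Rightarrow> mpoly \<Rightarrow> mpoly"
  where "derivation d p = coeff (dual_eval d p) 1"

lemma ring_hom_1_dual_eval: "ring_hom_1 (dual_eval d)"
  unfolding dual_eval_def by (rule ring_hom_1_mp_eval[OF ring_hom_1_poly_const])

lemmas dual_eval_simps = ring_hom_1.hom_simps[OF ring_hom_1_dual_eval]

lemma dual_eval_var: "dual_eval d (mp_var i) = [:mp_var i, d i:]"
  by (simp add: dual_eval_def ring_hom_1_poly_const)

lemma coeff_dual_eval_0: "coeff (dual_eval d p) 0 = p"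
proof -
  have "poly (dual_eval d p) 0 = mp_eval (\<lambda>c. poly [:Poly_Mapping.single 0 c:] 0) (\<lambda>i. poly [:mp_var i, d i:] 0) p"
    unfolding dual_eval_def by (rule mp_eval_comp[OF ring_hom_1_poly ring_hom_1_poly_const])
  also have "\<dots> = p"
    using mp_subst_var[of p] by (simp add: mp_subst_def)
  finally show ?thesis
    by (simp add: poly_0_coeff_0)
qed

lemma derivation_add: "derivation d (p + q) = derivation d p + derivation d q"
  by (simp add: derivation_def dual_eval_simps)

lemma derivation_mult: "derivation d (p * q) = derivation d p * q + p * derivation d q"
  by (simp add: derivation_def dual_eval_simps coeff_mult coeff_dual_eval_0 flip: coeff_dual_eval_0)
    (simp add: coeff_dual_eval_0)

lemma derivation_const [simp]: "derivation d (Poly_Mapping.single 0 c) = 0"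
  by (simp add: derivation_def dual_eval_def ring_hom_1_poly_const)

lemma derivation_var [simp]: "derivation d (mp_var i) = d i"
  by (simp add: derivation_def dual_eval_var)

section \<open>Polarisation operators and the two representations\<close>

definition mat_var :: "nat \<Rightarrow> nat \<Rightarrow> mpoly"
  where "mat_var i j = mp_var (prod_encode (i, j))"

text \<open>The polarisation operator \<open>\<Sum>\<^sub>l x\<^sub>i\<^sub>l \<partial>/\<partial>x\<^sub>j\<^sub>l\<close>.\<close>

definition polar :: "nat \<Rightarrow> nat \<Rightarrow> mpoly \<Rightarrow> mpoly"
  where "polar i j = derivation (\<lambda>v. if fst (prod_decode v) = j then mat_var i (snd (prod_decode v)) else 0)"

lemma polar_add: "polar i j (p + q) = polar i j p + polar i j q"
  by (simp add: polar_def derivation_add)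

lemma polar_mult: "polar i j (p * q) = polar i j p * q + p * polar i j q"
  by (simp add: polar_def derivation_mult)

lemma polar_const [simp]: "polar i j (Poly_Mapping.single 0 c) = 0"
  by (simp add: polar_def)

lemma polar_zero [simp]: "polar i j 0 = 0"
  using polar_const[of i j 0] by simp

lemma polar_mat_var: "polar i j (mat_var k l) = (if k = j then mat_var i l else 0)"
  by (simp add: polar_def mat_var_def)

text \<open>A commutator of derivations is a derivation, and so is the right-hand side; hence it is
  enough to compare them on the variables.\<close>

lemma polar_commute:
  "polar i j (polar k l p) - polar k l (polar i j p) = (if j = k then polar i l p else 0) - (if l = i then polar k j p else 0)"
proof -
  have "vars_in UNIV p"
    by (simp add: vars_in_def)
  then show ?thesis
  proof (induction rule: mp_poly_induct)
    case (var v)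
    obtain a b where "v = prod_encode (a, b)"
      by (metis prod_decode_inverse surj_pair)
    then have "mp_var v = mat_var a b"
      by (simp add: mat_var_def)
    then show ?case
      by (auto simp: polar_mat_var)
  next
    case (add p q)
    let ?C = "\<lambda>p. polar i j (polar k l p) - polar k l (polar i j p)"
    have "?C (p + q) = ?C p + ?C q"
      by (simp add: polar_add algebra_simps)
    then show ?case
      unfolding add.IH by (auto simp: polar_add)
  next
    case (mult p q)
    let ?C = "\<lambda>p. polar i j (polar k l p) - polar k l (polar i j p)"
    have "?C (p * q) = ?C p * q + p * ?C q"
      by (simp add: polar_add polar_mult algebra_simps)
    then show ?case
      unfolding mult.IH by (auto simp: polar_mult algebra_simps)
  qed simp
qed

lift_definition polar_op :: "nat \<Rightarrow> nat \<Rightarrow> endo" is polar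
  by (simp add: polar_add polar_mult)

definition mult_op :: "mpoly \<Rightarrow> endo"
  where "mult_op q = Endo ((*) q)"

lemma endo_app_polar_op [simp]: "endo_app (polar_op i j) p = polar i j p"
  by transfer simp

lemma endo_app_mult_op [simp]: "endo_app (mult_op q) p = q * p"
  unfolding mult_op_def by (subst Endo_inverse) (auto simp: algebra_simps)

text \<open>Applied to \<open>1\<close>, a word in these operators is the corresponding monomial plus terms of
  smaller degree; this makes \<open>u \<mapsto> u \<cdot> 1\<close> injective and gives the Poincare-Birkhoff-Witt theorem.\<close>

definition pbw_op :: "nat \<Rightarrow> nat \<Rightarrow> endo"
  where "pbw_op i j = polar_op i j + mult_op (mat_var i j)"

lemma gl_family_polar_op: "gl_family polar_op"
proof (rule gl_family.intro)
  fix i j k l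
  show "polar_op i j * polar_op k l - polar_op k l * polar_op i j
      = (if j = k then polar_op i l else 0) - (if l = i then polar_op k j else 0)"
  proof (rule endo_eqI)
    fix p
    have "endo_app (polar_op i j * polar_op k l - polar_op k l * polar_op i j) p
        = (if j = k then polar i l p else 0) - (if l = i then polar k j p else 0)"
      using polar_commute[of i j k l p] by simp
    then show "endo_app (polar_op i j * polar_op k l - polar_op k l * polar_op i j) p
        = endo_app ((if j = k then polar_op i l else 0) - (if l = i then polar_op k j else 0)) p"
      by (simp only: endo_app_simps if_distrib[of "\<lambda>f. endo_app f p"] endo_app_polar_op)
  qed
qed

text \<open>Multiplications commute with one another, and the mixed terms
  \<open>polar i j (mat_var k l) - polar k l (mat_var i j)\<close> reproduce the bracket, so adding
  the variable to the polarisation preserves the relations.\<close>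

lemma gl_family_pbw_op: "gl_family pbw_op"
proof (rule gl_family.intro)
  fix i j k l
  show "pbw_op i j * pbw_op k l - pbw_op k l * pbw_op i j
      = (if j = k then pbw_op i l else 0) - (if l = i then pbw_op k j else 0)"
  proof (rule endo_eqI)
    fix p
    have "endo_app (pbw_op i j * pbw_op k l - pbw_op k l * pbw_op i j) p
        = (polar i j (polar k l p) - polar k l (polar i j p))
          + (polar i j (mat_var k l) * p - polar k l (mat_var i j) * p)"
      by (simp add: pbw_op_def polar_add polar_mult algebra_simps)
    also have "\<dots> = endo_app ((if j = k then pbw_op i l else 0) - (if l = i then pbw_op k j else 0)) p"
      unfolding polar_commute polar_mat_var by (simp add: pbw_op_def)
    finally show "endo_app (pbw_op i j * pbw_op k l - pbw_op k l * pbw_op i j) p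
        = endo_app ((if j = k then pbw_op i l else 0) - (if l = i then pbw_op k j else 0)) p" .
  qed
qed

interpretation endo_const: coeff_hom endo_const
  by unfold_locales (auto intro!: endo_eqI simp: single_add distrib_right)

interpretation pol: gl_hom polar_op endo_const
  by (rule gl_hom_endo[OF gl_family_polar_op])

interpretation pbw: gl_hom pbw_op endo_const
  by (rule gl_hom_endo[OF gl_family_pbw_op])

section \<open>Symbols\<close>

text \<open>The coefficient of \<open>t\<^sup>m\<close> in \<open>symb \<kappa> X p\<close> is the degree \<open>m\<close> part of \<open>p\<close>, made commutative
  and evaluated at the matrix \<open>X\<close>.\<close>

definition symb :: "(complex \<Rightarrow> 'b) \<Rightarrow> (nat \<Rightarrow> nat \<Rightarrow> 'b) \<Rightarrow> tensor \<Rightarrow> 'b::comm_ring_1 poly"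
  where "symb \<kappa> X = meval (\<lambda>c. [:\<kappa> c:]) (word_eval (\<lambda>i j. monom (X i j) 1))"

lemma word_eval_monom: "word_eval (\<lambda>i j. monom (X i j) 1) w = monom (word_eval X w :: 'b::comm_ring_1) (length w)"
  by (induction w) (auto simp: mult_monom monom_0 one_pCons)

lemma coeff_symb:
  "coeff (symb \<kappa> X p) m = (\<Sum>w | w \<in> Poly_Mapping.keys p \<and> length w = m. \<kappa> (Poly_Mapping.lookup p w) * word_eval X w)"
proof -
  have "coeff (symb \<kappa> X p) m
      = (\<Sum>w\<in>Poly_Mapping.keys p. if length w = m then \<kappa> (Poly_Mapping.lookup p w) * word_eval X w else 0)"
    unfolding symb_def meval_def word_eval_monom coeff_sum by (intro sum.cong refl) simp
  then show ?thesis
    by (simp add: sum.inter_filter)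
qed

lemma algebra_eval_symb:
  assumes "ring_hom_1 \<kappa>"
  shows "algebra_eval (\<lambda>c. [:\<kappa> c:]) (word_eval (\<lambda>i j. monom (X i j :: 'b::comm_ring_1) 1))"
proof -
  interpret ring_hom_1 "\<lambda>c. [:\<kappa> c:]"
    by (rule ring_hom_1_comp[OF ring_hom_1_pCons assms])
  show ?thesis
    by unfold_locales (rule \<kappa>_add \<kappa>_mult \<kappa>_one word_eval_simps mult.commute)+
qed

lemma hom_word_eval: "ring_hom_1 \<phi> \<Longrightarrow> \<phi> (word_eval X w) = word_eval (\<lambda>i j. \<phi> (X i j)) w"
  by (induction w) (auto simp: ring_hom_1.hom_simps)

lemma hom_coeff_symb:
  assumes "ring_hom_1 \<phi>"
  shows "\<phi> (coeff (symb \<kappa> X p) m) = coeff (symb (\<lambda>c. \<phi> (\<kappa> c)) (\<lambda>i j. \<phi> (X i j)) p) m"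
  unfolding coeff_symb by (simp only: ring_hom_1.hom_simps[OF assms] hom_word_eval[OF assms])

lemma coeff_mult_le_degree:
  assumes "degree p \<le> m" "degree q \<le> k"
  shows "coeff (p * q) (m + k) = coeff p m * coeff q k"
proof -
  have "coeff (p * q) (m + k) = (\<Sum>i\<le>m + k. coeff p i * coeff q (m + k - i))"
    by (rule coeff_mult)
  also have "\<dots> = (\<Sum>i\<in>{m}. coeff p i * coeff q (m + k - i))"
  proof (rule sum.mono_neutral_right)
    show "\<forall>i\<in>{..m + k} - {m}. coeff p i * coeff q (m + k - i) = 0"
    proof
      fix i assume "i \<in> {..m + k} - {m}"
      then have "degree p < i \<or> degree q < m + k - i"
        using assms by auto
      then show "coeff p i * coeff q (m + k - i) = 0"
        by (auto simp: coeff_eq_0)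
    qed
  qed auto
  finally show ?thesis
    by simp
qed

section \<open>The Poincare-Birkhoff-Witt theorem\<close>

lemma weight_le_coeff_mult:
  assumes "\<And>k. weight_le w a (coeff p k)" "\<And>k. weight_le w b (coeff q k)"
  shows "weight_le w (a + b) (coeff (p * q) k)"
  unfolding coeff_mult by (intro weight_le_sum weight_le_mult assms)

lemma weight_le_coeff_power:
  assumes "\<And>k. weight_le w a (coeff p k)"
  shows "weight_le w (a * m) (coeff (p ^ m) k)"
  by (induction m arbitrary: k) (auto intro: weight_le_coeff_mult assms simp: coeff_1)

lemma weight_le_coeff_prod:
  assumes "\<And>i k. i \<in> I \<Longrightarrow> weight_le w (d i) (coeff (f i) k)"
  shows "weight_le w (\<Sum>i\<in>I. d i) (coeff (prod f I) k)"
  using assms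
  by (induction I arbitrary: k rule: infinite_finite_induct) (auto intro: weight_le_coeff_mult simp: coeff_1)

text \<open>Each variable is replaced by a dual number both of whose coefficients have degree at
  most one, so no coefficient of the result gains degree.\<close>

lemma weight_le_polar:
  assumes "weight_le (\<lambda>_. 1) m p"
  shows "weight_le (\<lambda>_. 1) m (polar i j p)"
proof -
  let ?d = "\<lambda>v. if fst (prod_decode v) = j then mat_var i (snd (prod_decode v)) else 0"
  have 1: "weight_le (\<lambda>_. 1) 1 (coeff [:mp_var v, ?d v:] k)" for v k
    by (auto simp: coeff_pCons mat_var_def split: nat.split)
  have 0: "weight_le (\<lambda>_. 1) 0 (coeff [:Poly_Mapping.single 0 c:] k)" for c :: complex and k
    by (auto simp: coeff_pCons split: nat.split)
  have "weight_le (\<lambda>_. 1) m (coeff (dual_eval ?d p) k)" for k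
    unfolding dual_eval_def mp_eval_def coeff_sum
  proof (rule weight_le_sum)
    fix a assume a: "a \<in> Poly_Mapping.keys p"
    have "weight_le (\<lambda>_. 1) (0 + (\<Sum>v\<in>Poly_Mapping.keys a. 1 * Poly_Mapping.lookup a v))
      (coeff ([:Poly_Mapping.single 0 (Poly_Mapping.lookup p a):]
        * (\<Prod>v\<in>Poly_Mapping.keys a. [:mp_var v, ?d v:] ^ Poly_Mapping.lookup a v)) k)"
      by (intro weight_le_coeff_mult weight_le_coeff_prod weight_le_coeff_power 0 1)
    then show "weight_le (\<lambda>_. 1) m (coeff ([:Poly_Mapping.single 0 (Poly_Mapping.lookup p a):]
        * (\<Prod>v\<in>Poly_Mapping.keys a. [:mp_var v, ?d v:] ^ Poly_Mapping.lookup a v)) k)"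
      using assms a by (elim weight_le_mono) (auto simp: weight_le_def mon_weight_def)
  qed
  then show ?thesis
    by (simp add: polar_def derivation_def)
qed

lemma homog_var: "homog (mp_var i) = monom (mp_var i) 1"
  by (simp add: homog_def ring_hom_1_poly_const)

lemma homog_const: "homog (Poly_Mapping.single 0 c) = [:Poly_Mapping.single 0 c:]"
  by (simp add: homog_def ring_hom_1_poly_const)

lemmas homog_simps = ring_hom_1.hom_simps[OF ring_hom_1_homog]

lemma pbw_word:
  "weight_le (\<lambda>_. 1) (length w) (endo_app (word_eval pbw_op w) 1) \<and>
   coeff (homog (endo_app (word_eval pbw_op w) 1)) (length w) = word_eval mat_var w"
proof (induction w)
  case (Cons x w)
  obtain i j where x: "x = (i, j)"
    by force
  let ?f = "endo_app (word_eval pbw_op w) 1"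
  have f: "endo_app (word_eval pbw_op (x # w)) 1 = polar i j ?f + mat_var i j * ?f"
    by (simp add: x pbw_op_def)
  have p: "weight_le (\<lambda>_. 1) (length w) (polar i j ?f)"
    using Cons by (intro weight_le_polar) simp
  have "weight_le (\<lambda>_. 1) (1 + length w) (mat_var i j * ?f)"
    using Cons by (intro weight_le_mult) (auto simp: mat_var_def)
  moreover have "weight_le (\<lambda>_. 1) (1 + length w) (polar i j ?f)"
    by (rule weight_le_mono[OF p]) simp
  moreover have "coeff (homog (polar i j ?f)) (Suc (length w)) = 0"
    using p unfolding weight_le_iff_degree by (intro coeff_eq_0) simp
  ultimately show ?case
    using Cons unfolding f
    by (simp add: x homog_simps mat_var_def homog_var weight_le_add coeff_monom_mult)
qed (simp add: homog_simps)

text \<open>Words shorter than \<open>m\<close> contribute nothing in degree \<open>m\<close> when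
  applied to \<open>1\<close>; what remains in that degree is the symbol at the generic
  matrix.\<close>

lemma pbw_symbol:
  assumes "pbw.eval p = 0" "len_lt (Suc m) p"
  shows "coeff (symb (Poly_Mapping.single 0) mat_var p) m = 0"
proof -
  let ?f = "\<lambda>w. endo_app (word_eval pbw_op w) 1"
  have "0 = coeff (homog (endo_app (pbw.eval p) 1)) m"
    by (simp add: assms homog_simps)
  also have "endo_app (pbw.eval p) 1
      = (\<Sum>w\<in>Poly_Mapping.keys p. Poly_Mapping.single 0 (Poly_Mapping.lookup p w) * ?f w)"
    by (simp add: meval_def endo_app_sum)
  also have "coeff (homog \<dots>) m = (\<Sum>w\<in>Poly_Mapping.keys p.
      Poly_Mapping.single 0 (Poly_Mapping.lookup p w) * coeff (homog (?f w)) m)"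
    by (simp add: homog_simps homog_const coeff_sum)
  also have "\<dots> = (\<Sum>w\<in>Poly_Mapping.keys p. if length w = m
      then Poly_Mapping.single 0 (Poly_Mapping.lookup p w) * word_eval mat_var w else 0)"
  proof (rule sum.cong[OF refl])
    fix w assume "w \<in> Poly_Mapping.keys p"
    then have "length w \<le> m"
      using assms(2) by (auto simp: len_lt_def)
    moreover have "coeff (homog (?f w)) m = 0" if "length w < m"
      using pbw_word[of w] that unfolding weight_le_iff_degree by (intro coeff_eq_0) simp
    ultimately show "Poly_Mapping.single 0 (Poly_Mapping.lookup p w) * coeff (homog (?f w)) m
        = (if length w = m then Poly_Mapping.single 0 (Poly_Mapping.lookup p w) * word_eval mat_var w else 0)"
      using pbw_word[of w] by auto
  qed
  also have "\<dots> = coeff (symb (Poly_Mapping.single 0) mat_var p) m"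
    by (simp add: coeff_symb sum.inter_filter)
  finally show ?thesis
    by simp
qed

text \<open>Bubble sort for an abstract preorder \<open>R\<close>, used for reordering words modulo
  shorter ones and for the symmetry of \<open>principal\<close>. The prefix \<open>pre\<close> is
  carried through the induction because \<open>R\<close> need not be compatible with
  prepending.\<close>

lemma mset_eq_adjacent_swaps:
  assumes "mset xs = mset ys" "set xs \<subseteq> S"
    and "\<And>xs. R xs xs" and "\<And>xs ys zs. R xs ys \<Longrightarrow> R ys zs \<Longrightarrow> R xs zs"
    and swap: "\<And>xs a b ys. set (xs @ a # b # ys) \<subseteq> S \<Longrightarrow> length (xs @ a # b # ys) = m
      \<Longrightarrow> R (xs @ a # b # ys) (xs @ b # a # ys)"
    and "length xs = m"
  shows "R xs ys"
proof -
  have "R (pre @ xs) (pre @ ys)"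
    if "mset xs = mset ys" "set (pre @ xs) \<subseteq> S" "length (pre @ xs) = m" for pre
    using that
  proof (induction xs arbitrary: pre ys)
    case (Cons x xs)
    then have "x \<in> set ys"
      by (metis list.set_intros(1) mset_eq_setD)
    then obtain us vs where ys: "ys = us @ x # vs"
      by (meson split_list)
    have set_eq: "set (x # xs) = set (us @ x # vs)" and len: "length (x # xs) = length (us @ x # vs)"
      using Cons.prems(1) unfolding ys by (rule mset_eq_setD, rule mset_eq_length)
    have "R ((pre @ [x]) @ xs) ((pre @ [x]) @ us @ vs)"
      using Cons.prems by (intro Cons.IH) (auto simp: ys)
    moreover have "R (pre @ x # us @ vs) (pre @ us @ x # vs)"
      if "set (pre @ x # us @ vs) \<subseteq> S" "length (pre @ x # us @ vs) = m" for pre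
      using that
    proof (induction us arbitrary: pre)
      case (Cons u us)
      have "R (pre @ x # u # us @ vs) (pre @ u # x # us @ vs)"
        using Cons.prems by (intro swap) auto
      moreover have "R ((pre @ [u]) @ x # us @ vs) ((pre @ [u]) @ us @ x # vs)"
        using Cons.prems by (intro Cons.IH) auto
      ultimately show ?case
        using assms(4) by fastforce
    qed (simp add: assms(3))
    moreover have "set us \<subseteq> S" "set vs \<subseteq> S"
      using set_eq Cons.prems(2) by auto
    ultimately show ?case
      using assms(4)[of "pre @ x # xs" "pre @ x # us @ vs" "pre @ ys"] Cons.prems(2,3) len
      by (simp add: ys)
  qed (simp add: assms(3))
  from this[of "[]"] show ?thesis
    using assms by simp
qed

definition word_monomial :: "(nat \<times> nat) list \<Rightarrow> nat \<Rightarrow>\<^sub>0 nat"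
  where "word_monomial w = (\<Sum>x\<leftarrow>w. Poly_Mapping.single (prod_encode x) 1)"

lemma word_eval_mat_var: "word_eval mat_var w = Poly_Mapping.single (word_monomial w) 1"
  by (induction w) (auto simp: word_monomial_def mat_var_def mp_var_def mult_single)

lemma lookup_word_monomial: "Poly_Mapping.lookup (word_monomial w) (prod_encode x) = count (mset w) x"
  by (induction w) (auto simp: word_monomial_def lookup_add lookup_single when_def)

lemma word_monomial_eqD: "word_monomial u = word_monomial v \<Longrightarrow> mset u = mset v"
  by (intro multiset_eqI) (simp flip: lookup_word_monomial)

text \<open>Expresses that the class of \<open>p\<close> has order below \<open>m\<close> in the
  enveloping algebra.\<close>

definition reducible :: "nat \<Rightarrow> nat \<Rightarrow> tensor \<Rightarrow> bool"
  where "reducible n m p \<longleftrightarrow> (\<exists>q\<in>tens n. len_lt m q \<and> p - q \<in> ugl_ideal n)"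

lemma reducible_add: "reducible n m p \<Longrightarrow> reducible n m q \<Longrightarrow> reducible n m (p + q)"
proof -
  assume "reducible n m p" "reducible n m q"
  then obtain p' q' where "p' \<in> tens n" "q' \<in> tens n" "len_lt m p'" "len_lt m q'"
      "p - p' \<in> ugl_ideal n" "q - q' \<in> ugl_ideal n"
    by (auto simp: reducible_def)
  then show ?thesis
    unfolding reducible_def using ugl_ideal_add[of "p - p'" n "q - q'"]
    by (intro bexI[of _ "p' + q'"]) (auto simp: algebra_simps)
qed

lemma reducible_self: "p \<in> tens n \<Longrightarrow> len_lt m p \<Longrightarrow> reducible n m p"
  unfolding reducible_def by (intro bexI[of _ p]) auto

lemma reducible_sum: "(\<And>i. i \<in> I \<Longrightarrow> reducible n m (f i)) \<Longrightarrow> reducible n m (sum f I)"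
  by (induction I rule: infinite_finite_induct) (auto intro: reducible_add reducible_self)

lemma reducible_scale:
  assumes "reducible n m p"
  shows "reducible n m (Poly_Mapping.single 0 c * p)"
proof -
  obtain q where "q \<in> tens n" "len_lt m q" "p - q \<in> ugl_ideal n"
    using assms by (auto simp: reducible_def)
  then show ?thesis
    unfolding reducible_def using ugl_ideal_mult_left[OF tens_single_0[of c n], of "p - q"]
    by (intro bexI[of _ "Poly_Mapping.single 0 c * q"])
      (auto simp: algebra_simps intro: len_lt_scale tens_mult[OF tens_single_0])
qed

lemma len_lt_gl_comm: "len_lt (Suc 1) (gl_comm i j k l)"
  unfolding gl_comm_def e_tensor_def by (intro len_lt_diff) auto

lemma tens_gl_comm:
  "i \<in> {1..n} \<Longrightarrow> j \<in> {1..n} \<Longrightarrow> k \<in> {1..n} \<Longrightarrow> l \<in> {1..n} \<Longrightarrow> gl_comm i j k l \<in> tens n"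
  unfolding gl_comm_def by (intro tens_diff) (auto simp: tens_e_tensor)

lemma single_append: "Poly_Mapping.single (u @ v) 1 = Poly_Mapping.single u 1 * (Poly_Mapping.single v 1 :: tensor)"
  by (simp add: mult_single plus_list_def)

lemma single_Cons: "Poly_Mapping.single ((i, j) # v) 1 = e_tensor i j * (Poly_Mapping.single v 1 :: tensor)"
  by (simp add: mult_single plus_list_def e_tensor_def)

text \<open>Exchanging two neighbours costs a bracket, which is one letter shorter than the
  pair.\<close>

lemma swap_reducible:
  assumes "set (us @ a # b # vs) \<subseteq> {1..n} \<times> {1..n}" "length (us @ a # b # vs) = m"
  shows "reducible n m (Poly_Mapping.single (us @ a # b # vs) 1 - Poly_Mapping.single (us @ b # a # vs) 1)"
proof -
  obtain i j k l where ab: "a = (i, j)" "b = (k, l)"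
    by force
  let ?u = "Poly_Mapping.single us 1 :: tensor" and ?v = "Poly_Mapping.single vs 1 :: tensor"
  let ?r = "e_tensor i j * e_tensor k l - e_tensor k l * e_tensor i j - gl_comm i j k l"
  have idx: "i \<in> {1..n}" "j \<in> {1..n}" "k \<in> {1..n}" "l \<in> {1..n}" "?u \<in> tens n" "?v \<in> tens n"
    using assms by (auto simp: ab)
  have eq: "Poly_Mapping.single (us @ a # b # vs) 1 - Poly_Mapping.single (us @ b # a # vs) 1
      - ?u * (gl_comm i j k l * ?v) = ?u * (?r * ?v)"
    unfolding ab single_append single_Cons by (simp add: algebra_simps)
  have "?u * (gl_comm i j k l * ?v) \<in> tens n"
    by (intro tens_mult tens_gl_comm idx)
  moreover have "len_lt (length us + (1 + Suc (length vs))) (?u * (gl_comm i j k l * ?v))"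
    by (intro len_lt_mult len_lt_gl_comm) auto
  moreover have "?u * (?r * ?v) \<in> ugl_ideal n"
    by (intro ugl_ideal_mult_left ugl_ideal_mult_right e_tensor_comm idx)
  ultimately show ?thesis
    unfolding reducible_def using assms(2) by (intro bexI[of _ "?u * (gl_comm i j k l * ?v)"]) (auto simp: eq)
qed

lemma mset_eq_reducible:
  assumes "mset u = mset v" "set u \<subseteq> {1..n} \<times> {1..n}"
  shows "reducible n (length u) (Poly_Mapping.single u 1 - Poly_Mapping.single v 1)"
proof (rule mset_eq_adjacent_swaps[OF assms, where m = "length u"
      and R = "\<lambda>u' v'. reducible n (length u) (Poly_Mapping.single u' 1 - Poly_Mapping.single v' 1)"])
  show "reducible n (length u) (Poly_Mapping.single xs 1 - Poly_Mapping.single zs 1)"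
    if "reducible n (length u) (Poly_Mapping.single xs 1 - Poly_Mapping.single ys 1)"
      "reducible n (length u) (Poly_Mapping.single ys 1 - Poly_Mapping.single zs 1)" for xs ys zs
    using reducible_add[OF that] by simp
  show "reducible n (length u) (Poly_Mapping.single xs 1 - Poly_Mapping.single xs 1)" for xs
    by (rule reducible_self) simp_all
qed (rule swap_reducible refl | assumption)+

text \<open>Every word of length \<open>m\<close> is replaced by a fixed word with the same letters,
  modulo lower order. The vanishing symbol makes these fixed words cancel. No ordered basis is
  involved: \<open>can\<close> picks any word for each monomial.\<close>

theorem pbw_span:
  assumes "p \<in> tens n" "len_lt (Suc m) p" "coeff (symb (Poly_Mapping.single 0) mat_var p) m = 0"
  shows "reducible n m p"
proof -
  define can where "can a = (SOME u. word_monomial u = a)" for a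
  let ?K = "Poly_Mapping.keys p" and ?c = "Poly_Mapping.lookup p"
  let ?T = "{w \<in> ?K. length w = m}" and ?s = "\<lambda>w. can (word_monomial w)"
  have can: "mset (?s w) = mset w" for w
    unfolding can_def by (rule word_monomial_eqD, rule someI_ex) auto
  interpret coeff_hom "Poly_Mapping.single 0 :: complex \<Rightarrow> tensor"
    by unfold_locales (simp add: single_add)
  \<comment> \<open>The linear map from monomials to their chosen words transports the cancellation
    of monomials to words.\<close>
  have "(\<Sum>w\<in>?T. Poly_Mapping.single (?s w) (?c w))
      = meval (Poly_Mapping.single 0) (\<lambda>a. Poly_Mapping.single (can a) 1)
          (\<Sum>w\<in>?T. Poly_Mapping.single (word_monomial w) (?c w))"
    by (simp add: meval_sum mult_single)
  also have "(\<Sum>w\<in>?T. Poly_Mapping.single (word_monomial w) (?c w)) = 0"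
    using assms(3) by (simp add: coeff_symb word_eval_mat_var mult_single)
  finally have zero: "(\<Sum>w\<in>?T. Poly_Mapping.single (?s w) (?c w)) = 0"
    by simp
  have "p = (\<Sum>w\<in>?K. Poly_Mapping.single w (?c w))"
    by (rule poly_mapping_sum_single)
  also have "\<dots> = (\<Sum>w\<in>?K - ?T. Poly_Mapping.single w (?c w)) + (\<Sum>w\<in>?T. Poly_Mapping.single w (?c w))"
    by (rule sum.subset_diff) auto
  also have "(\<Sum>w\<in>?T. Poly_Mapping.single w (?c w))
      = (\<Sum>w\<in>?T. Poly_Mapping.single 0 (?c w) * (Poly_Mapping.single w 1 - Poly_Mapping.single (?s w) 1))"
    using zero by (simp add: right_diff_distrib mult_single sum_subtractf)
  finally have p: "p = (\<Sum>w\<in>?K - ?T. Poly_Mapping.single w (?c w))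
      + (\<Sum>w\<in>?T. Poly_Mapping.single 0 (?c w) * (Poly_Mapping.single w 1 - Poly_Mapping.single (?s w) 1))" .
  have r1: "reducible n m (\<Sum>w\<in>?K - ?T. Poly_Mapping.single w (?c w))"
    using assms(1,2) by (intro reducible_sum reducible_self) (auto simp: tens_def len_lt_def less_Suc_eq)
  have r2: "reducible n m (Poly_Mapping.single 0 (?c w) * (Poly_Mapping.single w 1 - Poly_Mapping.single (?s w) 1))"
    if "w \<in> ?T" for w
    using mset_eq_reducible[of w "?s w" n] can[of w] that assms(1) by (intro reducible_scale) (auto simp: tens_def)
  have "reducible n m ((\<Sum>w\<in>?K - ?T. Poly_Mapping.single w (?c w))
      + (\<Sum>w\<in>?T. Poly_Mapping.single 0 (?c w) * (Poly_Mapping.single w 1 - Poly_Mapping.single (?s w) 1)))"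
    by (rule reducible_add[OF r1 reducible_sum[OF r2]])
  then show ?thesis
    by (rule ssubst[OF p])
qed

text \<open>Descent on the length bound: an element of the kernel has zero symbol, hence is
  congruent to a shorter element, which lies in the kernel again.\<close>

theorem pbw_faithful: "p \<in> tens n \<Longrightarrow> pbw.eval p = 0 \<Longrightarrow> p \<in> ugl_ideal n"
proof -
  have "p \<in> ugl_ideal n" if "p \<in> tens n" "len_lt m p" "pbw.eval p = 0" for m
    using that
  proof (induction m arbitrary: p)
    case 0
    then have "p = 0"
      using poly_mapping_sum_single[of p] by (auto simp: len_lt_def)
    then show ?case
      by simp
  next
    case (Suc m)
    have "reducible n m p"
      by (rule pbw_span[OF Suc.prems(1,2) pbw_symbol[OF Suc.prems(3,2)]])
    then obtain q where q: "q \<in> tens n" "len_lt m q" "p - q \<in> ugl_ideal n"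
      unfolding reducible_def by blast
    have "pbw.eval p - pbw.eval q = 0"
      using pbw.eval_ugl_ideal[OF q(3)] by (simp only: endo_const.meval_diff)
    then have "pbw.eval q = 0"
      by (simp add: Suc.prems(3))
    then have "q \<in> ugl_ideal n"
      by (rule Suc.IH[OF q(1,2)])
    then show ?case
      using ugl_ideal_add[OF q(3), of q] by simp
  qed
  moreover have "\<exists>m. len_lt m p"
  proof (intro exI)
    show "len_lt (Suc (Max (length ` Poly_Mapping.keys p))) p"
      by (auto simp: len_lt_def less_Suc_eq_le)
  qed
  ultimately show "p \<in> tens n \<Longrightarrow> pbw.eval p = 0 \<Longrightarrow> p \<in> ugl_ideal n"
    by blast
qed

text \<open>The symbol at any matrix over any ring is a specialisation of the one at the generic
  matrix \<open>mat_var\<close>.\<close>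

lemma symb_ugl_ideal:
  assumes "p \<in> ugl_ideal n" "len_lt (Suc m) p" "ring_hom_1 \<kappa>"
  shows "coeff (symb \<kappa> X p) m = 0"
proof -
  let ?g = "\<lambda>v. X (fst (prod_decode v)) (snd (prod_decode v))"
  have "mp_eval \<kappa> ?g (coeff (symb (Poly_Mapping.single 0) mat_var p) m)
      = coeff (symb (\<lambda>c. mp_eval \<kappa> ?g (Poly_Mapping.single 0 c)) (\<lambda>i j. mp_eval \<kappa> ?g (mat_var i j)) p) m"
    by (rule hom_coeff_symb[OF ring_hom_1_mp_eval[OF assms(3)]])
  also have "\<dots> = coeff (symb \<kappa> X p) m"
    by (simp add: assms(3) mat_var_def)
  finally show ?thesis
    using pbw_symbol[OF pbw.eval_ugl_ideal[OF assms(1)] assms(2)] by (simp add: assms(3))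
qed

section \<open>Column determinants and the Capelli elements\<close>

lemma cdet_cong:
  assumes "\<And>a b. a \<in> {1..k} \<Longrightarrow> b \<in> {1..k} \<Longrightarrow> X a b = Y a b"
  shows "cdet k X = cdet k Y"
  unfolding cdet_def
proof (intro sum.cong refl arg_cong2[where f = "(*)"] arg_cong[where f = prod_list] map_cong)
  fix \<sigma> j assume "\<sigma> \<in> {\<sigma>. \<sigma> permutes {1..k}}" "j \<in> set [1..<Suc k]"
  then have "\<sigma> j \<in> {1..k}" "j \<in> {1..k}"
    using permutes_in_image[of \<sigma> "{1..k}" j] by auto
  then show "X (\<sigma> j) j = Y (\<sigma> j) j"
    by (rule assms)
qed

lemma (in algebra_eval) meval_cdet: "meval \<kappa> h (cdet k X) = cdet k (\<lambda>a b. meval \<kappa> h (X a b))"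
  by (simp add: cdet_def meval_sum meval_mult meval_prod_list o_def)

definition rowprod :: "nat \<Rightarrow> (nat \<Rightarrow> nat \<Rightarrow> 'r) \<Rightarrow> (nat \<Rightarrow> nat) \<Rightarrow> 'r::ring_1"
  where "rowprod k X \<sigma> = prod_list (map (\<lambda>j. X (\<sigma> j) j) [1..<Suc k])"

lemma cdet_rowprod: "cdet k X = (\<Sum>\<sigma> | \<sigma> permutes {1..k}. of_int (sign \<sigma>) * rowprod k X \<sigma>)"
  by (simp add: cdet_def rowprod_def)

lemma sum_permutes_compose_right:
  assumes "\<pi> permutes S" "\<pi> \<circ> \<pi> = id"
  shows "(\<Sum>\<sigma> | \<sigma> permutes S. f (\<sigma> \<circ> \<pi>)) = (\<Sum>\<sigma> | \<sigma> permutes S. f \<sigma>)"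
  by (rule sum.reindex_bij_witness[where i = "\<lambda>\<sigma>. \<sigma> \<circ> \<pi>" and j = "\<lambda>\<sigma>. \<sigma> \<circ> \<pi>"])
    (auto simp: comp_assoc assms(2) intro: permutes_compose[OF assms(1)])

lemma sum_permutes_compose_left:
  assumes "\<pi> permutes S" "\<pi> \<circ> \<pi> = id"
  shows "(\<Sum>\<sigma> | \<sigma> permutes S. f (\<pi> \<circ> \<sigma>)) = (\<Sum>\<sigma> | \<sigma> permutes S. f \<sigma>)"
  by (rule sum.reindex_bij_witness[where i = "\<lambda>\<sigma>. \<pi> \<circ> \<sigma>" and j = "\<lambda>\<sigma>. \<pi> \<circ> \<sigma>"])
    (auto simp: comp_assoc[symmetric] assms(2) intro: permutes_compose[OF _ assms(1)])

lemma sign_transpose_compose: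
  assumes "\<sigma> permutes {1..k::nat}" "i \<noteq> j"
  shows "sign (Transposition.transpose i j \<circ> \<sigma>) = - sign \<sigma>" "sign (\<sigma> \<circ> Transposition.transpose i j) = - sign \<sigma>"
  using assms permutes_imp_permutation[OF _ assms(1)]
  by (simp_all add: sign_compose permutation_swap_id sign_swap_id)

text \<open>Factors are ordered by columns, so permuting the rows merely reindexes the sum; this
  needs no commutativity. Exchanging columns is the difficult operation.\<close>

lemma cdet_swap_rows:
  fixes X :: "nat \<Rightarrow> nat \<Rightarrow> 'r::ring_1"
  assumes "i \<in> {1..k}" "j \<in> {1..k}" "i \<noteq> j"
  shows "cdet k (\<lambda>a. X (Transposition.transpose i j a)) = - cdet k X"
proof -
  let ?t = "Transposition.transpose i j"
  have t: "?t permutes {1..k}"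
    using assms by (intro permutes_swap_id)
  have "cdet k (\<lambda>a. X (?t a)) = (\<Sum>\<sigma> | \<sigma> permutes {1..k}. of_int (sign \<sigma>) * rowprod k X (?t \<circ> \<sigma>))"
    by (simp add: cdet_rowprod rowprod_def)
  also have "\<dots> = (\<Sum>\<sigma> | \<sigma> permutes {1..k}. - of_int (sign (?t \<circ> \<sigma>)) * rowprod k X (?t \<circ> \<sigma>))"
    using assms by (intro sum.cong refl) (simp add: sign_transpose_compose)
  also have "\<dots> = (\<Sum>\<sigma> | \<sigma> permutes {1..k}. - of_int (sign \<sigma>) * rowprod k X \<sigma>)"
    by (rule sum_permutes_compose_left[OF t transpose_comp_involutory])
  also have "\<dots> = - cdet k X"
    by (simp add: cdet_rowprod sum_negf)
  finally show ?thesis .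
qed

lemma prod_list_upd_diff:
  fixes f :: "nat \<Rightarrow> 'r::ring_1"
  assumes "distinct xs" "b \<in> set xs"
  shows "prod_list (map (f(b := y - z)) xs) = prod_list (map (f(b := y)) xs) - prod_list (map (f(b := z)) xs)"
  using assms
proof (induction xs)
  case (Cons x xs)
  show ?case
  proof (cases "x = b")
    case True
    then have "map (f(b := w)) xs = map f xs" for w
      using Cons.prems by (intro map_cong) auto
    with True show ?thesis
      by (simp only: list.map prod_list.Cons fun_upd_same left_diff_distrib)
  next
    case False
    with Cons have "prod_list (map (f(b := y - z)) xs) = prod_list (map (f(b := y)) xs) - prod_list (map (f(b := z)) xs)"
      by (intro Cons.IH) auto
    then show ?thesis
      by (simp only: list.map prod_list.Cons fun_upd_other[OF False] right_diff_distrib)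
  qed
qed simp

lemma prod_list_upd_zero:
  fixes f :: "nat \<Rightarrow> 'r::ring_1"
  assumes "b \<in> set xs"
  shows "prod_list (map (f(b := 0)) xs) = 0"
  using assms by (induction xs) auto

text \<open>Leibniz rule for the inner derivation given by \<open>x\<close>.\<close>

lemma commutator_prod_list:
  fixes x :: "'r::ring_1"
  shows "x * prod_list (map f [1..<Suc k]) - prod_list (map f [1..<Suc k]) * x
    = (\<Sum>b=1..k. prod_list (map (f(b := x * f b - f b * x)) [1..<Suc k]))"
proof (induction k)
  case (Suc k)
  let ?P = "prod_list (map f [1..<Suc k])" and ?g = "\<lambda>b. f(b := x * f b - f b * x)"
  have upt: "[1..<Suc (Suc k)] = [1..<Suc k] @ [Suc k]"
    by simp
  have "x * (?P * f (Suc k)) - ?P * f (Suc k) * x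
      = (x * ?P - ?P * x) * f (Suc k) + ?P * (x * f (Suc k) - f (Suc k) * x)"
    by (simp add: algebra_simps)
  also have "\<dots> = (\<Sum>b=1..k. prod_list (map (?g b) [1..<Suc k]) * f (Suc k)) + ?P * (x * f (Suc k) - f (Suc k) * x)"
    unfolding Suc.IH sum_distrib_right ..
  also have "\<dots> = (\<Sum>b=1..k. prod_list (map (?g b) [1..<Suc (Suc k)])) + prod_list (map (?g (Suc k)) [1..<Suc (Suc k)])"
  proof (intro arg_cong2[where f = "(+)"] sum.cong refl)
    have "map (?g (Suc k)) [1..<Suc k] = map f [1..<Suc k]"
      by (intro map_cong) auto
    then show "?P * (x * f (Suc k) - f (Suc k) * x) = prod_list (map (?g (Suc k)) [1..<Suc (Suc k)])"
      unfolding upt by simp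
    show "prod_list (map (?g b) [1..<Suc k]) * f (Suc k) = prod_list (map (?g b) [1..<Suc (Suc k)])"
      if "b \<in> {1..k}" for b
      unfolding upt using that by (simp del: upt_Suc)
  qed
  finally have "x * (?P * f (Suc k)) - ?P * f (Suc k) * x
      = (\<Sum>b=1..Suc k. prod_list (map (?g b) [1..<Suc (Suc k)]))"
    by (simp del: upt_Suc)
  moreover have "prod_list (map f [1..<Suc (Suc k)]) = ?P * f (Suc k)"
    unfolding upt by (simp del: upt_Suc)
  ultimately show ?case
    by (simp only:)
qed simp

context gl_family
begin

text \<open>The shift depends on equality of the matrix indices, not on equality of positions in the
  determinant; the rules below thereby stay valid for repeated indices.\<close>

definition entry :: "nat \<Rightarrow> nat \<Rightarrow> nat \<Rightarrow> 'r"
  where "entry p q u = E p q + (if p = q then of_nat u else 0)"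

definition minor :: "nat \<Rightarrow> (nat \<Rightarrow> nat) \<Rightarrow> (nat \<Rightarrow> nat) \<Rightarrow> 'r"
  where "minor k r c = cdet k (\<lambda>a b. entry (r a) (c b) (k - b))"

lemma minor_cong:
  "(\<And>a. a \<in> {1..k} \<Longrightarrow> r a = r' a) \<Longrightarrow> (\<And>a. a \<in> {1..k} \<Longrightarrow> c a = c' a) \<Longrightarrow> minor k r c = minor k r' c'"
  unfolding minor_def by (rule cdet_cong) simp

lemma of_nat_left_commute: "x * (of_nat u * y) = of_nat u * (x * y :: 'r)"
proof -
  have "x * (of_nat u * y) = x * of_nat u * y"
    by (simp only: mult.assoc)
  also have "x * of_nat u = of_nat u * x"
    by (rule mult_of_nat_commute[symmetric])
  finally show ?thesis
    by (simp only: mult.assoc)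
qed

text \<open>The shifts on the right cancel, since both occur exactly when \<open>r = q\<close> and
  \<open>c = p\<close>.\<close>

lemma entry_commute:
  "E p q * entry r c u - entry r c u * E p q = (if r = q then entry p c u else 0) - (if c = p then entry r q u else 0)"
proof -
  have "E p q * entry r c u - entry r c u * E p q = E p q * E r c - E r c * E p q"
    by (simp add: entry_def algebra_simps mult_of_nat_commute)
  then show ?thesis
    unfolding gl_commute by (auto simp: entry_def)
qed

text \<open>The shifts \<open>u + 1\<close>, \<open>u\<close> on consecutive columns compensate for the commutators.\<close>

lemma entry_exchange:
  "entry p c (Suc u) * entry s d u - entry s c (Suc u) * entry p d u
    + (entry p d (Suc u) * entry s c u - entry s d (Suc u) * entry p c u) = 0"
proof -
  define \<delta> where "\<delta> i j = (if i = j then 1 else 0 :: 'r)" for i j :: nat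
  have \<delta>_comm: "x * \<delta> i j = \<delta> i j * x" for x i j
    by (simp add: \<delta>_def)
  have entry: "entry i j v = E i j + of_nat v * \<delta> i j" for i j v
    by (simp add: entry_def \<delta>_def)
  have c1: "E p c * E s d = E s d * E p c + \<delta> c s * E p d - \<delta> d p * E s c"
    using gl_commute[of p c s d] by (auto simp: \<delta>_def algebra_simps split: if_splits)
  have c2: "E s c * E p d = E p d * E s c + \<delta> c p * E s d - \<delta> d s * E p c"
    using gl_commute[of s c p d] by (auto simp: \<delta>_def algebra_simps split: if_splits)
  have sym: "\<delta> c s = \<delta> s c" "\<delta> d p = \<delta> p d" "\<delta> c p = \<delta> p c" "\<delta> d s = \<delta> s d"
    by (auto simp: \<delta>_def)
  have ex: "entry i j v * entry k l w = E i j * E k l + of_nat w * (\<delta> k l * E i j) + of_nat v * (\<delta> i j * E k l)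
      + of_nat v * (of_nat w * (\<delta> i j * \<delta> k l))" for i j k l v w
  proof -
    have "E i j * (of_nat w * \<delta> k l) = of_nat w * (\<delta> k l * E i j)"
      by (simp only: of_nat_left_commute[of "E i j"] \<delta>_comm[of "E i j"])
    moreover have "of_nat v * \<delta> i j * (of_nat w * \<delta> k l) = of_nat v * (of_nat w * (\<delta> i j * \<delta> k l))"
      by (simp only: mult.assoc of_nat_left_commute[of "\<delta> i j"])
    ultimately show ?thesis
      unfolding entry by (simp add: distrib_left distrib_right mult.assoc add.assoc)
  qed
  show ?thesis
    unfolding ex c1 c2 sym by (simp add: algebra_simps \<delta>_comm[of "\<delta> s d" p c] \<delta>_comm[of "\<delta> s c" p d])
qed

text \<open>A single summand has no exchange rule; \<open>entry_exchange\<close> needs the terms of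
  \<open>\<sigma>\<close> and of \<open>\<sigma>\<close> followed after a transposition together.
  Doubling the minors pairs these terms, and \<open>tf\<close> removes the factor two.\<close>

lemma minor_swap_columns:
  assumes tf: "\<And>x::'r. x + x = 0 \<Longrightarrow> x = 0"
    and j: "1 \<le> j" "j < k"
  shows "minor k r (\<lambda>b. c (Transposition.transpose j (Suc j) b)) = - minor k r c"
proof -
  let ?t = "Transposition.transpose j (Suc j)"
  let ?F = "\<lambda>c \<sigma>. rowprod k (\<lambda>a b. entry (r a) (c b) (k - b)) \<sigma>"
  have t: "?t permutes {1..k}"
    using j by (intro permutes_swap_id) auto
  have double: "minor k r c + minor k r c
      = (\<Sum>\<sigma> | \<sigma> permutes {1..k}. of_int (sign \<sigma>) * (?F c \<sigma> - ?F c (\<sigma> \<circ> ?t)))" for c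
  proof -
    have "minor k r c = (\<Sum>\<sigma> | \<sigma> permutes {1..k}. of_int (sign (\<sigma> \<circ> ?t)) * ?F c (\<sigma> \<circ> ?t))"
      unfolding minor_def cdet_rowprod by (rule sum_permutes_compose_right[OF t transpose_comp_involutory, symmetric])
    also have "\<dots> = (\<Sum>\<sigma> | \<sigma> permutes {1..k}. - (of_int (sign \<sigma>) * ?F c (\<sigma> \<circ> ?t)))"
      by (intro sum.cong refl) (simp add: sign_transpose_compose)
    finally have "minor k r c = (\<Sum>\<sigma> | \<sigma> permutes {1..k}. - (of_int (sign \<sigma>) * ?F c (\<sigma> \<circ> ?t)))" .
    moreover have "minor k r c = (\<Sum>\<sigma> | \<sigma> permutes {1..k}. of_int (sign \<sigma>) * ?F c \<sigma>)"
      by (simp add: minor_def cdet_rowprod)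
    ultimately have "minor k r c + minor k r c = (\<Sum>\<sigma> | \<sigma> permutes {1..k}. of_int (sign \<sigma>) * ?F c \<sigma>)
        + (\<Sum>\<sigma> | \<sigma> permutes {1..k}. - (of_int (sign \<sigma>) * ?F c (\<sigma> \<circ> ?t)))"
      by (rule arg_cong2[where f = "(+)", rotated])
    then show ?thesis
      by (simp add: sum.distrib[symmetric] right_diff_distrib)
  qed
  have zero: "?F c \<sigma> - ?F c (\<sigma> \<circ> ?t) + (?F (\<lambda>b. c (?t b)) \<sigma> - ?F (\<lambda>b. c (?t b)) (\<sigma> \<circ> ?t)) = 0" for \<sigma>
  proof -
    have upt: "[1..<Suc k] = [1..<j] @ [j, Suc j] @ [Suc (Suc j)..<Suc k]"
      using j upt_add_eq_append[of 1 j "Suc k - j"] by (simp add: upt_conv_Cons)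
    have fix1: "?t b = b" if "b \<in> set [1..<j] \<or> b \<in> set [Suc (Suc j)..<Suc k]" for b
      using that by (auto intro!: transpose_apply_other)
    define P where "P = prod_list (map (\<lambda>b. entry (r (\<sigma> b)) (c b) (k - b)) [1..<j])"
    define Q where "Q = prod_list (map (\<lambda>b. entry (r (\<sigma> b)) (c b) (k - b)) [Suc (Suc j)..<Suc k])"
    have u: "k - j = Suc (k - Suc j)"
      using j by simp
    have split: "?F c' \<sigma>' = P * (entry (r (\<sigma>' j)) (c' j) (Suc (k - Suc j))
        * entry (r (\<sigma>' (Suc j))) (c' (Suc j)) (k - Suc j)) * Q"
      if "\<And>b. b \<in> set [1..<j] \<or> b \<in> set [Suc (Suc j)..<Suc k] \<Longrightarrow> \<sigma>' b = \<sigma> b \<and> c' b = c b" for \<sigma>' c'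
    proof -
      have "map (\<lambda>b. entry (r (\<sigma>' b)) (c' b) (k - b)) [1..<j] = map (\<lambda>b. entry (r (\<sigma> b)) (c b) (k - b)) [1..<j]"
        using that by (intro map_cong refl) simp
      moreover have "map (\<lambda>b. entry (r (\<sigma>' b)) (c' b) (k - b)) [Suc (Suc j)..<Suc k]
          = map (\<lambda>b. entry (r (\<sigma> b)) (c b) (k - b)) [Suc (Suc j)..<Suc k]"
        using that by (intro map_cong refl) simp
      ultimately show ?thesis
        unfolding rowprod_def upt P_def Q_def map_append prod_list.append
        by (simp only: list.map prod_list.Cons prod_list.Nil mult_1_right u mult.assoc)
    qed
    have "?F c \<sigma> - ?F c (\<sigma> \<circ> ?t) + (?F (\<lambda>b. c (?t b)) \<sigma> - ?F (\<lambda>b. c (?t b)) (\<sigma> \<circ> ?t))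
       = P * (entry (r (\<sigma> j)) (c j) (Suc (k - Suc j)) * entry (r (\<sigma> (Suc j))) (c (Suc j)) (k - Suc j)
           - entry (r (\<sigma> (Suc j))) (c j) (Suc (k - Suc j)) * entry (r (\<sigma> j)) (c (Suc j)) (k - Suc j)
           + (entry (r (\<sigma> j)) (c (Suc j)) (Suc (k - Suc j)) * entry (r (\<sigma> (Suc j))) (c j) (k - Suc j)
           - entry (r (\<sigma> (Suc j))) (c (Suc j)) (Suc (k - Suc j)) * entry (r (\<sigma> j)) (c j) (k - Suc j))) * Q"
      by (subst (1 2 3 4) split) (auto simp: fix1 algebra_simps simp del: upt_Suc)
    then show ?thesis
      by (simp only: entry_exchange mult_zero_left mult_zero_right)
  qed
  let ?m = "minor k r c" and ?m' = "minor k r (\<lambda>b. c (?t b))"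
  have "(?m + ?m') + (?m + ?m') = (?m + ?m) + (?m' + ?m')"
    by simp
  also have "\<dots> = (\<Sum>\<sigma> | \<sigma> permutes {1..k}. of_int (sign \<sigma>)
      * (?F c \<sigma> - ?F c (\<sigma> \<circ> ?t) + (?F (\<lambda>b. c (?t b)) \<sigma> - ?F (\<lambda>b. c (?t b)) (\<sigma> \<circ> ?t))))"
    unfolding double by (simp add: sum.distrib distrib_left)
  also have "\<dots> = 0"
    unfolding zero by simp
  finally have "?m + ?m' = 0"
    by (rule tf)
  then show ?thesis
    by (simp add: eq_neg_iff_add_eq_0 add.commute)
qed

text \<open>The derivation acts on one factor at a time. A row contribution arises in column
  \<open>b\<close> at row \<open>\<sigma> b\<close>; reindexing by \<open>\<sigma>\<close> collects
  these contributions by rows.\<close>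

lemma minor_commute:
  "E p q * minor k r c - minor k r c * E p q
    = (\<Sum>a=1..k. if r a = q then minor k (r(a := p)) c else 0) - (\<Sum>b=1..k. if c b = p then minor k r (c(b := q)) else 0)"
proof -
  let ?F = "\<lambda>r c \<sigma>. rowprod k (\<lambda>a b. entry (r a) (c b) (k - b)) \<sigma>"
  have F: "E p q * ?F r c \<sigma> - ?F r c \<sigma> * E p q
      = (\<Sum>a=1..k. if r a = q then ?F (r(a := p)) c \<sigma> else 0) - (\<Sum>b=1..k. if c b = p then ?F r (c(b := q)) \<sigma> else 0)"
    if \<sigma>: "\<sigma> permutes {1..k}" for \<sigma>
  proof -
    let ?f = "\<lambda>j. entry (r (\<sigma> j)) (c j) (k - j)" and ?L = "[1..<Suc k]"
    have "E p q * ?F r c \<sigma> - ?F r c \<sigma> * E p q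
        = (\<Sum>b=1..k. prod_list (map (?f(b := E p q * ?f b - ?f b * E p q)) ?L))"
      unfolding rowprod_def by (rule commutator_prod_list)
    also have "\<dots> = (\<Sum>b=1..k. (if r (\<sigma> b) = q then ?F (r(\<sigma> b := p)) c \<sigma> else 0)
        - (if c b = p then ?F r (c(b := q)) \<sigma> else 0))"
    proof (intro sum.cong refl)
      fix b assume b: "b \<in> {1..k}"
      have "prod_list (map (?f(b := E p q * ?f b - ?f b * E p q)) ?L)
          = prod_list (map (?f(b := (if r (\<sigma> b) = q then entry p (c b) (k - b) else 0))) ?L)
          - prod_list (map (?f(b := (if c b = p then entry (r (\<sigma> b)) q (k - b) else 0))) ?L)"
        unfolding entry_commute using b by (intro prod_list_upd_diff) (auto simp del: upt_Suc)
      also have "prod_list (map (?f(b := (if r (\<sigma> b) = q then entry p (c b) (k - b) else 0))) ?L)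
          = (if r (\<sigma> b) = q then ?F (r(\<sigma> b := p)) c \<sigma> else 0)"
      proof (cases "r (\<sigma> b) = q")
        case True
        have "map (?f(b := entry p (c b) (k - b))) ?L = map (\<lambda>j. entry ((r(\<sigma> b := p)) (\<sigma> j)) (c j) (k - j)) ?L"
          by (intro map_cong refl) (use permutes_inj[OF \<sigma>] in \<open>auto simp: inj_eq simp del: upt_Suc\<close>)
        with True show ?thesis
          unfolding rowprod_def by (simp only: if_True simp_thms)
      next
        case False
        then show ?thesis
          using prod_list_upd_zero[of b ?L ?f] b by (simp del: upt_Suc)
      qed
      also have "prod_list (map (?f(b := (if c b = p then entry (r (\<sigma> b)) q (k - b) else 0))) ?L)
          = (if c b = p then ?F r (c(b := q)) \<sigma> else 0)"
      proof (cases "c b = p")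
        case True
        have "map (?f(b := entry (r (\<sigma> b)) q (k - b))) ?L = map (\<lambda>j. entry (r (\<sigma> j)) ((c(b := q)) j) (k - j)) ?L"
          by (intro map_cong refl) (auto simp del: upt_Suc)
        with True show ?thesis
          unfolding rowprod_def by (simp only: if_True simp_thms)
      next
        case False
        then show ?thesis
          using prod_list_upd_zero[of b ?L ?f] b by (simp del: upt_Suc)
      qed
      finally show "prod_list (map (?f(b := E p q * ?f b - ?f b * E p q)) ?L)
          = (if r (\<sigma> b) = q then ?F (r(\<sigma> b := p)) c \<sigma> else 0) - (if c b = p then ?F r (c(b := q)) \<sigma> else 0)" .
    qed
    also have "\<dots> = (\<Sum>b=1..k. if r (\<sigma> b) = q then ?F (r(\<sigma> b := p)) c \<sigma> else 0)
        - (\<Sum>b=1..k. if c b = p then ?F r (c(b := q)) \<sigma> else 0)"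
      by (rule sum_subtractf)
    also have "(\<Sum>b=1..k. if r (\<sigma> b) = q then ?F (r(\<sigma> b := p)) c \<sigma> else 0)
        = (\<Sum>a=1..k. if r a = q then ?F (r(a := p)) c \<sigma> else 0)"
      by (rule sum.reindex_bij_betw[OF permutes_imp_bij[OF \<sigma>]])
    finally show ?thesis .
  qed
  have comm: "E p q * (of_int s * x) - of_int s * x * E p q = of_int s * (E p q * x - x * E p q)" for s x
  proof -
    have "E p q * of_int s = of_int s * E p q"
      by (rule mult_of_int_commute[symmetric])
    then have "E p q * (of_int s * x) = of_int s * (E p q * x)"
      by (simp only: mult.assoc[symmetric])
    then show ?thesis
      by (simp add: right_diff_distrib mult.assoc)
  qed
  have swap: "(\<Sum>\<sigma> | \<sigma> permutes {1..k}. of_int (sign \<sigma>) * (\<Sum>a=1..k. if P a then G a \<sigma> else 0))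
      = (\<Sum>a=1..k. if P a then \<Sum>\<sigma> | \<sigma> permutes {1..k}. of_int (sign \<sigma>) * G a \<sigma> else 0)"
    for P and G :: "nat \<Rightarrow> (nat \<Rightarrow> nat) \<Rightarrow> 'r"
  proof -
    have "(\<Sum>\<sigma> | \<sigma> permutes {1..k}. of_int (sign \<sigma>) * (\<Sum>a=1..k. if P a then G a \<sigma> else 0))
        = (\<Sum>a=1..k. \<Sum>\<sigma> | \<sigma> permutes {1..k}. of_int (sign \<sigma>) * (if P a then G a \<sigma> else 0))"
      unfolding sum_distrib_left by (rule sum.swap)
    then show ?thesis
      by (auto intro!: sum.cong)
  qed
  have "E p q * minor k r c - minor k r c * E p q
      = (\<Sum>\<sigma> | \<sigma> permutes {1..k}. of_int (sign \<sigma>) * (E p q * ?F r c \<sigma> - ?F r c \<sigma> * E p q))"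
    unfolding minor_def cdet_rowprod sum_distrib_left sum_distrib_right sum_subtractf[symmetric]
    by (intro sum.cong refl comm)
  also have "\<dots> = (\<Sum>\<sigma> | \<sigma> permutes {1..k}. of_int (sign \<sigma>) * (\<Sum>a=1..k. if r a = q then ?F (r(a := p)) c \<sigma> else 0))
      - (\<Sum>\<sigma> | \<sigma> permutes {1..k}. of_int (sign \<sigma>) * (\<Sum>b=1..k. if c b = p then ?F r (c(b := q)) \<sigma> else 0))"
    unfolding sum_subtractf[symmetric] by (intro sum.cong refl) (auto simp: F right_diff_distrib)
  also have "\<dots> = (\<Sum>a=1..k. if r a = q then minor k (r(a := p)) c else 0)
      - (\<Sum>b=1..k. if c b = p then minor k r (c(b := q)) else 0)"
    unfolding swap minor_def cdet_rowprod ..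
  finally show ?thesis .
qed

section \<open>Central sums of principal minors\<close>

definition principal :: "nat list \<Rightarrow> 'r"
  where "principal xs = minor (length xs) (\<lambda>a. xs ! (a - 1)) (\<lambda>a. xs ! (a - 1))"

text \<open>Division by \<open>2\<close> and by \<open>fact k\<close> is what the argument takes
  from characteristic zero; for operators it is provided by
  \<open>endo_torsion_free\<close>.\<close>

context
  assumes torsion_free: "\<And>m (x::'r). of_nat (Suc m) * x = 0 \<Longrightarrow> x = 0"
begin

lemma two_torsion_free: "x + x = 0 \<Longrightarrow> x = (0::'r)"
  using torsion_free[of 1 x] by (simp add: mult_2)

text \<open>One sign comes from exchanging the columns and one from exchanging the rows.\<close>

lemma principal_swap: "principal (us @ a # b # vs) = principal (us @ b # a # vs)"
proof -
  define k where "k = length (us @ a # b # vs)"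
  define j where "j = Suc (length us)"
  let ?t = "Transposition.transpose j (Suc j)"
  let ?x = "\<lambda>i. (us @ a # b # vs) ! (i - 1)" and ?y = "\<lambda>i. (us @ b # a # vs) ! (i - 1)"
  have xy: "?x i = ?y (?t i)" if "i \<in> {1..k}" for i
  proof -
    consider "i < j" | "i = j" | "i = Suc j" | "i > Suc j"
      by linarith
    then show ?thesis
    proof cases
      case 4
      then have "i - 1 - length us = Suc (Suc (i - Suc (Suc j)))"
        by (simp add: j_def)
      with 4 show ?thesis
        by (simp add: transpose_apply_other nth_append j_def)
    qed (use that in \<open>auto simp: transpose_apply_other nth_append j_def\<close>)
  qed
  have jk: "1 \<le> j" "j < k"
    by (auto simp: j_def k_def)
  have "principal (us @ a # b # vs) = minor k (\<lambda>i. ?y (?t i)) (\<lambda>i. ?y (?t i))"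
    unfolding principal_def k_def[symmetric] by (intro minor_cong xy)
  also have "\<dots> = - minor k (\<lambda>i. ?y (?t i)) ?y"
    by (rule minor_swap_columns[OF two_torsion_free jk])
  also have "minor k (\<lambda>i. ?y (?t i)) ?y = - minor k ?y ?y"
    unfolding minor_def
    using cdet_swap_rows[of j k "Suc j" "\<lambda>a b. entry (?y a) (?y b) (k - b)"] jk by auto
  finally show ?thesis
    by (simp add: principal_def k_def)
qed

lemma principal_mset: "mset xs = mset ys \<Longrightarrow> principal xs = principal ys"
  by (rule mset_eq_adjacent_swaps[where S = UNIV and m = "length xs" and R = "\<lambda>xs ys. principal xs = principal ys"])
    (auto intro: principal_swap)

lemma principal_not_distinct:
  assumes "\<not> distinct xs"
  shows "principal xs = 0"
proof -
  obtain i j where ij: "i < length xs" "j < length xs" "i \<noteq> j" "xs ! i = xs ! j"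
    using assms by (auto simp: distinct_conv_nth)
  let ?X = "\<lambda>a b. entry (xs ! (a - 1)) (xs ! (b - 1)) (length xs - b)"
  have "?X (Transposition.transpose (Suc i) (Suc j) a) = ?X a" for a
    using ij by (cases "a = Suc i"; cases "a = Suc j") (auto simp: transpose_apply_other)
  then have "cdet (length xs) ?X = - cdet (length xs) ?X"
    using cdet_swap_rows[of "Suc i" "length xs" "Suc j" ?X] ij by simp
  then have "principal xs = - principal xs"
    by (simp only: principal_def minor_def)
  then have "principal xs + principal xs = - principal xs + principal xs"
    by (rule arg_cong[where f = "\<lambda>y. y + principal xs"])
  also have "\<dots> = 0"
    by (rule left_minus)
  finally show ?thesis
    by (rule two_torsion_free)
qed

text \<open>The set of all sequences is stable under replacing a single entry, which increasing
  sequences are not. Each increasing sequence is counted once per rearrangement, and sequences with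
  repetitions contribute zero.\<close>

lemma sum_principal:
  "(\<Sum>xs | set xs \<subseteq> {1..n} \<and> length xs = k. principal xs) = of_nat (fact k) * (\<Sum>is\<in>incr_seqs n k. principal is)"
proof -
  let ?A = "{xs. set xs \<subseteq> {1..n} \<and> length xs = k}"
  let ?D = "{xs \<in> ?A. distinct xs}"
  have fin: "finite ?A"
    by (rule finite_lists_length_eq) simp
  have "(\<Sum>xs\<in>?A. principal xs) = (\<Sum>xs\<in>?D. principal xs)"
    by (rule sum.mono_neutral_right[OF fin]) (auto simp: principal_not_distinct)
  also have "\<dots> = (\<Sum>is\<in>incr_seqs n k. \<Sum>xs | xs \<in> ?D \<and> sort xs = is. principal xs)"
  proof (rule sum.group[symmetric])
    show "finite ?D"
      by (rule finite_subset[OF _ fin]) auto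
    show "sort ` ?D \<subseteq> incr_seqs n k"
      by (auto simp: incr_seqs_def strict_sorted_iff)
  qed simp
  also have "\<dots> = (\<Sum>is\<in>incr_seqs n k. of_nat (fact k) * principal is)"
  proof (rule sum.cong[OF refl])
    fix "is" assume mem: "is \<in> incr_seqs n k"
    then have d: "distinct is" "sorted is" "length is = k" "set is \<subseteq> {1..n}"
      by (auto simp: incr_seqs_def strict_sorted_iff)
    have "{xs \<in> ?D. sort xs = is} = permutations_of_set (set is)"
    proof (intro equalityI subsetI)
      fix xs assume "xs \<in> permutations_of_set (set is)"
      then have xs: "set xs = set is" "distinct xs"
        by (auto simp: permutations_of_set_def)
      then have "length xs = k"
        using d distinct_card[of xs] distinct_card[of "is"] by simp
      moreover have "sort xs = is"
        by (rule sorted_distinct_set_unique) (use xs d in auto)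
      ultimately show "xs \<in> {xs \<in> ?D. sort xs = is}"
        using xs d by auto
    qed (auto simp: permutations_of_set_def)
    moreover have "principal xs = principal is" if "xs \<in> {xs \<in> ?D. sort xs = is}" for xs
      using that by (intro principal_mset) auto
    moreover have "card (permutations_of_set (set is)) = fact k"
      using d by (simp add: distinct_card)
    ultimately show "(\<Sum>xs | xs \<in> ?D \<and> sort xs = is. principal xs) = of_nat (fact k) * principal is"
      by simp
  qed
  finally show ?thesis
    by (simp only: sum_distrib_left)
qed

text \<open>Over all sequences, replacing \<open>q\<close> by \<open>p\<close> at position
  \<open>a\<close> is a bijection from the sequences with \<open>q\<close> there to those with
  \<open>p\<close> there. It matches the row terms of \<open>minor_commute\<close> with the column
  terms, so the commutator vanishes; the factor \<open>fact k\<close> is then cancelled.\<close>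

lemma capelli_commute:
  assumes p: "p \<in> {1..n}" and q: "q \<in> {1..n}"
  shows "E p q * (\<Sum>is\<in>incr_seqs n k. principal is) = (\<Sum>is\<in>incr_seqs n k. principal is) * E p q"
proof -
  let ?A = "{xs. set xs \<subseteq> {1..n} \<and> length xs = k}"
  let ?fn = "\<lambda>xs i. xs ! (i - 1)"
  let ?m = "\<lambda>xs ys. minor k (?fn xs) (?fn ys)"
  let ?S = "\<Sum>xs\<in>?A. principal xs" and ?T = "\<Sum>is\<in>incr_seqs n k. principal is"
  have fin: "finite ?A"
    by (rule finite_lists_length_eq) simp
  have upd: "minor k ((?fn xs)(a := x)) (?fn ys) = ?m (xs[a - 1 := x]) ys"
    "minor k (?fn ys) ((?fn xs)(a := x)) = ?m ys (xs[a - 1 := x])"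
    if "a \<in> {1..k}" "length xs = k" for xs ys a x
    using that by (auto intro!: minor_cong simp: nth_list_update)
  have c: "E p q * principal xs - principal xs * E p q
      = (\<Sum>a=1..k. if xs ! (a - 1) = q then ?m (xs[a - 1 := p]) xs else 0)
      - (\<Sum>a=1..k. if xs ! (a - 1) = p then ?m xs (xs[a - 1 := q]) else 0)" if "xs \<in> ?A" for xs
  proof -
    have "length xs = k"
      using that by simp
    then have "E p q * principal xs - principal xs * E p q
      = (\<Sum>a=1..k. if xs ! (a - 1) = q then minor k ((?fn xs)(a := p)) (?fn xs) else 0)
      - (\<Sum>a=1..k. if xs ! (a - 1) = p then minor k (?fn xs) ((?fn xs)(a := q)) else 0)"
      using minor_commute[of p q k "?fn xs" "?fn xs"] by (simp add: principal_def)
    also have "\<dots> = (\<Sum>a=1..k. if xs ! (a - 1) = q then ?m (xs[a - 1 := p]) xs else 0)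
      - (\<Sum>a=1..k. if xs ! (a - 1) = p then ?m xs (xs[a - 1 := q]) else 0)"
      using upd \<open>length xs = k\<close> by (intro arg_cong2[where f = "(-)"] sum.cong refl) auto
    finally show ?thesis .
  qed
  have exch: "(\<Sum>xs\<in>?A. if xs ! (a - 1) = q then ?m (xs[a - 1 := p]) xs else 0)
      = (\<Sum>xs\<in>?A. if xs ! (a - 1) = p then ?m xs (xs[a - 1 := q]) else 0)" if a: "a \<in> {1..k}" for a
  proof -
    have "(\<Sum>xs\<in>{xs \<in> ?A. xs ! (a - 1) = q}. ?m (xs[a - 1 := p]) xs)
        = (\<Sum>xs\<in>{xs \<in> ?A. xs ! (a - 1) = p}. ?m xs (xs[a - 1 := q]))"
    proof (rule sum.reindex_bij_witness[where i = "\<lambda>xs. xs[a - 1 := q]" and j = "\<lambda>xs. xs[a - 1 := p]"])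
      fix xs assume xs: "xs \<in> {xs \<in> ?A. xs ! (a - 1) = q}"
      show "xs[a - 1 := p, a - 1 := q] = xs"
        using xs by (auto simp: list_update_id)
      show "xs[a - 1 := p] \<in> {xs \<in> ?A. xs ! (a - 1) = p}"
        using xs a p set_update_subset_insert[of xs "a - 1" p] by auto
      show "?m (xs[a - 1 := p]) (xs[a - 1 := p, a - 1 := q]) = ?m (xs[a - 1 := p]) xs"
        using xs by (auto simp: list_update_id)
    next
      fix xs assume xs: "xs \<in> {xs \<in> ?A. xs ! (a - 1) = p}"
      show "xs[a - 1 := q, a - 1 := p] = xs"
        using xs by (auto simp: list_update_id)
      show "xs[a - 1 := q] \<in> {xs \<in> ?A. xs ! (a - 1) = q}"
        using xs a q set_update_subset_insert[of xs "a - 1" q] by auto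
    qed
    then show ?thesis
      unfolding sum.inter_filter[OF fin] .
  qed
  have "E p q * ?S - ?S * E p q = (\<Sum>xs\<in>?A. E p q * principal xs - principal xs * E p q)"
    by (simp add: sum_distrib_left sum_distrib_right sum_subtractf)
  also have "\<dots> = (\<Sum>xs\<in>?A. (\<Sum>a=1..k. if xs ! (a - 1) = q then ?m (xs[a - 1 := p]) xs else 0)
      - (\<Sum>a=1..k. if xs ! (a - 1) = p then ?m xs (xs[a - 1 := q]) else 0))"
    by (rule sum.cong[OF refl c])
  also have "\<dots> = (\<Sum>xs\<in>?A. \<Sum>a=1..k. if xs ! (a - 1) = q then ?m (xs[a - 1 := p]) xs else 0)
      - (\<Sum>xs\<in>?A. \<Sum>a=1..k. if xs ! (a - 1) = p then ?m xs (xs[a - 1 := q]) else 0)"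
    by (rule sum_subtractf)
  also have "(\<Sum>xs\<in>?A. \<Sum>a=1..k. if xs ! (a - 1) = q then ?m (xs[a - 1 := p]) xs else 0)
      = (\<Sum>a=1..k. \<Sum>xs\<in>?A. if xs ! (a - 1) = q then ?m (xs[a - 1 := p]) xs else 0)"
    by (rule sum.swap)
  also have "\<dots> = (\<Sum>a=1..k. \<Sum>xs\<in>?A. if xs ! (a - 1) = p then ?m xs (xs[a - 1 := q]) else 0)"
    by (rule sum.cong[OF refl exch])
  also have "\<dots> = (\<Sum>xs\<in>?A. \<Sum>a=1..k. if xs ! (a - 1) = p then ?m xs (xs[a - 1 := q]) else 0)"
    by (rule sum.swap)
  finally have "E p q * ?S - ?S * E p q = 0"
    by simp
  then have "E p q * (of_nat (fact k) * ?T) - of_nat (fact k) * ?T * E p q = 0"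
    unfolding sum_principal .
  then have "of_nat (fact k) * (E p q * ?T - ?T * E p q) = 0"
    by (simp only: of_nat_left_commute[of "E p q"] mult.assoc right_diff_distrib)
  then have "E p q * ?T - ?T * E p q = 0"
    by (rule torsion_free[of "fact k - 1", simplified])
  then show ?thesis
    by simp
qed

end

end

definition capelli_rep :: "nat \<Rightarrow> nat \<Rightarrow> tensor"
  where "capelli_rep n k = (\<Sum>is\<in>incr_seqs n k. cdet k (\<lambda>a b.
       e_tensor (is ! (a - 1)) (is ! (b - 1)) + (if a = b then of_nat (k - a) else 0)))"

lemma capelli_H_eq: "capelli_H n k = ugl_class n (capelli_rep n k)"
  by (simp add: capelli_H_def capelli_rep_def)

lemma incr_seqs_nth: "is \<in> incr_seqs n k \<Longrightarrow> a \<in> {1..k} \<Longrightarrow> is ! (a - 1) \<in> {1..n}"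
proof -
  assume "is \<in> incr_seqs n k" "a \<in> {1..k}"
  then have "set is \<subseteq> {1..n}" "a - 1 < length is"
    by (auto simp: incr_seqs_def)
  then show ?thesis
    using nth_mem[of "a - 1" "is"] by blast
qed

lemma tens_cdet: "(\<And>a b. a \<in> {1..k} \<Longrightarrow> b \<in> {1..k} \<Longrightarrow> X a b \<in> tens n) \<Longrightarrow> cdet k X \<in> tens n"
  unfolding cdet_def
proof (intro tens_sum tens_mult tens_of_int tens_prod_list)
  fix \<sigma> x assume X: "\<And>a b. a \<in> {1..k} \<Longrightarrow> b \<in> {1..k} \<Longrightarrow> X a b \<in> tens n"
    and "\<sigma> \<in> {\<sigma>. \<sigma> permutes {1..k}}" "x \<in> set (map (\<lambda>j. X (\<sigma> j) j) [1..<Suc k])"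
  then obtain j where "j \<in> {1..k}" "x = X (\<sigma> j) j" "\<sigma> permutes {1..k}"
    by (auto simp: less_Suc_eq_le simp del: upt_Suc)
  then show "x \<in> tens n"
    using X permutes_in_image[of \<sigma> "{1..k}" j] by blast
qed

lemma tens_capelli_rep: "capelli_rep n k \<in> tens n"
  unfolding capelli_rep_def
  by (intro tens_sum tens_cdet tens_add tens_e_tensor incr_seqs_nth) auto

lemma (in gl_hom) eval_commute:
  assumes "\<And>i j. i \<in> {1..n} \<Longrightarrow> j \<in> {1..n} \<Longrightarrow> E i j * x = x * E i j" "p \<in> tens n"
  shows "eval p * x = x * eval p"
proof -
  have w: "word_eval E w * x = x * word_eval E w" if "set w \<subseteq> {1..n} \<times> {1..n}" for w
    using that
  proof (induction w)
    case (Cons y w)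
    obtain i j where y: "y = (i, j)"
      by force
    have "E i j * (word_eval E w * x) = x * E i j * word_eval E w"
      using Cons assms(1)[of i j] by (simp add: y flip: mult.assoc)
    then show ?case
      by (simp add: y mult.assoc)
  qed simp
  have "\<kappa> c * word_eval E w * x = x * (\<kappa> c * word_eval E w)" if "set w \<subseteq> {1..n} \<times> {1..n}" for c w
    by (simp only: mult.assoc w[OF that]) (simp only: mult.assoc[symmetric] \<kappa>_comm[of x c])
  then show ?thesis
    using assms(2) unfolding meval_def sum_distrib_left sum_distrib_right
    by (intro sum.cong refl) (auto simp: tens_def)
qed

lemma endo_torsion_free: "of_nat (Suc m) * (x::endo) = 0 \<Longrightarrow> x = 0"
proof -
  assume 0: "of_nat (Suc m) * x = 0"
  have "of_nat k = endo_const (of_nat k)" for k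
    by (rule endo_eqI) (induction k, auto simp: single_add distrib_right)
  then have "endo_const (inverse (of_nat (Suc m))) * (endo_const (of_nat (Suc m)) * x) = 0"
    using 0 by simp
  moreover have "endo_const (inverse (of_nat (Suc m))) * (endo_const (of_nat (Suc m)) * x) = x"
    by (simp add: of_nat_neq_0 pol.\<kappa>_one del: of_nat_Suc flip: mult.assoc pol.\<kappa>_mult)
  ultimately show "x = 0"
    by simp
qed

text \<open>Entries of an increasing sequence are distinct, so equality of positions and equality of
  indices give the same shifts.\<close>

lemma eval_capelli_rep:
  "pbw.eval (capelli_rep n k) = (\<Sum>is\<in>incr_seqs n k. pbw.principal is)"
  unfolding capelli_rep_def endo_const.meval_sum
proof (rule sum.cong[OF refl])
  fix "is" assume mem: "is \<in> incr_seqs n k"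
  then have d: "distinct is" "length is = k"
    by (auto simp: incr_seqs_def strict_sorted_iff)
  have eq: "is ! (a - 1) = is ! (b - 1) \<longleftrightarrow> a = b" if "a \<in> {1..k}" "b \<in> {1..k}" for a b
    using that d by (subst nth_eq_iff_index_eq) auto
  show "pbw.eval (cdet k (\<lambda>a b. e_tensor (is ! (a - 1)) (is ! (b - 1)) + (if a = b then of_nat (k - a) else 0)))
      = pbw.principal is"
    unfolding pbw.meval_cdet pbw.principal_def pbw.minor_def d(2)
    by (rule cdet_cong) (use eq in \<open>auto simp: pbw.entry_def endo_const.meval_add simp del: of_nat_diff\<close>)
qed

theorem capelli_central: "capelli_H n k \<in> carrier (zeta n)"
  unfolding capelli_H_eq class_in_zeta_iff[OF tens_capelli_rep]
proof
  fix q assume q: "q \<in> tens n"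
  have "pbw.eval q * pbw.eval (capelli_rep n k) = pbw.eval (capelli_rep n k) * pbw.eval q"
    unfolding eval_capelli_rep by (rule pbw.eval_commute[OF pbw.capelli_commute[OF endo_torsion_free] q])
  then show "capelli_rep n k * q - q * capelli_rep n k \<in> ugl_ideal n"
    by (intro pbw_faithful tens_diff tens_mult tens_capelli_rep q)
      (simp add: endo_const.meval_diff pbw.meval_mult)
qed

section \<open>Invariant symbols\<close>

lemma tensor_const_commute: "p * Poly_Mapping.single 0 c = Poly_Mapping.single 0 c * (p :: tensor)"
  by (induction p rule: poly_mapping_single_induct[OF subset_UNIV])
    (simp_all add: mult_single distrib_left distrib_right mult.commute)

text \<open>The commutator of \<open>e_tensor i j\<close> with a word, expanded by Leibniz. Unlike
  the bare commutator, whose words are one letter longer, this representative has the length of the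
  word and hence the right order for taking symbols.\<close>

fun ad_word :: "nat \<Rightarrow> nat \<Rightarrow> (nat \<times> nat) list \<Rightarrow> tensor" where
  "ad_word i j [] = 0"
| "ad_word i j ((k, l) # w) = gl_comm i j k l * Poly_Mapping.single w 1 + e_tensor k l * ad_word i j w"

fun ad_symbol :: "nat \<Rightarrow> nat \<Rightarrow> (nat \<Rightarrow> nat \<Rightarrow> 'b) \<Rightarrow> (nat \<times> nat) list \<Rightarrow> 'b::comm_ring_1" where
  "ad_symbol i j X [] = 0"
| "ad_symbol i j X ((k, l) # w) = ((if j = k then X i l else 0) - (if l = i then X k j else 0)) * word_eval X w
    + X k l * ad_symbol i j X w"

lemma ad_word_props:
  assumes "i \<in> {1..n}" "j \<in> {1..n}" "set w \<subseteq> {1..n} \<times> {1..n}"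
  shows "ad_word i j w \<in> tens n" "len_lt (Suc (length w)) (ad_word i j w)"
    "e_tensor i j * Poly_Mapping.single w 1 - Poly_Mapping.single w 1 * e_tensor i j - ad_word i j w \<in> ugl_ideal n"
proof -
  have "ad_word i j w \<in> tens n \<and> len_lt (Suc (length w)) (ad_word i j w) \<and>
    e_tensor i j * Poly_Mapping.single w 1 - Poly_Mapping.single w 1 * e_tensor i j - ad_word i j w \<in> ugl_ideal n"
    using assms(3)
  proof (induction w)
    case Nil
    have "Poly_Mapping.single [] 1 = (1 :: tensor)"
      by (metis single_one zero_list_def)
    then show ?case
      by simp
  next
    case (Cons x w)
    obtain k l where x: "x = (k, l)"
      by force
    have kl: "k \<in> {1..n}" "l \<in> {1..n}" "set w \<subseteq> {1..n} \<times> {1..n}"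
      using Cons.prems by (auto simp: x)
    let ?e = "e_tensor i j" and ?y = "e_tensor k l" and ?w = "Poly_Mapping.single w 1 :: tensor"
    have IH: "ad_word i j w \<in> tens n" "len_lt (Suc (length w)) (ad_word i j w)"
      "?e * ?w - ?w * ?e - ad_word i j w \<in> ugl_ideal n"
      using Cons.IH[OF kl(3)] by auto
    have w: "?w \<in> tens n" "?y \<in> tens n" "gl_comm i j k l \<in> tens n"
      using kl assms by (auto simp: tens_e_tensor tens_gl_comm)
    have "?e * (?y * ?w) - ?y * ?w * ?e - (gl_comm i j k l * ?w + ?y * ad_word i j w)
        = (?e * ?y - ?y * ?e - gl_comm i j k l) * ?w + ?y * (?e * ?w - ?w * ?e - ad_word i j w)"
      by (simp add: algebra_simps)
    also have "\<dots> \<in> ugl_ideal n"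
      by (intro ugl_ideal_add ugl_ideal_mult_right ugl_ideal_mult_left e_tensor_comm assms kl w IH)
    finally have "?e * Poly_Mapping.single (x # w) 1 - Poly_Mapping.single (x # w) 1 * ?e - ad_word i j (x # w) \<in> ugl_ideal n"
      by (simp only: x single_Cons ad_word.simps)
    moreover have "len_lt (1 + Suc (length w)) (gl_comm i j k l * ?w)" "len_lt (1 + Suc (length w)) (?y * ad_word i j w)"
      by (intro len_lt_mult len_lt_gl_comm IH; simp add: e_tensor_def)+
    moreover have "gl_comm i j k l * ?w + ?y * ad_word i j w \<in> tens n"
      by (intro tens_add tens_mult w IH(1))
    ultimately show ?case
      by (auto simp: x)
  qed
  then show "ad_word i j w \<in> tens n" "len_lt (Suc (length w)) (ad_word i j w)"
    "e_tensor i j * Poly_Mapping.single w 1 - Poly_Mapping.single w 1 * e_tensor i j - ad_word i j w \<in> ugl_ideal n"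
    by auto
qed

lemma symb_simps:
  assumes "ring_hom_1 \<kappa>"
  shows "symb \<kappa> X (p + q) = symb \<kappa> X p + symb \<kappa> X q" "symb \<kappa> X (p - q) = symb \<kappa> X p - symb \<kappa> X q"
    "symb \<kappa> X (p * q) = symb \<kappa> X p * symb \<kappa> X q" "symb \<kappa> X 0 = 0" "symb \<kappa> X 1 = 1"
    "symb \<kappa> X (Poly_Mapping.single 0 c) = [:\<kappa> c:]" "symb \<kappa> X (of_nat k) = of_nat k"
    "symb \<kappa> X (Poly_Mapping.single w 1) = monom (word_eval X w) (length w)"
    "symb \<kappa> X (e_tensor i j) = monom (X i j) 1"
    "symb \<kappa> X (sum f I) = (\<Sum>i\<in>I. symb \<kappa> X (f i))" "symb \<kappa> X (p ^ k) = symb \<kappa> X p ^ k"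
    "symb \<kappa> X (prod_list ps) = prod_list (map (symb \<kappa> X) ps)"
    "symb \<kappa> X (cdet k M) = cdet k (\<lambda>a b. symb \<kappa> X (M a b))"
proof -
  interpret algebra_eval "\<lambda>c. [:\<kappa> c:]" "word_eval (\<lambda>i j. monom (X i j) 1)"
    by (rule algebra_eval_symb[OF assms])
  show "symb \<kappa> X (Poly_Mapping.single w 1) = monom (word_eval X w) (length w)" for w
    unfolding symb_def meval_single word_eval_monom by (simp add: ring_hom_1.\<kappa>_one[OF assms])
  then show "symb \<kappa> X (e_tensor i j) = monom (X i j) 1"
    unfolding e_tensor_def by simp
  show "symb \<kappa> X (p + q) = symb \<kappa> X p + symb \<kappa> X q"
    unfolding symb_def by (rule meval_add)
  show "symb \<kappa> X (p - q) = symb \<kappa> X p - symb \<kappa> X q"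
    unfolding symb_def by (rule meval_diff)
  show "symb \<kappa> X (p * q) = symb \<kappa> X p * symb \<kappa> X q"
    unfolding symb_def by (rule meval_mult)
  show "symb \<kappa> X 0 = 0"
    unfolding symb_def by (rule meval_zero)
  show "symb \<kappa> X 1 = 1"
    unfolding symb_def by (rule meval_one)
  show "symb \<kappa> X (Poly_Mapping.single 0 c) = [:\<kappa> c:]"
    unfolding symb_def by (rule meval_const)
  show "symb \<kappa> X (of_nat k) = of_nat k"
    unfolding symb_def by (rule meval_of_nat)
  show "symb \<kappa> X (sum f I) = (\<Sum>i\<in>I. symb \<kappa> X (f i))"
    unfolding symb_def by (rule meval_sum)
  show "symb \<kappa> X (p ^ k) = symb \<kappa> X p ^ k"
    unfolding symb_def by (rule meval_power)
  show "symb \<kappa> X (prod_list ps) = prod_list (map (symb \<kappa> X) ps)"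
    unfolding symb_def by (rule meval_prod_list)
  show "symb \<kappa> X (cdet k M) = cdet k (\<lambda>a b. symb \<kappa> X (M a b))"
    unfolding symb_def by (rule meval_cdet)
qed

lemma symb_ad_word:
  assumes "ring_hom_1 \<kappa>"
  shows "symb \<kappa> X (ad_word i j w) = monom (ad_symbol i j X w) (length w)"
proof (induction w)
  case (Cons x w)
  obtain k l where x: "x = (k, l)"
    by force
  have "symb \<kappa> X (gl_comm i j k l) = monom ((if j = k then X i l else 0) - (if l = i then X k j else 0)) 1"
    by (simp add: gl_comm_def symb_simps[OF assms] diff_monom minus_monom)
  then show ?case
    using Cons by (simp add: x symb_simps[OF assms] mult_monom add_monom)
qed (simp add: symb_simps[OF assms])

definition central :: "nat \<Rightarrow> tensor \<Rightarrow> bool"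
  where "central n p \<longleftrightarrow> p \<in> tens n \<and> (\<forall>q\<in>tens n. p * q - q * p \<in> ugl_ideal n)"

lemma central_iff: "p \<in> tens n \<Longrightarrow> ugl_class n p \<in> carrier (zeta n) \<longleftrightarrow> central n p"
  by (simp add: central_def class_in_zeta_iff)

lemma tensor_sum_words: "p = (\<Sum>w\<in>Poly_Mapping.keys p. Poly_Mapping.single 0 (Poly_Mapping.lookup p w) * (Poly_Mapping.single w 1 :: tensor))"
  using poly_mapping_sum_single[of p] by (simp add: mult_single)

text \<open>Infinitesimal invariance of the leading symbol: for central \<open>p\<close> the
  combination of the \<open>ad_word\<close> terms lies in the ideal and has no word longer than
  \<open>m\<close>, so its symbol in degree \<open>m\<close> is zero.\<close>

lemma central_ad_symbol:
  assumes p: "central n p" "len_lt (Suc m) p" and \<kappa>: "ring_hom_1 \<kappa>" and ij: "i \<in> {1..n}" "j \<in> {1..n}"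
  shows "(\<Sum>w | w \<in> Poly_Mapping.keys p \<and> length w = m. \<kappa> (Poly_Mapping.lookup p w) * ad_symbol i j X w) = 0"
proof -
  let ?e = "e_tensor i j" and ?c = "\<lambda>w. Poly_Mapping.single 0 (Poly_Mapping.lookup p w) :: tensor"
  let ?K = "Poly_Mapping.keys p" and ?w = "\<lambda>w. Poly_Mapping.single w 1 :: tensor"
  define a where "a = (\<Sum>w\<in>?K. ?c w * ad_word i j w)"
  have K: "set w \<subseteq> {1..n} \<times> {1..n}" "length w \<le> m" if "w \<in> ?K" for w
    using p that by (auto simp: central_def tens_def len_lt_def)
  have "?e * p - p * ?e = ?e * (\<Sum>w\<in>?K. ?c w * ?w w) - (\<Sum>w\<in>?K. ?c w * ?w w) * ?e"
    using tensor_sum_words[of p] by (rule arg_cong2[where f = "\<lambda>x y. ?e * x - y * ?e"]) (rule tensor_sum_words)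
  also have "\<dots> = (\<Sum>w\<in>?K. ?e * (?c w * ?w w) - ?c w * ?w w * ?e)"
    by (simp only: sum_distrib_left sum_distrib_right sum_subtractf)
  also have "\<dots> = (\<Sum>w\<in>?K. ?c w * (?e * ?w w - ?w w * ?e))"
  proof (rule sum.cong[OF refl])
    fix w
    have "?e * (?c w * ?w w) = ?e * ?c w * ?w w"
      by (simp only: mult.assoc)
    also have "\<dots> = ?c w * (?e * ?w w)"
      by (simp only: tensor_const_commute mult.assoc)
    finally show "?e * (?c w * ?w w) - ?c w * ?w w * ?e = ?c w * (?e * ?w w - ?w w * ?e)"
      by (simp only: right_diff_distrib mult.assoc)
  qed
  finally have "?e * p - p * ?e - a = (\<Sum>w\<in>?K. ?c w * (?e * ?w w - ?w w * ?e - ad_word i j w))"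
    by (simp only: a_def sum_subtractf[symmetric] right_diff_distrib)
  also have "\<dots> \<in> ugl_ideal n"
    by (intro ugl_ideal_sum ugl_ideal_mult_left tens_single_0 ad_word_props ij K)
  finally have 1: "?e * p - p * ?e - a \<in> ugl_ideal n" .
  have "p * ?e - ?e * p \<in> ugl_ideal n"
    using p(1) tens_e_tensor[OF ij] by (simp add: central_def)
  from ugl_ideal_minus[OF ugl_ideal_add[OF 1 this]] have "a \<in> ugl_ideal n"
    by simp
  moreover have "len_lt (Suc m) a"
    unfolding a_def using K ad_word_props(2)[OF ij]
    by (intro len_lt_sum len_lt_scale) (meson Suc_le_mono len_lt_mono)
  ultimately have "coeff (symb \<kappa> X a) m = 0"
    using \<kappa> by (rule symb_ugl_ideal)
  moreover have "coeff (symb \<kappa> X a) m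
      = (\<Sum>w\<in>?K. if length w = m then \<kappa> (Poly_Mapping.lookup p w) * ad_symbol i j X w else 0)"
    unfolding a_def symb_simps[OF \<kappa>] symb_ad_word[OF \<kappa>] coeff_sum by (intro sum.cong refl) simp
  ultimately show ?thesis
    by (simp add: sum.inter_filter)
qed

section \<open>Invariance of symbols under conjugation\<close>

definition sym_val :: "nat \<Rightarrow> tensor \<Rightarrow> (nat \<Rightarrow> nat \<Rightarrow> complex) \<Rightarrow> complex"
  where "sym_val m p X = coeff (symb (\<lambda>c. c) X p) m"

text \<open>Conjugation by \<open>1 + s E\<^sub>j\<^sub>i\<close>.\<close>

definition conj_by :: "nat \<Rightarrow> nat \<Rightarrow> complex \<Rightarrow> (nat \<Rightarrow> nat \<Rightarrow> complex) \<Rightarrow> nat \<Rightarrow> nat \<Rightarrow> complex"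
  where "conj_by i j s X k l = X k l + (if k = j then s * X i l else 0)
    - (if l = i then s * (X k j + (if k = j then s * X i j else 0)) else 0)"

text \<open>Conjugation by \<open>1 + s E\<close> with \<open>E\<close> a matrix unit off the
  diagonal is a flow, because \<open>E\<close> squares to zero; its velocity at each
  \<open>s\<close> is the bracket with \<open>E\<close> at the current matrix.\<close>

lemma word_eval_conj_deriv:
  assumes "i \<noteq> j"
  shows "((\<lambda>s. word_eval (conj_by i j s X) w) has_field_derivative ad_symbol i j (conj_by i j s X) w) (at s)"
proof (induction w)
  case (Cons x w)
  obtain k l where x: "x = (k, l)"
    by force
  let ?Y = "conj_by i j s X"
  have "((\<lambda>s. conj_by i j s X k l) has_field_derivative
      (if k = j then X i l else 0) - (if l = i then X k j + (if k = j then 2 * s * X i j else 0) else 0)) (at s)"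
    unfolding conj_by_def by (cases "k = j"; cases "l = i") (auto intro!: derivative_eq_intros simp: algebra_simps)
  moreover have "(if k = j then X i l else 0) - (if l = i then X k j + (if k = j then 2 * s * X i j else 0) else 0)
      = (if j = k then ?Y i l else 0) - (if l = i then ?Y k j else 0)"
    using assms by (auto simp: conj_by_def algebra_simps)
  ultimately have "((\<lambda>s. conj_by i j s X k l) has_field_derivative
      (if j = k then ?Y i l else 0) - (if l = i then ?Y k j else 0)) (at s)"
    by (simp only:)
  from DERIV_mult[OF this Cons] show ?case
    by (simp add: x algebra_simps)
qed simp

text \<open>The derivative along the flow is zero by \<open>central_ad_symbol\<close>, so the value
  at \<open>s\<close> agrees with the value at \<open>0\<close>.\<close>

lemma sym_val_conj:
  assumes p: "central n p" "len_lt (Suc m) p" and ij: "i \<in> {1..n}" "j \<in> {1..n}" "i \<noteq> j"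
  shows "sym_val m p (conj_by i j s X) = sym_val m p X"
proof -
  have "((\<lambda>s. sym_val m p (conj_by i j s X)) has_field_derivative 0) (at s)" for s
  proof -
    have "((\<lambda>s. \<Sum>w | w \<in> Poly_Mapping.keys p \<and> length w = m. Poly_Mapping.lookup p w * word_eval (conj_by i j s X) w)
      has_field_derivative (\<Sum>w | w \<in> Poly_Mapping.keys p \<and> length w = m.
        Poly_Mapping.lookup p w * ad_symbol i j (conj_by i j s X) w)) (at s)"
      by (intro DERIV_sum DERIV_cmult word_eval_conj_deriv ij)
    then show ?thesis
      unfolding sym_val_def coeff_symb central_ad_symbol[OF p ring_hom_1_id ij(1,2)] .
  qed
  then have "\<exists>c. \<forall>s\<in>UNIV. sym_val m p (conj_by i j s X) = c"
    by (intro has_field_derivative_zero_constant convex_UNIV)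
  then obtain c where c: "\<And>s. sym_val m p (conj_by i j s X) = c"
    by blast
  have "conj_by i j 0 X = X"
    by (simp add: conj_by_def fun_eq_iff)
  then show ?thesis
    using c[of s] c[of 0] by (simp only:)
qed

lemma word_eval_cong: "(\<And>k l. (k, l) \<in> set w \<Longrightarrow> X k l = Y k l) \<Longrightarrow> word_eval X w = word_eval Y w"
  by (induction w) auto

lemma sym_val_cong:
  assumes "p \<in> tens n" "\<And>k l. k \<in> {1..n} \<Longrightarrow> l \<in> {1..n} \<Longrightarrow> X k l = Y k l"
  shows "sym_val m p X = sym_val m p Y"
  unfolding sym_val_def coeff_symb
proof (rule sum.cong[OF refl])
  fix w assume "w \<in> {w \<in> Poly_Mapping.keys p. length w = m}"
  then have sub: "set w \<subseteq> {1..n} \<times> {1..n}"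
    using assms(1) by (simp add: tens_def)
  have "word_eval X w = word_eval Y w"
  proof (rule word_eval_cong)
    fix k l assume "(k, l) \<in> set w"
    with sub have "k \<in> {1..n}" "l \<in> {1..n}"
      by auto
    then show "X k l = Y k l"
      by (rule assms(2))
  qed
  then show "Poly_Mapping.lookup p w * word_eval X w = Poly_Mapping.lookup p w * word_eval Y w"
    by simp
qed

definition upper :: "nat \<Rightarrow> (nat \<Rightarrow> nat \<Rightarrow> complex) \<Rightarrow> bool"
  where "upper k X \<longleftrightarrow> (\<forall>a b. 1 \<le> b \<longrightarrow> b \<le> k \<longrightarrow> b < a \<longrightarrow> X a b = 0)"

definition diagonal :: "(nat \<Rightarrow> 'b) \<Rightarrow> nat \<Rightarrow> nat \<Rightarrow> 'b::zero"
  where "diagonal x k l = (if k = l then x k else 0)"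

text \<open>A torus-invariant function of an upper triangular matrix depends on the diagonal only: under
  conjugation by \<open>diag(t, t\<^sup>2, \<dots>)\<close> the entry \<open>x\<^sub>k\<^sub>l\<close> acquires the factor \<open>t\<^sup>l\<^sup>-\<^sup>k\<close>.\<close>

lemma sum_ad_symbol_torus:
  fixes Y :: "nat \<Rightarrow> nat \<Rightarrow> 'b::comm_ring_1"
  assumes "set w \<subseteq> {1..n} \<times> {1..n}"
  shows "(\<Sum>i=1..n. of_nat i * ad_symbol i i Y w) = (\<Sum>(k, l)\<leftarrow>w. of_nat k - of_nat l) * word_eval Y w"
  using assms
proof (induction w)
  case (Cons x w)
  obtain k l where x: "x = (k, l)"
    by force
  have kl: "k \<in> {1..n}" "l \<in> {1..n}"
    using Cons.prems by (auto simp: x)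
  have "(\<Sum>i=1..n. of_nat i * ad_symbol i i Y (x # w))
      = (\<Sum>i=1..n. (if k = i then of_nat k * (Y k l * word_eval Y w) else 0)
          - (if l = i then of_nat l * (Y k l * word_eval Y w) else 0) + Y k l * (of_nat i * ad_symbol i i Y w))"
    by (intro sum.cong refl) (auto simp: x algebra_simps)
  also have "\<dots> = (of_nat k - of_nat l) * (Y k l * word_eval Y w) + Y k l * (\<Sum>i=1..n. of_nat i * ad_symbol i i Y w)"
    using kl by (simp add: sum.distrib sum_subtractf sum_distrib_left left_diff_distrib)
  also have "\<dots> = (\<Sum>(k, l)\<leftarrow>x # w. of_nat k - of_nat l) * word_eval Y (x # w)"
    using Cons by (simp add: x algebra_simps)
  finally show ?case .
qed simp

lemma sym_val_upper:
  assumes p: "central n p" "len_lt (Suc m) p" and X: "upper n X"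
  shows "sym_val m p X = sym_val m p (diagonal (\<lambda>k. X k k))"
proof -
  \<comment> \<open>\<open>Y\<close> is the torus conjugate of \<open>X\<close> with a polynomial
    variable in place of the parameter; its value at \<open>1\<close> is \<open>X\<close> on the
    index range, and its value at \<open>0\<close> is the diagonal part.\<close>
  define Y where "Y k l = (if k \<le> l then monom (X k l) (l - k) else 0)" for k l
  define N where "N w = (\<Sum>(k, l)\<leftarrow>w. l - k)" for w :: "(nat \<times> nat) list"
  let ?W = "{w \<in> Poly_Mapping.keys p. length w = m}" and ?c = "Poly_Mapping.lookup p"
  define G where "G = coeff (symb (\<lambda>c. [:c:]) Y p) m"
  have W: "set w \<subseteq> {1..n} \<times> {1..n}" if "w \<in> ?W" for w
    using that p(1) by (auto simp: central_def tens_def)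
  have wY: "(\<Sum>(k, l)\<leftarrow>w. of_nat k - of_nat l) * word_eval Y w = - of_nat (N w) * word_eval Y w"
    and wY': "word_eval Y w = monom (coeff (word_eval Y w) (N w)) (N w)" for w
  proof -
    \<comment> \<open>A letter below the diagonal would spoil the exponent \<open>N\<close>, where
      subtraction is truncated, but then the whole product is zero.\<close>
    have *: "((\<Sum>(k, l)\<leftarrow>w. of_nat k - of_nat l) = (- of_nat (N w) :: complex poly) \<and>
        word_eval Y w = monom (coeff (word_eval Y w) (N w)) (N w)) \<or> word_eval Y w = 0"
    proof (induction w)
      case (Cons x w)
      obtain k l where x: "x = (k, l)"
        by force
      show ?case
      proof (cases "k \<le> l \<and> word_eval Y w \<noteq> 0")
        case True
        then have "word_eval Y w = monom (coeff (word_eval Y w) (N w)) (N w)"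
          using Cons by simp
        then obtain c where c: "word_eval Y w = monom c (N w)"
          by blast
        have "word_eval Y (x # w) = monom (X k l * c) (N (x # w))"
          using True by (simp add: x c Y_def N_def mult_monom)
        moreover have "(\<Sum>(k, l)\<leftarrow>x # w. of_nat k - of_nat l) = (- of_nat (N (x # w)) :: complex poly)"
          using True Cons by (simp add: x N_def of_nat_diff)
        ultimately show ?thesis
          by simp
      next
        case False
        then have "Y k l = 0 \<or> word_eval Y w = 0"
          by (auto simp: Y_def)
        then have "word_eval Y (x # w) = 0"
          by (auto simp: x)
        then show ?thesis
          by simp
      qed
    qed (simp add: N_def monom_0 one_pCons)
    then show "(\<Sum>(k, l)\<leftarrow>w. of_nat k - of_nat l) * word_eval Y w = - of_nat (N w) * word_eval Y w"
      by (elim disjE) simp_all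
    from * show "word_eval Y w = monom (coeff (word_eval Y w) (N w)) (N w)"
      by (elim disjE) simp_all
  qed
  have "0 = (\<Sum>i=1..n. of_nat i * (\<Sum>w\<in>?W. [:?c w:] * ad_symbol i i Y w))"
    using central_ad_symbol[OF p ring_hom_1_pCons, of _ _ Y] by simp
  also have "\<dots> = (\<Sum>w\<in>?W. [:?c w:] * (\<Sum>i=1..n. of_nat i * ad_symbol i i Y w))"
    unfolding sum_distrib_left by (subst sum.swap) (intro sum.cong refl, simp add: algebra_simps)
  also have "\<dots> = (\<Sum>w\<in>?W. [:?c w:] * (- of_nat (N w) * word_eval Y w))"
    by (intro sum.cong refl) (simp only: sum_ad_symbol_torus[OF W] wY)
  finally have zero: "(\<Sum>w\<in>?W. [:?c w:] * (- of_nat (N w) * word_eval Y w)) = 0"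
    by simp
  have cY: "of_nat (N w) * coeff (word_eval Y w) r = of_nat r * coeff (word_eval Y w) r" for w r
    by (subst (1 2) wY') simp
  \<comment> \<open>Coefficientwise the torus identity says that \<open>r\<close> times the
    \<open>r\<close>-th coefficient of \<open>G\<close> vanishes, so \<open>G\<close> is constant
    and its values at \<open>1\<close> and \<open>0\<close> agree.\<close>
  have "coeff G r = 0" if "r \<noteq> 0" for r
  proof -
    have "0 = coeff (\<Sum>w\<in>?W. [:?c w:] * (- of_nat (N w) * word_eval Y w)) r"
      unfolding zero by simp
    also have "\<dots> = (\<Sum>w\<in>?W. ?c w * - (of_nat (N w) * coeff (word_eval Y w) r))"
      unfolding coeff_sum by (intro sum.cong refl) (simp add: of_nat_poly algebra_simps)
    also have "\<dots> = - of_nat r * coeff G r"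
      unfolding cY by (simp add: G_def coeff_symb coeff_sum sum_distrib_left sum_negf mult.left_commute)
    finally show ?thesis
      using that by simp
  qed
  then have "G = [:coeff G 0:]"
    by (intro poly_eqI) (auto simp: coeff_pCons split: nat.split)
  then obtain c where "G = [:c:]"
    by blast
  then have "poly G 1 = poly G 0"
    by simp
  moreover have "poly G t = sym_val m p (\<lambda>k l. poly (Y k l) t)" for t
    unfolding G_def sym_val_def using hom_coeff_symb[OF ring_hom_1_poly[of t], of "\<lambda>c. [:c:]" Y p m] by simp
  moreover have "sym_val m p (\<lambda>k l. poly (Y k l) 1) = sym_val m p X"
    by (rule sym_val_cong[of p n]) (use X p(1) in \<open>auto simp: Y_def poly_monom upper_def central_def\<close>)
  moreover have "sym_val m p (\<lambda>k l. poly (Y k l) 0) = sym_val m p (diagonal (\<lambda>k. X k k))"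
    by (rule sym_val_cong[of p n]) (use p(1) in \<open>auto simp: Y_def poly_monom diagonal_def central_def power_0_left\<close>)
  ultimately show ?thesis
    by simp
qed

text \<open>Placing a \<open>1\<close> at position \<open>(i, Suc i)\<close> does not change the
  symbol. Conjugation with parameter \<open>x i - x (Suc i)\<close> then exchanges the two diagonal
  entries, and exactly this parameter keeps the matrix upper triangular.\<close>

lemma sym_val_diag_swap:
  assumes p: "central n p" "len_lt (Suc m) p" and i: "1 \<le> i" "i < n"
  shows "sym_val m p (diagonal (x(i := x (Suc i), Suc i := x i))) = sym_val m p (diagonal x)"
proof -
  define X where "X k l = (if k = i \<and> l = Suc i then 1 else diagonal x k l)" for k l
  let ?Y = "conj_by i (Suc i) (x i - x (Suc i)) X"
  have "diagonal (\<lambda>k. X k k) = diagonal x"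
    by (auto simp: fun_eq_iff X_def diagonal_def)
  then have "sym_val m p (diagonal x) = sym_val m p (diagonal (\<lambda>k. X k k))"
    by simp
  also have "\<dots> = sym_val m p X"
    by (rule sym_val_upper[OF p, symmetric]) (auto simp: upper_def X_def diagonal_def)
  also have "\<dots> = sym_val m p ?Y"
    by (rule sym_val_conj[OF p, symmetric]) (use i in auto)
  also have "\<dots> = sym_val m p (diagonal (\<lambda>k. ?Y k k))"
    by (rule sym_val_upper[OF p]) (auto simp: upper_def X_def diagonal_def conj_by_def algebra_simps)
  also have "(\<lambda>k. ?Y k k) = x(i := x (Suc i), Suc i := x i)"
    by (auto simp: fun_eq_iff X_def diagonal_def conj_by_def)
  finally show ?thesis
    by (simp only:)
qed

section \<open>Triangularisation by transvections\<close>

definition eigen :: "nat \<Rightarrow> nat \<Rightarrow> (nat \<Rightarrow> nat \<Rightarrow> complex) \<Rightarrow> complex \<Rightarrow> (nat \<Rightarrow> complex) \<Rightarrow> bool"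
  where "eigen k n X c v \<longleftrightarrow> (\<forall>a\<in>{Suc k..n}. (\<Sum>b=Suc k..n. X a b * v b) = c * v a)"

lemma eigen_exists:
  assumes "k < n"
  shows "\<exists>c v. eigen k n X c v \<and> (\<exists>a\<in>{Suc k..n}. v a \<noteq> 0)"
proof -
  let ?N = "n - k"
  define A where "A = mat ?N ?N (\<lambda>(a, b). X (a + Suc k) (b + Suc k))"
  have A: "A \<in> carrier_mat ?N ?N"
    by (simp add: A_def)
  have "spectrum A \<noteq> {}"
    using spectrum_non_empty[OF A] assms by simp
  then obtain c w where "eigenvector A w c"
    by (auto simp: spectrum_def eigenvalue_def)
  then have w: "w \<in> carrier_vec ?N" "w \<noteq> 0\<^sub>v ?N" "A *\<^sub>v w = c \<cdot>\<^sub>v w"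
    using A by (auto simp: eigenvector_def)
  define v where "v a = w $ (a - Suc k)" for a
  have "eigen k n X c v"
    unfolding eigen_def
  proof
    fix a assume a: "a \<in> {Suc k..n}"
    have "(\<Sum>b=Suc k..n. X a b * v b) = (\<Sum>b=0..<?N. X a (b + Suc k) * w $ b)"
      by (rule sum.reindex_bij_witness[where i = "\<lambda>b. b + Suc k" and j = "\<lambda>b. b - Suc k"])
        (auto simp: v_def)
    also have "\<dots> = (A *\<^sub>v w) $ (a - Suc k)"
      using a w(1) by (auto simp: A_def scalar_prod_def intro!: sum.cong)
    also have "\<dots> = c * v a"
      using a w by (auto simp: v_def)
    finally show "(\<Sum>b=Suc k..n. X a b * v b) = c * v a" .
  qed
  moreover obtain b where "b < ?N" "w $ b \<noteq> 0"
    using w(1,2) by (metis carrier_vecD eq_vecI index_zero_vec(1,2))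
  then have "\<exists>a\<in>{Suc k..n}. v a \<noteq> 0"
    by (intro bexI[of _ "b + Suc k"]) (auto simp: v_def)
  ultimately show ?thesis
    by blast
qed

text \<open>The eigenvector of the trailing block undergoes the same transvection by which the
  matrix is conjugated.\<close>

lemma eigen_conj:
  assumes "eigen k n X c v" "i \<in> {Suc k..n}" "j \<in> {Suc k..n}" "i \<noteq> j"
  shows "eigen k n (conj_by i j s X) c (v(j := v j + s * v i))"
  unfolding eigen_def
proof
  fix a assume a: "a \<in> {Suc k..n}"
  let ?R = "{Suc k..n}"
  define Z where "Z b = X a b + (if a = j then s * X i b else 0)" for b
  have "(\<Sum>b\<in>?R. conj_by i j s X a b * (v(j := v j + s * v i)) b)
      = (\<Sum>b\<in>?R. Z b * v b + (if b = j then s * Z j * v i else 0) - (if b = i then s * Z j * v i else 0))"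
    using assms(4) by (intro sum.cong refl) (auto simp: conj_by_def Z_def algebra_simps)
  also have "\<dots> = (\<Sum>b\<in>?R. Z b * v b)"
    using assms by (simp add: sum.distrib sum_subtractf)
  also have "\<dots> = (\<Sum>b\<in>?R. X a b * v b) + (if a = j then s * (\<Sum>b\<in>?R. X i b * v b) else 0)"
    by (simp add: Z_def distrib_right sum.distrib sum_distrib_left mult.assoc)
  also have "\<dots> = c * (v(j := v j + s * v i)) a"
    using assms a by (auto simp: eigen_def algebra_simps)
  finally show "(\<Sum>b\<in>?R. conj_by i j s X a b * (v(j := v j + s * v i)) b) = c * (v(j := v j + s * v i)) a" .
qed

lemma upper_conj:
  assumes "upper k X" "i \<in> {Suc k..n}" "j \<in> {Suc k..n}"
  shows "upper k (conj_by i j s X)"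
  using assms by (auto simp: upper_def conj_by_def)

text \<open>Deflation by transvections, valid for every matrix: an eigenvector of the trailing block
  is moved to a multiple of the first unit vector of that block, after which the corresponding
  column is triangular. Later transvections act in a smaller block and keep the finished
  columns.\<close>

lemma triangularise:
  fixes F :: "(nat \<Rightarrow> nat \<Rightarrow> complex) \<Rightarrow> complex"
  assumes F: "\<And>i j s X. i \<in> {1..n} \<Longrightarrow> j \<in> {1..n} \<Longrightarrow> i \<noteq> j \<Longrightarrow> F (conj_by i j s X) = F X"
    and cong: "\<And>X Y. (\<And>k l. k \<in> {1..n} \<Longrightarrow> l \<in> {1..n} \<Longrightarrow> X k l = Y k l) \<Longrightarrow> F X = F Y"
    and "k \<le> n"
  shows "\<exists>Y. upper k Y \<and> F Y = F X"
  using \<open>k \<le> n\<close>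
proof (induction k)
  case 0
  then show ?case
    by (auto simp: upper_def)
next
  case (Suc k)
  then obtain Y where Y: "upper k Y" "F Y = F X"
    by auto
  let ?R = "{Suc k..n}" and ?h = "Suc k"
  have F': "F (conj_by i j s Z) = F Z" if "i \<in> ?R" "j \<in> ?R" "i \<noteq> j" for i j s Z
    using that by (intro F) auto
  obtain c v where v: "eigen k n Y c v" "\<exists>a\<in>?R. v a \<noteq> 0"
    using eigen_exists[of k n Y] Suc.prems by auto
  \<comment> \<open>If the leading coordinate of the eigenvector is zero, one transvection adds a
    nonzero coordinate to it.\<close>
  have "\<exists>Y v. upper k Y \<and> F Y = F X \<and> eigen k n Y c v \<and> v ?h \<noteq> 0"
  proof (cases "v ?h = 0")
    case True
    obtain a where va: "a \<in> ?R" "v a \<noteq> 0"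
      using v(2) by blast
    with True have a: "a \<in> ?R" "a \<noteq> ?h" "v a \<noteq> 0"
      by metis+
    have h: "?h \<in> ?R"
      using Suc.prems by simp
    show ?thesis
      using upper_conj[OF Y(1) a(1) h, of 1] F'[OF a(1) h a(2), of 1 Y] Y(2)
        eigen_conj[OF v(1) a(1) h a(2), of 1] a(3) True
      by (intro exI[of _ "conj_by a ?h 1 Y"] exI[of _ "v(?h := v ?h + 1 * v a)"]) simp
  qed (use Y v in auto)
  then obtain Y0 v0 where Y0: "upper k Y0" "F Y0 = F X" "eigen k n Y0 c v0" "v0 ?h \<noteq> 0"
    by auto
  have "\<exists>Y v. upper k Y \<and> F Y = F X \<and> eigen k n Y c v \<and> v ?h \<noteq> 0 \<and> (\<forall>a\<in>{Suc ?h..r}. v a = 0)"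
    if "r \<le> n" for r
    using that
  proof (induction r)
    case 0
    then show ?case
      using Y0 by auto
  next
    case (Suc r)
    then obtain Y v where Yv: "upper k Y" "F Y = F X" "eigen k n Y c v" "v ?h \<noteq> 0" "\<forall>a\<in>{Suc ?h..r}. v a = 0"
      by auto
    show ?case
    proof (cases "Suc ?h \<le> Suc r")
      case True
      \<comment> \<open>This parameter clears coordinate \<open>Suc r\<close> by means of the
        nonzero leading coordinate.\<close>
      let ?s = "- v (Suc r) / v ?h"
      have R: "?h \<in> ?R" "Suc r \<in> ?R" "?h \<noteq> Suc r"
        using Suc.prems True by auto
      define v' where "v' = v(Suc r := v (Suc r) + ?s * v ?h)"
      have "\<forall>a\<in>{Suc ?h..Suc r}. v' a = 0"
        using Yv(4,5) by (auto simp: v'_def le_Suc_eq)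
      moreover have "v' ?h \<noteq> 0"
        using Yv(4) R(3) by (simp add: v'_def)
      moreover have "eigen k n (conj_by ?h (Suc r) ?s Y) c v'"
        unfolding v'_def by (rule eigen_conj[OF Yv(3) R])
      moreover have "F (conj_by ?h (Suc r) ?s Y) = F X"
        using F'[OF R] Yv(2) by simp
      ultimately show ?thesis
        using upper_conj[OF Yv(1) R(1,2), of ?s] by blast
    next
      case False
      then show ?thesis
        using Yv by (intro exI[of _ Y] exI[of _ v]) auto
    qed
  qed
  from this[of n] obtain Y1 v1 where Y1: "upper k Y1" "F Y1 = F X" "eigen k n Y1 c v1" "v1 ?h \<noteq> 0"
      "\<forall>a\<in>{Suc ?h..n}. v1 a = 0"
    by auto
  \<comment> \<open>Since \<open>v1\<close> is supported at \<open>?h\<close> within the block, row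
    \<open>a\<close> of the eigenvalue equation reduces to
    \<open>Y1 a ?h * v1 ?h = 0\<close>.\<close>
  have zero: "Y1 a ?h = 0" if "a \<in> {Suc ?h..n}" for a
  proof -
    have "(\<Sum>b\<in>?R. Y1 a b * v1 b) = c * v1 a"
      using Y1(3) that by (auto simp: eigen_def)
    moreover have "(\<Sum>b\<in>?R. Y1 a b * v1 b) = (\<Sum>b\<in>?R. if b = ?h then Y1 a ?h * v1 ?h else 0)"
      using Y1(5) by (intro sum.cong refl) auto
    ultimately show ?thesis
      using Y1(4,5) that Suc.prems by simp
  qed
  \<comment> \<open>\<open>upper\<close> also constrains rows beyond \<open>n\<close>; by
    \<open>cong\<close> these are invisible to \<open>F\<close>, so they may be set to zero.\<close>
  define Z where "Z a b = (if a \<in> {1..n} then Y1 a b else 0)" for a b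
  have "F Z = F Y1"
    by (rule cong) (simp add: Z_def)
  moreover have "upper (Suc k) Z"
    using Y1(1) zero by (auto simp: upper_def Z_def le_Suc_eq)
  ultimately show ?case
    using Y1(2) by auto
qed

theorem sym_val_determined_by_diag:
  assumes p: "central n p" "len_lt (Suc m) p" and 0: "\<And>x. sym_val m p (diagonal x) = 0"
  shows "sym_val m p X = 0"
proof -
  have "p \<in> tens n"
    using p(1) by (simp add: central_def)
  from triangularise[where F = "sym_val m p" and X = X, OF sym_val_conj[OF p] sym_val_cong[OF this] le_refl]
  obtain Y where Y: "upper n Y" "sym_val m p Y = sym_val m p X"
    by blast
  then show ?thesis
    using sym_val_upper[OF p Y(1)] 0 by simp
qed

section \<open>Central elements are polynomials in the Capelli elements\<close>

lemma centralI: "p \<in> tens n \<Longrightarrow> (\<And>q. q \<in> tens n \<Longrightarrow> p * q - q * p \<in> ugl_ideal n) \<Longrightarrow> central n p"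
  by (simp add: central_def)

lemma central_tens: "central n p \<Longrightarrow> p \<in> tens n"
  by (simp add: central_def)

lemma central_commute: "central n p \<Longrightarrow> q \<in> tens n \<Longrightarrow> p * q - q * p \<in> ugl_ideal n"
  by (simp add: central_def)

lemma central_ideal: "p \<in> ugl_ideal n \<Longrightarrow> central n p"
  using ugl_ideal_subset by (intro centralI ugl_ideal_diff ugl_ideal_mult_left ugl_ideal_mult_right) auto

lemma central_add:
  assumes "central n p" "central n q"
  shows "central n (p + q)"
proof (rule centralI)
  fix r assume r: "r \<in> tens n"
  have "(p + q) * r - r * (p + q) = (p * r - r * p) + (q * r - r * q)"
    by (simp add: algebra_simps)
  also have "\<dots> \<in> ugl_ideal n"
    by (intro ugl_ideal_add central_commute assms r)
  finally show "(p + q) * r - r * (p + q) \<in> ugl_ideal n" .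
qed (use assms in \<open>auto simp: central_tens\<close>)

lemma central_mult:
  assumes "central n p" "central n q"
  shows "central n (p * q)"
proof (rule centralI)
  fix r assume r: "r \<in> tens n"
  have "p * q * r - r * (p * q) = p * (q * r - r * q) + (p * r - r * p) * q"
    by (simp add: algebra_simps)
  also have "\<dots> \<in> ugl_ideal n"
    by (intro ugl_ideal_add ugl_ideal_mult_left ugl_ideal_mult_right central_commute assms r)
      (use assms in \<open>auto simp: central_tens\<close>)
  finally show "p * q * r - r * (p * q) \<in> ugl_ideal n" .
qed (use assms in \<open>auto simp: central_tens\<close>)

lemma central_const [simp]: "central n (Poly_Mapping.single 0 c)"
  by (rule centralI) (simp_all only: tensor_const_commute diff_self ugl_ideal_zero tens_single_0)

lemma central_zero [simp]: "central n 0"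
  using central_const[of n 0] by simp

lemma central_one [simp]: "central n 1"
  using central_const[of n 1] by simp

lemma central_diff: "central n p \<Longrightarrow> central n q \<Longrightarrow> central n (p - q)"
  using central_add[OF _ central_mult[OF central_const[of n "- 1"]], of p q] by (simp add: single_uminus)

lemma central_sum: "(\<And>i. i \<in> I \<Longrightarrow> central n (f i)) \<Longrightarrow> central n (sum f I)"
  by (induction I rule: infinite_finite_induct) (auto intro: central_add)

lemma central_power: "central n p \<Longrightarrow> central n (p ^ k)"
  by (induction k) (auto intro: central_mult)

lemma central_prod_list: "(\<And>x. x \<in> set xs \<Longrightarrow> central n (f x)) \<Longrightarrow> central n (\<Prod>x\<leftarrow>xs. f x)"
  by (induction xs) (auto intro: central_mult)

lemma central_capelli_rep: "central n (capelli_rep n k)"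
  using capelli_central[of n k] by (simp add: capelli_H_eq central_iff tens_capelli_rep)

lemma len_lt_capelli_rep: "len_lt (Suc k) (capelli_rep n k)"
  unfolding capelli_rep_def cdet_def
proof (intro len_lt_sum)
  fix "is" \<sigma>
  let ?X = "\<lambda>a b. e_tensor (is ! (a - 1)) (is ! (b - 1)) + (if a = b then of_nat (k - a) else 0)"
  have "len_lt (Suc 1) (?X a b)" for a b
  proof -
    have "of_nat (k - a) = (Poly_Mapping.single 0 (of_nat (k - a)) :: tensor)"
      by (rule single_of_nat[symmetric])
    then have "len_lt (Suc 1) (if a = b then of_nat (k - a) else (0::tensor))"
      by (simp only: if_split) (simp add: zero_list_def)
    moreover have "len_lt (Suc 1) (e_tensor (is ! (a - 1)) (is ! (b - 1)))"
      by (simp add: e_tensor_def)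
    ultimately show ?thesis
      by (intro len_lt_add)
  qed
  then have "len_lt (Suc (\<Sum>j\<leftarrow>[1..<Suc k]. 1)) (\<Prod>j\<leftarrow>[1..<Suc k]. ?X (\<sigma> j) j)"
    by (intro len_lt_prod_list)
  then have "len_lt (Suc k) (Poly_Mapping.single 0 (of_int (sign \<sigma>)) * (\<Prod>j\<leftarrow>[1..<Suc k]. ?X (\<sigma> j) j))"
    by (intro len_lt_scale) (simp add: sum_list_triv del: upt_Suc)
  then show "len_lt (Suc k) (of_int (sign \<sigma>) * (\<Prod>j\<leftarrow>[1..<Suc k]. ?X (\<sigma> j) j))"
    by (simp only: single_of_int)
qed

text \<open>In general the factors commute only modulo the ideal, so an order of multiplication has
  to be fixed.\<close>

definition capelli_mon :: "nat \<Rightarrow> (nat \<Rightarrow>\<^sub>0 nat) \<Rightarrow> tensor"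
  where "capelli_mon n a = (\<Prod>i\<leftarrow>[1..<Suc n]. capelli_rep n i ^ Poly_Mapping.lookup a i)"

definition capelli_poly :: "nat \<Rightarrow> mpoly \<Rightarrow> tensor"
  where "capelli_poly n = meval (Poly_Mapping.single 0) (capelli_mon n)"

interpretation tensor_const: coeff_hom "Poly_Mapping.single 0 :: complex \<Rightarrow> tensor"
  by unfold_locales (simp add: single_add)

lemma capelli_poly_add: "capelli_poly n (P + Q) = capelli_poly n P + capelli_poly n Q"
  by (simp add: capelli_poly_def tensor_const.meval_add)

lemma capelli_poly_eq: "capelli_poly n P
    = (\<Sum>a\<in>Poly_Mapping.keys P. Poly_Mapping.single 0 (Poly_Mapping.lookup P a) * capelli_mon n a)"
  by (simp add: capelli_poly_def meval_def)

lemma central_capelli_mon: "central n (capelli_mon n a)"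
  unfolding capelli_mon_def by (intro central_prod_list central_power central_capelli_rep)

lemma central_capelli_poly: "central n (capelli_poly n P)"
  unfolding capelli_poly_eq by (intro central_sum central_mult central_const central_capelli_mon)

lemma mon_weight_list:
  "Poly_Mapping.keys a \<subseteq> {1..n} \<Longrightarrow> mon_weight w a = (\<Sum>i\<leftarrow>[1..<Suc n]. w i * Poly_Mapping.lookup a i)"
  by (subst mon_weight_superset[of "{1..n}"])
    (auto simp: sum.distinct_set_conv_list[symmetric] atLeastLessThanSuc_atLeastAtMost simp del: upt_Suc)

lemma mon_eval_list:
  "Poly_Mapping.keys a \<subseteq> {1..n} \<Longrightarrow> mon_eval g a = (\<Prod>i\<leftarrow>[1..<Suc n]. g i ^ Poly_Mapping.lookup a i)"
  by (subst mon_eval_superset[of "{1..n}"])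
    (auto simp: prod.distinct_set_conv_list[symmetric] atLeastLessThanSuc_atLeastAtMost simp del: upt_Suc)

lemma len_lt_capelli_poly:
  assumes "vars_in {1..n} P" "weight_le (\<lambda>i. i) m P"
  shows "len_lt (Suc m) (capelli_poly n P)"
  unfolding capelli_poly_eq
proof (intro len_lt_sum len_lt_scale)
  fix a assume a: "a \<in> Poly_Mapping.keys P"
  have "len_lt (Suc (\<Sum>i\<leftarrow>[1..<Suc n]. i * Poly_Mapping.lookup a i)) (capelli_mon n a)"
    unfolding capelli_mon_def by (intro len_lt_prod_list len_lt_power len_lt_capelli_rep)
  moreover have "(\<Sum>i\<leftarrow>[1..<Suc n]. i * Poly_Mapping.lookup a i) \<le> m"
    using a assms mon_weight_list[of a n "\<lambda>i. i"] by (auto simp: vars_in_def weight_le_def simp del: upt_Suc)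
  ultimately show "len_lt (Suc m) (capelli_mon n a)"
    by (elim len_lt_mono) simp
qed

subsection \<open>Top coefficients\<close>

text \<open>The value \<open>r\<close> may be zero, so top coefficients multiply without any
  discussion of cancellation.\<close>

definition top_coeff :: "nat \<Rightarrow> 'b poly \<Rightarrow> 'b::comm_ring_1 \<Rightarrow> bool"
  where "top_coeff m q r \<longleftrightarrow> degree q \<le> m \<and> coeff q m = r"

lemma top_coeff_mult: "top_coeff m q r \<Longrightarrow> top_coeff k q' r' \<Longrightarrow> top_coeff (m + k) (q * q') (r * r')"
  using degree_mult_le[of q q'] by (auto simp: top_coeff_def coeff_mult_le_degree)

lemma top_coeff_one: "top_coeff 0 1 1"
  by (simp add: top_coeff_def)

lemma top_coeff_power: "top_coeff m q r \<Longrightarrow> top_coeff (m * k) (q ^ k) (r ^ k)"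
  by (induction k) (auto intro: top_coeff_mult top_coeff_one)

lemma top_coeff_prod_list:
  "(\<And>x. x \<in> set xs \<Longrightarrow> top_coeff (d x) (f x) (r x)) \<Longrightarrow> top_coeff (\<Sum>x\<leftarrow>xs. d x) (\<Prod>x\<leftarrow>xs. f x) (\<Prod>x\<leftarrow>xs. r x)"
  by (induction xs) (auto intro: top_coeff_mult top_coeff_one)

lemma prod_list_mem_zero: "f x = 0 \<Longrightarrow> x \<in> set xs \<Longrightarrow> (\<Prod>x\<leftarrow>xs. f x) = (0::'r::ring_1)"
  by (induction xs) auto

lemma cdet_diagonal:
  assumes "\<And>a b. a \<in> {1..k} \<Longrightarrow> b \<in> {1..k} \<Longrightarrow> a \<noteq> b \<Longrightarrow> X a b = 0"
  shows "cdet k X = (\<Prod>j\<leftarrow>[1..<Suc k]. X j j)"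
proof -
  have zero: "(\<Prod>j\<leftarrow>[1..<Suc k]. X (\<sigma> j) j) = 0" if \<sigma>: "\<sigma> permutes {1..k}" "\<sigma> \<noteq> id" for \<sigma>
  proof -
    obtain j where "\<sigma> j \<noteq> j"
      using \<sigma>(2) by (auto simp: fun_eq_iff)
    moreover from this have "j \<in> {1..k}"
      using \<sigma>(1) by (auto simp: permutes_def)
    ultimately have "X (\<sigma> j) j = 0" "j \<in> set [1..<Suc k]"
      using assms permutes_in_image[OF \<sigma>(1), of j] by auto
    then show ?thesis
      by (intro prod_list_mem_zero)
  qed
  have "cdet k X = (\<Sum>\<sigma> | \<sigma> permutes {1..k}. if \<sigma> = id then (\<Prod>j\<leftarrow>[1..<Suc k]. X j j) else 0)"
    unfolding cdet_def
  proof (rule sum.cong[OF refl])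
    fix \<sigma> assume "\<sigma> \<in> {\<sigma>. \<sigma> permutes {1..k}}"
    then have \<sigma>: "\<sigma> permutes {1..k}"
      by simp
    show "of_int (sign \<sigma>) * (\<Prod>j\<leftarrow>[1..<Suc k]. X (\<sigma> j) j) = (if \<sigma> = id then \<Prod>j\<leftarrow>[1..<Suc k]. X j j else 0)"
    proof (cases "\<sigma> = id")
      case False
      then show ?thesis
        by (simp only: zero[OF \<sigma> False] mult_zero_right if_False)
    qed (simp add: sign_id del: upt_Suc)
  qed
  also have "\<dots> = (\<Prod>j\<leftarrow>[1..<Suc k]. X j j)"
    by (simp add: permutes_id finite_permutations del: upt_Suc)
  finally show ?thesis .
qed

text \<open>On a diagonal matrix only the identity permutation survives, and the shifts have lower
  order in the grading variable; what is left is an ordinary elementary symmetric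
  polynomial.\<close>

lemma top_coeff_symb_capelli:
  "top_coeff k (symb (Poly_Mapping.single 0) (diagonal mp_var) (capelli_rep n k)) (shift_elem 0 n k)"
proof -
  let ?s = "symb (Poly_Mapping.single 0) (diagonal mp_var)"
  let ?f = "\<lambda>is j. monom (mp_var (is ! (j - 1))) 1 + of_nat (k - j) :: mpoly poly"
  have symb_is: "?s (cdet k (\<lambda>a b. e_tensor (is ! (a - 1)) (is ! (b - 1)) + (if a = b then of_nat (k - a) else 0)))
      = (\<Prod>j\<leftarrow>[1..<Suc k]. ?f is j)" if "is \<in> incr_seqs n k" for "is"
  proof -
    have d: "distinct is" "length is = k"
      using that by (auto simp: incr_seqs_def strict_sorted_iff)
    have eq: "is ! (a - 1) = is ! (b - 1) \<longleftrightarrow> a = b" if "a \<in> {1..k}" "b \<in> {1..k}" for a b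
      using that d by (subst nth_eq_iff_index_eq) auto
    have X: "?s (e_tensor (is ! (a - 1)) (is ! (b - 1)) + (if a = b then of_nat (k - a) else 0))
        = (if a = b then ?f is b else 0)" if "a \<in> {1..k}" "b \<in> {1..k}" for a b
      using eq[OF that] by (simp add: symb_simps[OF ring_hom_1_const] diagonal_def)
    have "?s (cdet k (\<lambda>a b. e_tensor (is ! (a - 1)) (is ! (b - 1)) + (if a = b then of_nat (k - a) else 0)))
        = cdet k (\<lambda>a b. if a = b then ?f is b else 0)"
      unfolding symb_simps(13)[OF ring_hom_1_const] by (rule cdet_cong[OF X])
    also have "\<dots> = (\<Prod>j\<leftarrow>[1..<Suc k]. ?f is j)"
      by (subst cdet_diagonal) (auto simp del: upt_Suc)
    finally show ?thesis .
  qed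
  have top: "top_coeff k (\<Prod>j\<leftarrow>[1..<Suc k]. ?f is j) (\<Prod>j=1..k. mp_var (is ! (j - 1)))" for "is"
  proof -
    have "top_coeff 1 (?f is j) (mp_var (is ! (j - 1)))" for j
    proof -
      have "of_nat (k - j) = [:of_nat (k - j) :: mpoly:]"
        by (rule of_nat_poly)
      then have "?f is j = [:of_nat (k - j), mp_var (is ! (j - 1)):]"
        by (simp only:) (simp add: monom_altdef)
      then show ?thesis
        by (simp only:) (simp add: top_coeff_def)
    qed
    then have "top_coeff (\<Sum>j\<leftarrow>[1..<Suc k]. 1) (\<Prod>j\<leftarrow>[1..<Suc k]. ?f is j) (\<Prod>j\<leftarrow>[1..<Suc k]. mp_var (is ! (j - 1)))"
      by (intro top_coeff_prod_list)
    moreover have "(\<Prod>j\<leftarrow>[1..<Suc k]. mp_var (is ! (j - 1))) = (\<Prod>j=1..k. mp_var (is ! (j - 1)))"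
      by (simp add: prod.distinct_set_conv_list[symmetric] atLeastLessThanSuc_atLeastAtMost del: upt_Suc)
    ultimately show ?thesis
      by (simp add: sum_list_triv del: upt_Suc)
  qed
  have "?s (capelli_rep n k) = (\<Sum>is\<in>incr_seqs n k. \<Prod>j\<leftarrow>[1..<Suc k]. ?f is j)"
    unfolding capelli_rep_def symb_simps(10)[OF ring_hom_1_const] by (rule sum.cong[OF refl symb_is])
  moreover have "degree (\<Sum>is\<in>incr_seqs n k. \<Prod>j\<leftarrow>[1..<Suc k]. ?f is j) \<le> k"
    by (rule degree_sum_le) (use top in \<open>auto simp: top_coeff_def simp del: upt_Suc\<close>)
  moreover have "coeff (\<Sum>is\<in>incr_seqs n k. \<Prod>j\<leftarrow>[1..<Suc k]. ?f is j) k = shift_elem 0 n k"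
    unfolding coeff_sum shift_elem_eq_sum using top by (intro sum.cong refl) (simp add: top_coeff_def del: upt_Suc)
  ultimately show ?thesis
    by (simp only: top_coeff_def)
qed

lemma homog_shift_elem_0: "homog (shift_elem 0 n k) = monom (shift_elem 0 n k) k"
proof -
  have "homog (\<Prod>a=1..k. mp_var (is ! (a - 1))) = monom (\<Prod>a=1..k. mp_var (is ! (a - 1))) k" for "is"
  proof (induction k)
    case (Suc k)
    then show ?case
      by (simp add: homog_simps homog_var mult_monom)
  qed (simp add: homog_simps monom_0 one_pCons)
  then show ?thesis
    unfolding shift_elem_eq_sum by (simp add: homog_simps monom_sum)
qed

lemma mon_eval_monom:
  "mon_eval (\<lambda>i. monom (e i) i) a = monom (mon_eval e a :: 'b::comm_ring_1) (mon_weight (\<lambda>i. i) a)"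
proof (induction a rule: monomial_induct[OF subset_UNIV])
  case (3 a b)
  then show ?case by (simp add: mon_eval_add mon_weight_add mult_monom)
qed (simp_all add: monom_0 one_pCons)

text \<open>Both sides select the monomials of weight exactly \<open>m\<close>: the symbol of a
  Capelli monomial of weight \<open>d\<close> has degree at most \<open>d\<close>, and
  \<open>shift_elem 0 n k\<close> is homogeneous of degree \<open>k\<close>.\<close>

lemma coeff_symb_capelli_poly:
  assumes P: "vars_in {1..n} P" "weight_le (\<lambda>i. i) m P"
  shows "coeff (symb (Poly_Mapping.single 0) (diagonal mp_var) (capelli_poly n P)) m
    = coeff (homog (mp_subst (shift_elem 0 n) P)) m"
proof -
  let ?s = "symb (Poly_Mapping.single 0) (diagonal mp_var)" and ?e = "shift_elem 0 n"
  let ?c = "\<lambda>a. Poly_Mapping.single 0 (Poly_Mapping.lookup P a) :: mpoly"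
  let ?g = "\<lambda>a. if mon_weight (\<lambda>i. i) a = m then ?c a * mon_eval ?e a else 0"
  have "?s (capelli_poly n P) = (\<Sum>a\<in>Poly_Mapping.keys P. [:?c a:] * ?s (capelli_mon n a))"
    by (simp add: capelli_poly_eq symb_simps[OF ring_hom_1_const])
  then have "coeff (?s (capelli_poly n P)) m = (\<Sum>a\<in>Poly_Mapping.keys P. ?c a * coeff (?s (capelli_mon n a)) m)"
    by (simp add: coeff_sum)
  also have "\<dots> = (\<Sum>a\<in>Poly_Mapping.keys P. ?g a)"
  proof (rule sum.cong[OF refl])
    fix a assume a: "a \<in> Poly_Mapping.keys P"
    have "top_coeff (\<Sum>i\<leftarrow>[1..<Suc n]. i * Poly_Mapping.lookup a i) (?s (capelli_mon n a))
        (\<Prod>i\<leftarrow>[1..<Suc n]. ?e i ^ Poly_Mapping.lookup a i)"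
      unfolding capelli_mon_def symb_simps(11,12)[OF ring_hom_1_const] map_map o_def
      by (intro top_coeff_prod_list top_coeff_power top_coeff_symb_capelli)
    then have "top_coeff (mon_weight (\<lambda>i. i) a) (?s (capelli_mon n a)) (mon_eval ?e a)"
      using a P(1) mon_weight_list[of a n "\<lambda>i. i"] mon_eval_list[of a n ?e] by (simp add: vars_in_def del: upt_Suc)
    moreover have "mon_weight (\<lambda>i. i) a \<le> m"
      using a P(2) by (simp add: weight_le_def)
    ultimately show "?c a * coeff (?s (capelli_mon n a)) m = ?g a"
      by (auto simp: top_coeff_def coeff_eq_0)
  qed
  also have "\<dots> = coeff (homog (mp_subst ?e P)) m"
  proof -
    have "homog (mp_subst ?e P) = mp_eval (\<lambda>c. [:Poly_Mapping.single 0 c:]) (\<lambda>i. monom (?e i) i) P"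
      using hom_mp_subst[OF ring_hom_1_homog, of ?e P] by (simp only: homog_const homog_shift_elem_0)
    then show ?thesis
      unfolding mp_eval_eq_meval meval_def mon_eval_monom by (simp add: coeff_sum) (intro sum.cong refl, simp)
  qed
  finally show ?thesis .
qed

text \<open>For \<open>c = 0\<close> the substitutions \<open>shift_swap\<close> are plain
  exchanges, which are supplied by \<open>sym_val_diag_swap\<close>; homogeneity holds because all
  contributing words have \<open>m\<close> letters.\<close>

lemma diagonal_symbol:
  assumes p: "central n p" "len_lt (Suc m) p"
  defines "G \<equiv> coeff (symb (Poly_Mapping.single 0) (diagonal mp_var) p) m"
  shows "shift_sym 0 n G" "weight_le (\<lambda>_. 1) m G" "coeff (homog G) m = G"
proof -
  let ?W = "{w \<in> Poly_Mapping.keys p. length w = m}"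
  have G: "G = (\<Sum>w\<in>?W. Poly_Mapping.single 0 (Poly_Mapping.lookup p w) * word_eval (diagonal mp_var) w)"
    by (simp add: G_def coeff_symb)
  have W: "set w \<subseteq> {1..n} \<times> {1..n}" if "w \<in> ?W" for w
    using that p(1) by (auto simp: central_def tens_def)
  have val: "mp_value G x = sym_val m p (diagonal x)" for x
    unfolding G_def sym_val_def using hom_coeff_symb[OF ring_hom_1_mp_value[of x], of "Poly_Mapping.single 0" "diagonal mp_var" p m]
    by (simp add: diagonal_def[abs_def] if_distrib[of "\<lambda>q. mp_value q x"] mp_value_simps cong: if_cong)
  have w1: "vars_in {1..n} (word_eval (diagonal mp_var) w)" if "set w \<subseteq> {1..n} \<times> {1..n}" for w
    using that by (induction w) (auto simp: diagonal_def intro!: vars_in_mult)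
  then have "vars_in {1..n} G"
    unfolding G using W by (intro vars_in_sum vars_in_mult) auto
  moreover have "mp_subst (shift_swap 0 i) G = G" if "1 \<le> i" "i < n" for i
  proof (rule mp_value_eqD)
    fix x
    have "(\<lambda>j. mp_value (shift_swap 0 i j) x) = x(i := x (Suc i), Suc i := x i)"
      by (auto simp: fun_eq_iff shift_swap_def mp_value_simps)
    then show "mp_value (mp_subst (shift_swap 0 i) G) x = mp_value G x"
      by (simp only: mp_value_mp_subst val sym_val_diag_swap[OF p that])
  qed
  ultimately show "shift_sym 0 n G"
    by (rule shift_symI)
  have w2: "homog (word_eval (diagonal mp_var) w) = monom (word_eval (diagonal mp_var) w) (length w)" for w
  proof (induction w)
    case (Cons y w)
    obtain k l where "y = (k, l)"
      by force
    then show ?case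
      using Cons by (simp add: homog_simps diagonal_def homog_var mult_monom)
  qed (simp add: homog_simps monom_0 one_pCons)
  have "homog G = (\<Sum>w\<in>?W. monom (Poly_Mapping.single 0 (Poly_Mapping.lookup p w) * word_eval (diagonal mp_var) w) m)"
    unfolding G homog_simps w2 by (intro sum.cong refl) (auto simp: homog_const smult_monom)
  also have "\<dots> = monom G m"
    unfolding G by (simp add: monom_sum)
  finally have h: "homog G = monom G m" .
  then show "coeff (homog G) m = G"
    by simp
  show "weight_le (\<lambda>_. 1) m G"
    unfolding weight_le_iff_degree h by (rule degree_monom_le)
qed

text \<open>Writing the diagonal symbol as a polynomial \<open>P\<close> in elementary symmetric
  functions and subtracting \<open>capelli_poly n P\<close> leaves a central element whose symbol
  vanishes on diagonal matrices, hence at every matrix, hence generically; \<open>pbw_span\<close>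
  then lowers the order.\<close>

lemma central_leading:
  assumes p: "central n p" "len_lt (Suc m) p"
  shows "\<exists>P. vars_in {1..n} P \<and> weight_le (\<lambda>i. i) m P \<and> reducible n m (p - capelli_poly n P)"
proof -
  let ?s = "symb (Poly_Mapping.single 0) (diagonal mp_var)"
  obtain P where P: "vars_in {1..n} P" "weight_le (\<lambda>i. i) m P" "coeff (?s p) m = mp_subst (shift_elem 0 n) P"
    using shift_sym_generated[OF diagonal_symbol(1,2)[OF p]] by blast
  let ?q = "p - capelli_poly n P"
  have q: "central n ?q" "len_lt (Suc m) ?q"
    by (intro central_diff p central_capelli_poly len_lt_diff len_lt_capelli_poly P)+
  have "coeff (?s ?q) m = 0"
    using coeff_symb_capelli_poly[OF P(1,2)] diagonal_symbol(3)[OF p]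
    by (simp add: symb_simps(2)[OF ring_hom_1_const] P(3))
  have "sym_val m ?q (diagonal x) = 0" for x
  proof -
    have "sym_val m ?q (diagonal x) = mp_value (coeff (?s ?q) m) x"
      unfolding sym_val_def using hom_coeff_symb[OF ring_hom_1_mp_value[of x], of "Poly_Mapping.single 0" "diagonal mp_var" ?q m]
      by (simp add: diagonal_def[abs_def] if_distrib[of "\<lambda>q. mp_value q x"] mp_value_simps cong: if_cong)
    then show ?thesis
      unfolding \<open>coeff (?s ?q) m = 0\<close> by (simp add: mp_value_simps)
  qed
  then have 0: "sym_val m ?q X = 0" for X
    by (rule sym_val_determined_by_diag[OF q])
  have "coeff (symb (Poly_Mapping.single 0) mat_var ?q) m = 0"
  proof (rule mp_value_eqD)
    fix x
    have "mp_value (coeff (symb (Poly_Mapping.single 0) mat_var ?q) m) x = sym_val m ?q (\<lambda>i j. x (prod_encode (i, j)))"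
      unfolding sym_val_def using hom_coeff_symb[OF ring_hom_1_mp_value[of x], of "Poly_Mapping.single 0" mat_var ?q m]
      by (simp add: mat_var_def)
    then show "mp_value (coeff (symb (Poly_Mapping.single 0) mat_var ?q) m) x = mp_value 0 x"
      by (simp add: 0 mp_value_simps)
  qed
  then have "reducible n m ?q"
    by (rule pbw_span[OF central_tens[OF q(1)] q(2)])
  then show ?thesis
    using P by blast
qed

theorem central_capelli:
  assumes "central n p" "len_lt (Suc m) p"
  shows "\<exists>P. vars_in {1..n} P \<and> weight_le (\<lambda>i. i) m P \<and> p - capelli_poly n P \<in> ugl_ideal n"
  using assms
proof (induction m arbitrary: p)
  case (0 p)
  then obtain P r where P: "vars_in {1..n} P" "weight_le (\<lambda>i. i) 0 P" "len_lt 0 r" "p - capelli_poly n P - r \<in> ugl_ideal n"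
    using central_leading[OF 0] unfolding reducible_def by blast
  moreover have "r = 0"
    using P(3) poly_mapping_sum_single[of r] by (simp add: len_lt_def)
  ultimately show ?case
    by auto
next
  case (Suc m p)
  obtain P r where P: "vars_in {1..n} P" "weight_le (\<lambda>i. i) (Suc m) P"
    and r: "len_lt (Suc m) r" "p - capelli_poly n P - r \<in> ugl_ideal n"
    using central_leading[OF Suc.prems] unfolding reducible_def by blast
  \<comment> \<open>This is \<open>r\<close>, written as a difference of central elements.\<close>
  have "central n (p - capelli_poly n P - (p - capelli_poly n P - r))"
    by (intro central_diff Suc.prems central_capelli_poly central_ideal r)
  then have "central n r"
    by simp
  then obtain Q where Q: "vars_in {1..n} Q" "weight_le (\<lambda>i. i) m Q" "r - capelli_poly n Q \<in> ugl_ideal n"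
    using Suc.IH[OF _ r(1)] by blast
  have "p - capelli_poly n (P + Q) = (p - capelli_poly n P - r) + (r - capelli_poly n Q)"
    by (simp add: capelli_poly_add)
  also have "\<dots> \<in> ugl_ideal n"
    by (intro ugl_ideal_add r Q)
  finally show ?case
    using P Q weight_le_mono[OF Q(2), of "Suc m"] by (intro exI[of _ "P + Q"]) (auto intro: vars_in_add weight_le_add)
qed

lemma zeta_filt_eq:
  "zeta_filt n m = {ugl_class n (capelli_poly n P) | P. vars_in {1..n} P \<and> weight_le (\<lambda>i. i) m P}"
proof (intro equalityI subsetI)
  fix A assume "A \<in> zeta_filt n m"
  then obtain p where p: "A = ugl_class n p" "p \<in> tens n" "len_lt (Suc m) p" "A \<in> carrier (zeta n)"
    by (auto simp: zeta_filt_def ugl_filt_iff)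
  then have "central n p"
    by (simp add: central_iff)
  then obtain P where P: "vars_in {1..n} P" "weight_le (\<lambda>i. i) m P" "p - capelli_poly n P \<in> ugl_ideal n"
    using central_capelli p(3) by blast
  then have "A = ugl_class n (capelli_poly n P)"
    unfolding p(1) by (subst ugl_class_eq_iff[OF p(2) central_tens[OF central_capelli_poly]])
  then show "A \<in> {ugl_class n (capelli_poly n P) | P. vars_in {1..n} P \<and> weight_le (\<lambda>i. i) m P}"
    using P by blast
next
  fix A assume "A \<in> {ugl_class n (capelli_poly n P) | P. vars_in {1..n} P \<and> weight_le (\<lambda>i. i) m P}"
  then obtain P where P: "A = ugl_class n (capelli_poly n P)" "vars_in {1..n} P" "weight_le (\<lambda>i. i) m P"
    by auto
  then show "A \<in> zeta_filt n m"
    using central_capelli_poly[of n P] central_tens[OF central_capelli_poly[of n P]] len_lt_capelli_poly[OF P(2,3)]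
    by (auto simp: zeta_filt_def central_iff ugl_filt_iff)
qed

lemma weight_le_exists: "\<exists>m. weight_le w m P"
  by (intro exI[of _ "Max (mon_weight w ` Poly_Mapping.keys P)"]) (auto simp: weight_le_def)

lemma carrier_zeta: "carrier (zeta n) = {ugl_class n (capelli_poly n P) | P. vars_in {1..n} P}"
proof (intro equalityI subsetI)
  fix A assume A: "A \<in> carrier (zeta n)"
  then obtain p where p: "A = ugl_class n p" "p \<in> tens n"
    using zeta_subset by (auto simp: carrier_ugl)
  have "len_lt (Suc (Max (length ` Poly_Mapping.keys p))) p"
    by (auto simp: len_lt_def less_Suc_eq_le)
  with A p have "A \<in> zeta_filt n (Max (length ` Poly_Mapping.keys p))"
    by (auto simp: zeta_filt_def ugl_filt_iff)
  then show "A \<in> {ugl_class n (capelli_poly n P) | P. vars_in {1..n} P}"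
    unfolding zeta_filt_eq by auto
next
  fix A assume "A \<in> {ugl_class n (capelli_poly n P) | P. vars_in {1..n} P}"
  then show "A \<in> carrier (zeta n)"
    using central_capelli_poly central_tens[OF central_capelli_poly] by (auto simp: central_iff)
qed

section \<open>The action on highest weight modules\<close>

lemma lookup_vec_scale [simp]: "Poly_Mapping.lookup (vec_scale c v) k = c * Poly_Mapping.lookup v k"
  by (simp add: vec_scale_def map.rep_eq when_def)

lemma vec_scale_simps [simp]: "vec_scale 0 v = 0" "vec_scale 1 v = v" "vec_scale c 0 = 0"
  by (rule poly_mapping_eqI; simp)+

lemma vec_scale_vec_scale: "vec_scale c (vec_scale d v) = vec_scale (c * d) v"
  by (rule poly_mapping_eqI) simp

lemma vec_scale_add: "vec_scale (c + d) v = vec_scale c v + vec_scale d v"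
  by (rule poly_mapping_eqI) (simp add: lookup_add distrib_right)

lemma vec_scale_sum: "vec_scale (sum f I) v = (\<Sum>i\<in>I. vec_scale (f i) v)"
  by (induction I rule: infinite_finite_induct) (simp_all add: vec_scale_add)

lemma vec_scale_inject:
  assumes "v \<noteq> 0" "vec_scale c v = vec_scale d v"
  shows "c = d"
proof -
  obtain k where "Poly_Mapping.lookup v k \<noteq> 0"
    using assms(1) by (metis lookup_zero poly_mapping_eqI)
  moreover have "c * Poly_Mapping.lookup v k = d * Poly_Mapping.lookup v k"
    using arg_cong[OF assms(2), of "\<lambda>w. Poly_Mapping.lookup w k"] by simp
  ultimately show ?thesis
    by simp
qed

section \<open>Modules through representatives in the tensor algebra\<close>

locale ugl_rep =
  fixes n :: nat and V :: "Defs.vec set" and act :: "tensor set \<Rightarrow> Defs.vec \<Rightarrow> Defs.vec"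
  assumes ugl_module: "ugl_module n V act"
begin

definition op :: "tensor \<Rightarrow> Defs.vec \<Rightarrow> Defs.vec"
  where "op p = act (ugl_class n p)"

lemma op_vec_scale: "p \<in> tens n \<Longrightarrow> v \<in> V \<Longrightarrow> op p (vec_scale c v) = vec_scale c (op p v)"
  using ugl_module by (simp add: ugl_module_def op_def)

lemma op_add: "p \<in> tens n \<Longrightarrow> q \<in> tens n \<Longrightarrow> v \<in> V \<Longrightarrow> op (p + q) v = op p v + op q v"
  using ugl_module by (simp add: ugl_module_def op_def flip: ugl_add)

lemma op_mult: "p \<in> tens n \<Longrightarrow> q \<in> tens n \<Longrightarrow> v \<in> V \<Longrightarrow> op (p * q) v = op p (op q v)"
  using ugl_module by (simp add: ugl_module_def op_def flip: ugl_mult)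

lemma op_scale: "p \<in> tens n \<Longrightarrow> v \<in> V \<Longrightarrow> op (Poly_Mapping.single 0 c * p) v = vec_scale c (op p v)"
  using ugl_module by (simp add: ugl_module_def op_def flip: ugl_smult)

lemma op_one: "v \<in> V \<Longrightarrow> op 1 v = v"
  using ugl_module by (simp add: ugl_module_def op_def flip: ugl_one)

lemma op_const: "v \<in> V \<Longrightarrow> op (Poly_Mapping.single 0 c) v = vec_scale c v"
  using op_scale[OF tens_one, of v c] by (simp add: op_one)

lemma op_zero: "v \<in> V \<Longrightarrow> op 0 v = 0"
  using op_const[of v 0] by simp

lemma op_of_nat: "v \<in> V \<Longrightarrow> op (of_nat k) v = vec_scale (of_nat k) v"
  using op_const[of v "of_nat k"] by simp

lemma op_zero_right: "p \<in> tens n \<Longrightarrow> v \<in> V \<Longrightarrow> op p 0 = 0"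
  using op_vec_scale[of p v 0] by simp

lemma op_sum:
  assumes "\<And>i. i \<in> I \<Longrightarrow> f i \<in> tens n" "v \<in> V"
  shows "op (sum f I) v = (\<Sum>i\<in>I. op (f i) v)"
  using assms by (induction I rule: infinite_finite_induct) (simp_all add: op_zero op_add tens_sum)

lemma op_scalar_mult:
  assumes "p \<in> tens n" "q \<in> tens n" "v \<in> V" "op p v = vec_scale c v" "op q v = vec_scale d v"
  shows "op (p * q) v = vec_scale (c * d) v"
  using assms by (simp add: op_mult op_vec_scale vec_scale_vec_scale mult.commute)

lemma op_scalar_power:
  assumes "p \<in> tens n" "v \<in> V" "op p v = vec_scale c v"
  shows "op (p ^ k) v = vec_scale (c ^ k) v"
  by (induction k) (simp_all add: op_one assms op_scalar_mult tens_power)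

lemma op_scalar_prod_list:
  assumes "\<And>x. x \<in> set xs \<Longrightarrow> f x \<in> tens n" "v \<in> V"
    and "\<And>x. x \<in> set xs \<Longrightarrow> op (f x) v = vec_scale (c x) v"
  shows "op (\<Prod>x\<leftarrow>xs. f x) v = vec_scale (\<Prod>x\<leftarrow>xs. c x) v"
  using assms by (induction xs) (auto simp: op_one intro!: op_scalar_mult tens_prod_list)

end

lemma tens_capelli_cdet:
  "is \<in> incr_seqs n k \<Longrightarrow> cdet k (\<lambda>a b.
     e_tensor (is ! (a - 1)) (is ! (b - 1)) + (if a = b then of_nat (k - a) else 0)) \<in> tens n"
  by (intro tens_cdet tens_add tens_e_tensor incr_seqs_nth) auto

locale hw_vector = ugl_rep +
  fixes \<mu> :: "nat \<Rightarrow> complex" and v :: Defs.vec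
  assumes v: "v \<in> V"
    and raise: "\<And>i j. i \<in> {1..n} \<Longrightarrow> j \<in> {1..n} \<Longrightarrow> i < j \<Longrightarrow> op (e_tensor i j) v = 0"
    and weight: "\<And>i. i \<in> {1..n} \<Longrightarrow> op (e_tensor i i) v = vec_scale (\<mu> i) v"
begin

text \<open>In a summand of the column determinant other than the diagonal one, the last factor off the
  diagonal is a raising operator, and the factors to its right act by scalars.\<close>

lemma op_cdet:
  assumes "is \<in> incr_seqs n k"
  shows "op (cdet k (\<lambda>a b. e_tensor (is ! (a - 1)) (is ! (b - 1)) + (if a = b then of_nat (k - a) else 0))) v
    = vec_scale (\<Prod>j=1..k. \<mu> (is ! (j - 1)) + of_nat (k - j)) v"
proof -
  let ?X = "\<lambda>a b. e_tensor (is ! (a - 1)) (is ! (b - 1)) + (if a = b then of_nat (k - a) else 0)"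
  let ?c = "\<lambda>j. \<mu> (is ! (j - 1)) + of_nat (k - j)"
  have mem: "is ! (a - 1) \<in> {1..n}" if "a \<in> {1..k}" for a
    using incr_seqs_nth[OF assms that] .
  have X: "?X a b \<in> tens n" if "a \<in> {1..k}" "b \<in> {1..k}" for a b
  proof (rule tens_add)
    show "e_tensor (is ! (a - 1)) (is ! (b - 1)) \<in> tens n"
      by (rule tens_e_tensor[OF mem[OF that(1)] mem[OF that(2)]])
    show "(if a = b then of_nat (k - a) else 0) \<in> tens n"
      by (cases "a = b") (simp_all del: of_nat_diff)
  qed
  have diag: "op (?X a a) v = vec_scale (?c a) v" if "a \<in> {1..k}" for a
  proof -
    have "?X a a = e_tensor (is ! (a - 1)) (is ! (a - 1)) + of_nat (k - a)"
      by (simp only: if_True simp_thms)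
    then have "op (?X a a) v = op (e_tensor (is ! (a - 1)) (is ! (a - 1))) v + op (of_nat (k - a)) v"
      by (simp only: op_add[OF tens_e_tensor[OF mem[OF that] mem[OF that]] tens_of_nat v])
    then show ?thesis
      by (simp only: op_of_nat[OF v] weight[OF mem[OF that]] vec_scale_add)
  qed
  have zero: "op (\<Prod>j\<leftarrow>[1..<Suc k]. ?X (\<sigma> j) j) v = 0" if \<sigma>: "\<sigma> permutes {1..k}" "\<sigma> \<noteq> id" for \<sigma>
  proof -
    let ?M = "{j::nat. \<sigma> j \<noteq> j}"
    have M: "?M \<subseteq> {1..k}" "?M \<noteq> {}"
      using \<sigma> by (auto simp: permutes_def fun_eq_iff)
    then have fin: "finite ?M"
      by (meson finite_atLeastAtMost finite_subset)
    define j where "j = Max ?M"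
    have j: "\<sigma> j \<noteq> j" "j \<in> {1..k}" "\<And>b. j < b \<Longrightarrow> \<sigma> b = b"
      using Max_in[OF fin M(2)] Max_ge[OF fin] M(1) by (auto simp: j_def[symmetric] not_le[symmetric])
    have \<sigma>j: "\<sigma> j \<in> {1..k}" "\<sigma> j < j"
      using permutes_in_image[OF \<sigma>(1), of j] j permutes_inj[OF \<sigma>(1)]
      by (auto simp: inj_eq) (metis inj_eq linorder_neqE_nat)
    have split: "[1..<Suc k] = [1..<j] @ j # [Suc j..<Suc k]"
      using j(2) upt_add_eq_append[of 1 j "Suc k - j"] by (simp add: upt_conv_Cons)
    let ?P = "\<Prod>b\<leftarrow>[1..<j]. ?X (\<sigma> b) b" and ?Q = "\<Prod>b\<leftarrow>[Suc j..<Suc k]. ?X (\<sigma> b) b"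
    have P: "?P \<in> tens n"
    proof (rule tens_prod_list)
      fix x assume "x \<in> set (map (\<lambda>b. ?X (\<sigma> b) b) [1..<j])"
      then obtain b where b: "x = ?X (\<sigma> b) b" "b \<in> {1..k}"
        using j(2) by auto
      then show "x \<in> tens n"
        using X[of "\<sigma> b" b] permutes_in_image[OF \<sigma>(1), of b] by simp
    qed
    have Q: "?Q = (\<Prod>b\<leftarrow>[Suc j..<Suc k]. ?X b b)"
      by (rule arg_cong[where f = prod_list], rule map_cong) (use j(3) in auto)
    have Qb: "b \<in> {1..k}" if "b \<in> set [Suc j..<Suc k]" for b
      using that j(2) by auto
    have Qt: "?X b b \<in> tens n" "op (?X b b) v = vec_scale (?c b) v" if "b \<in> set [Suc j..<Suc k]" for b
      by (rule X[OF Qb[OF that] Qb[OF that]], rule diag[OF Qb[OF that]])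
    have Qt': "?Q \<in> tens n"
      unfolding Q
    proof (rule tens_prod_list)
      fix x assume "x \<in> set (map (\<lambda>b. ?X b b) [Suc j..<Suc k])"
      then show "x \<in> tens n"
        unfolding set_map by (rule imageE) (simp only: Qt(1))
    qed
    have Qv: "op ?Q v = vec_scale (\<Prod>b\<leftarrow>[Suc j..<Suc k]. ?c b) v"
      unfolding Q by (rule op_scalar_prod_list[OF Qt(1) v Qt(2)])
    have "sorted_wrt (<) is" "length is = k"
      using assms by (auto simp: incr_seqs_def)
    then have "is ! (\<sigma> j - 1) < is ! (j - 1)"
      using \<sigma>j j(2) by (intro sorted_wrt_nth_less[of "(<)" "is" "\<sigma> j - 1" "j - 1"]) auto
    then have "op (e_tensor (is ! (\<sigma> j - 1)) (is ! (j - 1))) v = 0"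
      by (rule raise[OF mem[OF \<sigma>j(1)] mem[OF j(2)]])
    then have e: "op (?X (\<sigma> j) j) v = 0"
      by (simp only: j(1) if_False add_0_right)
    have "op (?P * (?X (\<sigma> j) j * ?Q)) v = op ?P (op (?X (\<sigma> j) j) (op ?Q v))"
      using P Qt' X[OF \<sigma>j(1) j(2)] v by (simp only: op_mult tens_mult)
    also have "\<dots> = 0"
      unfolding Qv using P X[OF \<sigma>j(1) j(2)] v e by (simp only: op_vec_scale vec_scale_simps op_zero_right)
    finally show ?thesis
      unfolding split map_append list.map prod_list.append prod_list.Cons .
  qed
  have tens: "(\<Prod>j\<leftarrow>[1..<Suc k]. ?X (\<sigma> j) j) \<in> tens n" if "\<sigma> permutes {1..k}" for \<sigma>
  proof (rule tens_prod_list)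
    fix x assume "x \<in> set (map (\<lambda>b. ?X (\<sigma> b) b) [1..<Suc k])"
    then obtain b where b: "x = ?X (\<sigma> b) b" "b \<in> {1..k}"
      by (auto simp: less_Suc_eq_le simp del: upt_Suc)
    then show "x \<in> tens n"
      using X[of "\<sigma> b" b] permutes_in_image[OF that, of b] by simp
  qed
  have "op (cdet k ?X) v = (\<Sum>\<sigma> | \<sigma> permutes {1..k}. op (of_int (sign \<sigma>) * (\<Prod>j\<leftarrow>[1..<Suc k]. ?X (\<sigma> j) j)) v)"
    unfolding cdet_def
  proof (rule op_sum[OF _ v])
    fix \<sigma> assume "\<sigma> \<in> {\<sigma>. \<sigma> permutes {1..k}}"
    then have "\<sigma> permutes {1..k}"
      by simp
    then show "of_int (sign \<sigma>) * (\<Prod>j\<leftarrow>[1..<Suc k]. ?X (\<sigma> j) j) \<in> tens n"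
      by (rule tens_mult[OF tens_of_int tens])
  qed
  also have "\<dots> = (\<Sum>\<sigma> | \<sigma> permutes {1..k}. if \<sigma> = id then op (\<Prod>j\<leftarrow>[1..<Suc k]. ?X j j) v else 0)"
  proof (rule sum.cong[OF refl])
    fix \<sigma> assume "\<sigma> \<in> {\<sigma>. \<sigma> permutes {1..k}}"
    then have \<sigma>: "\<sigma> permutes {1..k}"
      by simp
    show "op (of_int (sign \<sigma>) * (\<Prod>j\<leftarrow>[1..<Suc k]. ?X (\<sigma> j) j)) v
        = (if \<sigma> = id then op (\<Prod>j\<leftarrow>[1..<Suc k]. ?X j j) v else 0)"
    proof (cases "\<sigma> = id")
      case False
      have "op (Poly_Mapping.single 0 (of_int (sign \<sigma>)) * (\<Prod>j\<leftarrow>[1..<Suc k]. ?X (\<sigma> j) j)) v = 0"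
        by (simp only: op_scale[OF tens[OF \<sigma>] v] zero[OF \<sigma> False] vec_scale_simps)
      with False show ?thesis
        by (simp only: single_of_int if_False)
    qed (simp add: sign_id del: upt_Suc)
  qed
  also have "\<dots> = op (\<Prod>j\<leftarrow>[1..<Suc k]. ?X j j) v"
    by (simp add: permutes_id finite_permutations del: upt_Suc)
  also have "\<dots> = vec_scale (\<Prod>j\<leftarrow>[1..<Suc k]. ?c j) v"
    by (rule op_scalar_prod_list[OF X v diag]) auto
  also have "(\<Prod>j\<leftarrow>[1..<Suc k]. ?c j) = (\<Prod>j=1..k. ?c j)"
    by (simp add: prod.distinct_set_conv_list[symmetric] atLeastLessThanSuc_atLeastAtMost del: upt_Suc)
  finally show ?thesis .
qed

lemma op_capelli_rep: "op (capelli_rep n k) v = vec_scale (mp_value (e_star n k) \<mu>) v"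
proof -
  have "op (capelli_rep n k) v = (\<Sum>is\<in>incr_seqs n k. op (cdet k (\<lambda>a b.
      e_tensor (is ! (a - 1)) (is ! (b - 1)) + (if a = b then of_nat (k - a) else 0))) v)"
    unfolding capelli_rep_def by (rule op_sum[OF tens_capelli_cdet v])
  also have "\<dots> = (\<Sum>is\<in>incr_seqs n k. vec_scale (\<Prod>j=1..k. \<mu> (is ! (j - 1)) + of_nat (k - j)) v)"
    by (rule sum.cong[OF refl op_cdet])
  finally have "op (capelli_rep n k) v
      = (\<Sum>is\<in>incr_seqs n k. vec_scale (\<Prod>j=1..k. \<mu> (is ! (j - 1)) + of_nat (k - j)) v)" .
  then show ?thesis
    by (simp add: e_star_def mp_value_simps vec_scale_sum del: of_nat_diff)
qed

lemma op_capelli_poly: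
  assumes "vars_in {1..n} P"
  shows "op (capelli_poly n P) v = vec_scale (mp_value (mp_subst (e_star n) P) \<mu>) v"
proof -
  let ?e = "\<lambda>i. mp_value (e_star n i) \<mu>"
  have mon: "op (capelli_mon n a) v = vec_scale (mon_eval ?e a) v" if "Poly_Mapping.keys a \<subseteq> {1..n}" for a
    unfolding capelli_mon_def mon_eval_list[OF that]
    by (intro op_scalar_prod_list v tens_power tens_capelli_rep op_scalar_power op_capelli_rep)
  have t: "capelli_mon n a \<in> tens n" for a
    by (rule central_tens[OF central_capelli_mon])
  have "op (capelli_poly n P) v
      = (\<Sum>a\<in>Poly_Mapping.keys P. op (Poly_Mapping.single 0 (Poly_Mapping.lookup P a) * capelli_mon n a) v)"
    unfolding capelli_poly_eq by (rule op_sum[OF tens_mult[OF tens_single_0 t] v])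
  also have "\<dots> = (\<Sum>a\<in>Poly_Mapping.keys P. vec_scale (Poly_Mapping.lookup P a * mon_eval ?e a) v)"
    using assms by (intro sum.cong refl) (simp add: op_scale[OF t v] mon vars_in_def vec_scale_vec_scale)
  also have "\<dots> = vec_scale (mp_value (mp_subst (e_star n) P) \<mu>) v"
    using hom_mp_subst[OF ring_hom_1_mp_value[of \<mu>], of "e_star n" P]
    by (simp add: vec_scale_sum mp_eval_eq_meval meval_def)
  finally show ?thesis .
qed

end

text \<open>A central element acts on the vector obtained by \<open>u\<close> from the highest
  weight vector as it acts on the highest weight vector itself, and that vector generates the
  module.\<close>

theorem hw_capelli_poly:
  assumes "highest_weight_module n \<mu> V act" "vars_in {1..n} P" "w \<in> V"
  shows "act (ugl_class n (capelli_poly n P)) w = vec_scale (mp_value (mp_subst (e_star n) P) \<mu>) w"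
proof -
  have "ugl_module n V act"
    using assms(1) by (simp add: highest_weight_module_def)
  then interpret ugl_rep n V act
    by unfold_locales
  obtain v where hv: "v \<in> V" "\<forall>i\<in>{1..n}. \<forall>j\<in>{1..n}. i < j \<longrightarrow> act (ugl_class n (e_tensor i j)) v = 0"
    "\<forall>i\<in>{1..n}. act (ugl_class n (e_tensor i i)) v = vec_scale (\<mu> i) v" "V = (\<lambda>u. act u v) ` carrier (ugl n)"
    using assms(1) unfolding highest_weight_module_def by blast
  interpret hw_vector n V act \<mu> v
    using hv(1-3) by unfold_locales (auto simp: op_def)
  obtain u where u: "u \<in> tens n" "w = op u v"
    using assms(3) hv(4) by (auto simp: carrier_ugl op_def)
  let ?p = "capelli_poly n P"
  have p: "?p \<in> tens n"
    by (rule central_tens[OF central_capelli_poly])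
  have class_eq: "ugl_class n (?p * u) = ugl_class n (u * ?p)"
    by (rule iffD2[OF ugl_class_eq_iff[OF tens_mult[OF p u(1)] tens_mult[OF u(1) p]]
      central_commute[OF central_capelli_poly u(1)]])
  have "op ?p w = op (?p * u) v"
    unfolding u(2) by (rule op_mult[OF p u(1) hv(1), symmetric])
  also have "op (?p * u) v = op (u * ?p) v"
    unfolding op_def class_eq ..
  also have "\<dots> = op u (op ?p v)"
    by (rule op_mult[OF u(1) p hv(1)])
  also have "\<dots> = vec_scale (mp_value (mp_subst (e_star n) P) \<mu>) w"
    by (simp add: op_capelli_poly[OF assms(2)] op_vec_scale u hv(1))
  finally show ?thesis
    by (simp add: op_def)
qed

section \<open>Highest weight modules with dominant integral highest weights\<close>

definition lead_minor :: "nat \<Rightarrow> mpoly"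
  where "lead_minor k = det (mat k k (\<lambda>(r, c). mat_var (Suc r) (Suc c)))"

lemma comm_ring_hom_of_ring_hom_1: "ring_hom_1 \<phi> \<Longrightarrow> comm_ring_hom \<phi>"
  by unfold_locales (simp_all add: ring_hom_1.hom_simps)

text \<open>Over dual numbers the derivation becomes a row operation: row \<open>j\<close> gains an
  infinitesimal multiple of row \<open>i\<close>. For \<open>i < j \<le> k\<close> the determinant
  is unchanged, for \<open>i = j \<le> k\<close> it is scaled by \<open>[:1, 1:]\<close>, and for
  \<open>j > k\<close> row \<open>j\<close> is not in the minor.\<close>

lemma polar_lead_minor:
  assumes "1 \<le> i" "i \<le> j"
  shows "polar i j (lead_minor k) = of_nat (if i = j \<and> i \<le> k then 1 else 0) * lead_minor k"
proof -
  let ?d = "\<lambda>v. if fst (prod_decode v) = j then mat_var i (snd (prod_decode v)) else 0"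
  let ?M = "mat k k (\<lambda>(r, c). mat_var (Suc r) (Suc c))"
  interpret \<phi>: comm_ring_hom "dual_eval ?d"
    by (rule comm_ring_hom_of_ring_hom_1[OF ring_hom_1_dual_eval])
  interpret C: comm_ring_hom "\<lambda>c::mpoly. [:c:]"
    by (rule comm_ring_hom_of_ring_hom_1[OF ring_hom_1_pCons])
  let ?C = "map_mat (\<lambda>c. [:c:]) ?M"
  have C: "?C \<in> carrier_mat k k" "det ?C = [:lead_minor k:]"
    by (simp_all add: lead_minor_def C.hom_det)
  have entry: "dual_eval ?d (mat_var a b) = [:mat_var a b, if a = j then mat_var i b else 0:]" for a b
    unfolding mat_var_def dual_eval_var by simp
  have "dual_eval ?d (lead_minor k) = det (map_mat (dual_eval ?d) ?M)"
    by (simp add: lead_minor_def \<phi>.hom_det)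
  also have "\<dots> = (if i = j \<and> i \<le> k then [:1, 1:] * [:lead_minor k:] else [:lead_minor k:])"
  proof (cases "j \<le> k")
    case False
    have "map_mat (dual_eval ?d) ?M = ?C"
      using False by (intro eq_matI) (auto simp: entry)
    with False C(2) assms show ?thesis
      by auto
  next
    case True
    show ?thesis
    proof (cases "i = j")
      case True
      have "map_mat (dual_eval ?d) ?M = multrow (j - 1) [:1, 1:] ?C"
        using assms True by (intro eq_matI) (auto simp: entry mat_multrow_def)
      then show ?thesis
        using True \<open>j \<le> k\<close> assms det_multrow[OF _ C(1), of "j - 1" "[:1, 1:]"] C(2) by auto
    next
      case False
      have "map_mat (dual_eval ?d) ?M = addrow [:0, 1:] (j - 1) (i - 1) ?C"
        using assms True by (intro eq_matI) (auto simp: entry mat_addrow_def)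
      then show ?thesis
        using False \<open>j \<le> k\<close> assms det_addrow[OF _ _ C(1), of "i - 1" "j - 1" "[:0, 1:]"] C(2) by auto
    qed
  qed
  finally have "coeff (dual_eval ?d (lead_minor k)) 1
      = coeff (if i = j \<and> i \<le> k then [:1, 1:] * [:lead_minor k:] else [:lead_minor k:]) 1"
    by (rule arg_cong)
  then show ?thesis
    by (auto simp: polar_def derivation_def split: if_splits)
qed

lemma polar_scalar_mult:
  "polar i j p = of_nat c * p \<Longrightarrow> polar i j q = of_nat d * q \<Longrightarrow> polar i j (p * q) = of_nat (c + d) * (p * q)"
  by (simp add: polar_mult algebra_simps)

lemma polar_one: "polar i j 1 = of_nat 0 * 1"
  using polar_const[of i j 1] by simp

lemma polar_scalar_power: "polar i j p = of_nat c * p \<Longrightarrow> polar i j (p ^ k) = of_nat (c * k) * p ^ k"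
proof (induction k)
  case (Suc k)
  then show ?case
    using polar_scalar_mult[of i j p c "p ^ k" "c * k"] by simp
qed (simp add: polar_one)

lemma polar_scalar_prod:
  "(\<And>x. x \<in> A \<Longrightarrow> polar i j (f x) = of_nat (c x) * f x) \<Longrightarrow> polar i j (prod f A) = of_nat (\<Sum>x\<in>A. c x) * prod f A"
proof (induction A rule: infinite_finite_induct)
  case (insert x A)
  then show ?case
    using polar_scalar_mult[of i j "f x" "c x" "prod f A" "\<Sum>x\<in>A. c x"] by simp
qed (simp_all add: polar_one)

definition hw_poly :: "nat \<Rightarrow> (nat \<Rightarrow> nat) \<Rightarrow> mpoly"
  where "hw_poly n a = (\<Prod>k=1..n. lead_minor k ^ a k)"

text \<open>On \<open>{1..n}\<close> these are the partitions with at most \<open>n\<close> parts;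
  for \<open>k < n\<close> the number \<open>a k\<close> is the difference of parts \<open>k\<close>
  and \<open>Suc k\<close>, and \<open>a n\<close> is the last part.\<close>

definition dominant :: "nat \<Rightarrow> (nat \<Rightarrow> nat) \<Rightarrow> nat \<Rightarrow> complex"
  where "dominant n a i = of_nat (\<Sum>k=i..n. a k)"

lemma polar_hw_poly:
  assumes "1 \<le> i" "i \<le> j"
  shows "polar i j (hw_poly n a) = Poly_Mapping.single 0 (if i = j then dominant n a i else 0) * hw_poly n a"
proof -
  have "polar i j (hw_poly n a) = of_nat (\<Sum>k=1..n. (if i = j \<and> i \<le> k then 1 else 0) * a k) * hw_poly n a"
    unfolding hw_poly_def by (intro polar_scalar_prod polar_scalar_power polar_lead_minor assms)
  also have "(\<Sum>k=1..n. (if i = j \<and> i \<le> k then 1 else 0) * a k) = (if i = j then \<Sum>k=i..n. a k else 0)"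
  proof (cases "i = j")
    case True
    have "(\<Sum>k=1..n. (if i = j \<and> i \<le> k then 1 else 0) * a k) = (\<Sum>k=1..n. if i \<le> k then a k else 0)"
      using True by (intro sum.cong) auto
    also have "\<dots> = (\<Sum>k=i..n. a k)"
      using assms(1) by (intro sum.mono_neutral_cong_right) auto
    finally show ?thesis
      using True by simp
  qed simp
  finally have "polar i j (hw_poly n a) = of_nat (if i = j then \<Sum>k=i..n. a k else 0) * hw_poly n a" .
  moreover have "of_nat (if i = j then \<Sum>k=i..n. a k else 0) = (Poly_Mapping.single 0 (if i = j then dominant n a i else 0) :: mpoly)"
    unfolding single_of_nat[symmetric] dominant_def by (intro arg_cong[where f = "Poly_Mapping.single 0"]) auto
  ultimately show ?thesis
    by (simp only:)
qed

text \<open>Every leading minor takes the value \<open>1\<close> at the identity matrix.\<close>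

lemma hw_poly_neq_0: "hw_poly n a \<noteq> 0"
proof -
  define x :: "nat \<Rightarrow> complex" where "x v = (if fst (prod_decode v) = snd (prod_decode v) then 1 else 0)" for v
  interpret comm_ring_hom "\<lambda>p. mp_value p x"
    by (rule comm_ring_hom_of_ring_hom_1[OF ring_hom_1_mp_value])
  have "mp_value (lead_minor k) x = 1" for k
  proof -
    have "mp_value (lead_minor k) x = det (map_mat (\<lambda>p. mp_value p x) (mat k k (\<lambda>(r, c). mat_var (Suc r) (Suc c))))"
      by (simp add: lead_minor_def hom_det)
    also have "map_mat (\<lambda>p. mp_value p x) (mat k k (\<lambda>(r, c). mat_var (Suc r) (Suc c))) = 1\<^sub>m k"
      by (intro eq_matI) (auto simp: mat_var_def x_def)
    finally show ?thesis
      by simp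
  qed
  then have "mp_value (hw_poly n a) x = 1"
    by (simp add: hw_poly_def mp_value_simps)
  then show ?thesis
    by (auto simp: mp_value_simps)
qed

text \<open>The polynomial ring embeds linearly into the type carrying the modules.\<close>

definition encode_monomial :: "(nat \<Rightarrow>\<^sub>0 nat) \<Rightarrow> nat"
  where "encode_monomial a = list_encode (map (Poly_Mapping.lookup a) [0..<Poly_Mapping.degree a])"

lemma inj_encode_monomial: "inj encode_monomial"
proof (rule injI)
  fix a b assume "encode_monomial a = encode_monomial b"
  then have eq: "map (Poly_Mapping.lookup a) [0..<Poly_Mapping.degree a] = map (Poly_Mapping.lookup b) [0..<Poly_Mapping.degree b]"
    unfolding encode_monomial_def by (metis list_encode_inverse)
  then have deg: "Poly_Mapping.degree a = Poly_Mapping.degree b"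
    using map_eq_imp_length_eq[OF eq] by simp
  show "a = b"
  proof (rule poly_mapping_eqI)
    fix k
    show "Poly_Mapping.lookup a k = Poly_Mapping.lookup b k"
    proof (cases "k < Poly_Mapping.degree a")
      case True
      then show ?thesis
        using arg_cong[OF eq, of "\<lambda>xs. xs ! k"] deg by simp
    next
      case False
      then show ?thesis
        using deg by (simp add: beyond_degree_lookup_zero)
    qed
  qed
qed

definition embed :: "mpoly \<Rightarrow> Defs.vec"
  where "embed f = (\<Sum>a\<in>Poly_Mapping.keys f. Poly_Mapping.single (encode_monomial a) (Poly_Mapping.lookup f a))"

lemma lookup_embed: "Poly_Mapping.lookup (embed f) (encode_monomial b) = Poly_Mapping.lookup f b"
proof -
  have "Poly_Mapping.lookup (embed f) (encode_monomial b)
      = (\<Sum>a\<in>Poly_Mapping.keys f. if a = b then Poly_Mapping.lookup f a else 0)"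
    unfolding embed_def lookup_sum lookup_single when_def
    by (intro sum.cong refl if_cong) (auto simp: inj_eq[OF inj_encode_monomial])
  then show ?thesis
    using not_in_keys_iff_lookup_eq_zero[of b f] by simp
qed

lemma lookup_embed_other: "k \<notin> range encode_monomial \<Longrightarrow> Poly_Mapping.lookup (embed f) k = 0"
  unfolding embed_def lookup_sum lookup_single when_def by (intro sum.neutral) auto

lemma embed_eqI:
  assumes "\<And>b. Poly_Mapping.lookup w (encode_monomial b) = Poly_Mapping.lookup f b"
    and "\<And>k. k \<notin> range encode_monomial \<Longrightarrow> Poly_Mapping.lookup w k = 0"
  shows "embed f = w"
proof (rule poly_mapping_eqI)
  fix k show "Poly_Mapping.lookup (embed f) k = Poly_Mapping.lookup w k"
    using assms by (cases "k \<in> range encode_monomial") (auto simp: lookup_embed lookup_embed_other)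
qed

lemma embed_add: "embed (f + g) = embed f + embed g"
  by (rule embed_eqI) (simp_all add: lookup_add lookup_embed lookup_embed_other)

lemma embed_scale: "embed (Poly_Mapping.single 0 c * f) = vec_scale c (embed f)"
proof (rule embed_eqI)
  have "Poly_Mapping.lookup (Poly_Mapping.single 0 c * f) b = c * Poly_Mapping.lookup f b" for b
    unfolding mult_map_scale_conv_mult[symmetric] by (simp add: map.rep_eq when_def)
  then show "Poly_Mapping.lookup (vec_scale c (embed f)) (encode_monomial b)
      = Poly_Mapping.lookup (Poly_Mapping.single 0 c * f) b" for b
    by (simp add: lookup_embed)
qed (simp add: lookup_embed_other)

lemma embed_zero: "embed 0 = 0"
  by (simp add: embed_def)

lemma inj_embed: "inj embed"
  by (intro injI poly_mapping_eqI) (metis lookup_embed)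

text \<open>Any representative of the coset may be chosen, because \<open>pol.eval\<close> kills the
  ideal.\<close>

definition pol_act :: "nat \<Rightarrow> tensor set \<Rightarrow> Defs.vec \<Rightarrow> Defs.vec"
  where "pol_act n u w = embed (endo_app (pol.eval (SOME p. p \<in> tens n \<and> ugl_class n p = u)) (inv_into UNIV embed w))"

lemma pol_act: 
  assumes "p \<in> tens n"
  shows "pol_act n (ugl_class n p) (embed f) = embed (endo_app (pol.eval p) f)"
proof -
  define q where "q = (SOME q. q \<in> tens n \<and> ugl_class n q = ugl_class n p)"
  have q: "q \<in> tens n \<and> ugl_class n q = ugl_class n p"
    unfolding q_def by (rule someI[of _ p]) (simp add: assms)
  then have "q - p \<in> ugl_ideal n"
    using ugl_class_eq_iff[OF conjunct1[OF q] assms] by blast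
  then have "pol.eval q = pol.eval p"
    using pol.eval_ugl_ideal[of "q - p" n] by (simp add: endo_const.meval_diff)
  then show ?thesis
    unfolding pol_act_def q_def[symmetric] by (simp add: inv_f_f[OF inj_embed])
qed

text \<open>The module is the embedded orbit of \<open>hw_poly n a\<close> under the polarisation
  operators, so it is cyclic by construction.\<close>

theorem highest_weight_module_exists:
  "\<exists>V act. highest_weight_module n (dominant n a) V act"
proof -
  let ?h = "hw_poly n a"
  define V where "V = (\<lambda>p. embed (endo_app (pol.eval p) ?h)) ` tens n"
  have VI: "embed (endo_app (pol.eval p) ?h) \<in> V" if "p \<in> tens n" for p
    using that by (auto simp: V_def)
  have VE: "\<exists>p\<in>tens n. w = embed (endo_app (pol.eval p) ?h)" if "w \<in> V" for w
    using that by (auto simp: V_def)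
  have ev: "embed (endo_app (pol.eval p) f) + embed (endo_app (pol.eval q) f) = embed (endo_app (pol.eval (p + q)) f)"
    "vec_scale c (embed (endo_app (pol.eval p) f)) = embed (endo_app (pol.eval (Poly_Mapping.single 0 c * p)) f)"
    "endo_app (pol.eval p) (endo_app (pol.eval q) f) = endo_app (pol.eval (p * q)) f" for p q f c
    by (simp_all add: endo_const.meval_add embed_add pol.meval_mult embed_scale)
  have mod: "ugl_module n V (pol_act n)"
    unfolding ugl_module_def
  proof (intro conjI ballI allI)
    show "0 \<in> V"
      using VI[OF tens_zero] by (simp add: embed_zero)
    fix w w' c assume "w \<in> V" "w' \<in> V"
    then obtain p p' where p: "p \<in> tens n" "w = embed (endo_app (pol.eval p) ?h)"
        "p' \<in> tens n" "w' = embed (endo_app (pol.eval p') ?h)"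
      using VE by meson
    show "w + w' \<in> V" "vec_scale c w \<in> V"
      unfolding p(2,4) ev by (rule VI[OF tens_add[OF p(1,3)]], rule VI[OF tens_mult[OF tens_single_0 p(1)]])
    show "pol_act n \<one>\<^bsub>ugl n\<^esub> w = w"
      by (simp add: ugl_one p pol_act)
    fix u u' assume "u \<in> carrier (ugl n)" "u' \<in> carrier (ugl n)"
    then obtain q q' where q: "q \<in> tens n" "u = ugl_class n q" "q' \<in> tens n" "u' = ugl_class n q'"
      by (auto simp: carrier_ugl)
    show "pol_act n u w \<in> V"
      unfolding p(2) q(2) pol_act[OF q(1)] ev by (intro VI tens_mult p q)
    show "pol_act n u (w + w') = pol_act n u w + pol_act n u w'"
      unfolding p q(2) ev pol_act[OF q(1)] by (simp add: endo_app_add endo_const.meval_add embed_add pol.meval_mult)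
    show "pol_act n u (vec_scale c w) = vec_scale c (pol_act n u w)"
      unfolding p q(2) pol_act[OF q(1)] embed_scale[symmetric] by (simp add: endo_app_scale)
    show "pol_act n (u \<oplus>\<^bsub>ugl n\<^esub> u') w = pol_act n u w + pol_act n u' w"
      unfolding p q(2,4) ugl_add[OF q(1,3)] pol_act[OF q(1)] pol_act[OF q(3)] pol_act[OF tens_add[OF q(1,3)]]
      by (simp add: endo_const.meval_add embed_add)
    show "pol_act n (c \<odot>\<^bsub>ugl n\<^esub> u) w = vec_scale c (pol_act n u w)"
      unfolding p q(2) ugl_smult[OF q(1)] pol_act[OF q(1)] pol_act[OF tens_mult[OF tens_single_0 q(1)]] ev
      by (simp only: mult.assoc)
    show "pol_act n (u \<otimes>\<^bsub>ugl n\<^esub> u') w = pol_act n u (pol_act n u' w)"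
      unfolding p q(2,4) ugl_mult[OF q(1,3)] pol_act[OF q(1)] pol_act[OF q(3)] pol_act[OF tens_mult[OF q(1,3)]]
      by (simp add: pol.meval_mult)
  qed
  have h: "pol_act n (ugl_class n (e_tensor i j)) (embed ?h) = embed (polar i j ?h)"
    if "i \<in> {1..n}" "j \<in> {1..n}" for i j
    unfolding pol_act[OF tens_e_tensor[OF that]] by simp
  have "highest_weight_module n (dominant n a) V (pol_act n)"
    unfolding highest_weight_module_def
  proof (intro conjI mod bexI[of _ "embed ?h"] ballI impI)
    show "embed ?h \<noteq> 0"
      using hw_poly_neq_0 inj_eq[OF inj_embed, of ?h 0] by (simp add: embed_zero)
    show "embed ?h \<in> V"
      using VI[OF tens_one] by simp
    show "V = (\<lambda>u. pol_act n u (embed ?h)) ` carrier (ugl n)"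
      by (auto simp: V_def carrier_ugl pol_act image_image)
    fix i assume i: "i \<in> {1..n}"
    show "pol_act n (ugl_class n (e_tensor i i)) (embed ?h) = vec_scale (dominant n a i) (embed ?h)"
      using i by (simp only: h polar_hw_poly embed_scale atLeastAtMost_iff order_refl if_True simp_thms)
    fix j assume j: "j \<in> {1..n}" "i < j"
    then show "pol_act n (ugl_class n (e_tensor i j)) (embed ?h) = 0"
      using i by (simp add: h polar_hw_poly embed_zero)
  qed
  then show ?thesis
    by (intro exI)
qed

text \<open>Coordinate \<open>i\<close> of a dominant weight involves only the \<open>a k\<close>
  with \<open>k \<ge> i\<close>. Varying \<open>a (Suc r)\<close> thus moves coordinate
  \<open>Suc r\<close> through infinitely many values while the later ones stay fixed, and variables
  are eliminated from the front.\<close>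

lemma dominant_dense:
  assumes "vars_in {1..n} f" "\<And>a. mp_value f (dominant n a) = 0"
  shows "f = 0"
proof -
  have "f = 0" if "vars_in {Suc r..n} f" "r \<le> n" "\<And>a. mp_value f (dominant n a) = 0" for r f
    using that(2,1,3)
  proof (induction r arbitrary: f rule: inc_induct)
    case base
    then have "vars_in {} f"
      by simp
    then have "mp_value f x = 0" for x
      using base(2) mp_value_cong[of "{}" f x "dominant n (\<lambda>_. 0)"] by simp
    then show ?case
      using mp_value_eqD[of f 0] by (simp add: mp_value_simps)
  next
    case (step r)
    show ?case
    proof (rule mp_zero_by_last_var[where v = "Suc r" and V = "{Suc (Suc r)..n}" and A = "range (dominant n)"])
      have "insert (Suc r) {Suc (Suc r)..n} = {Suc r..n}"
        using step.hyps by auto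
      then show "vars_in (insert (Suc r) {Suc (Suc r)..n}) f"
        using step.prems(1) by simp
      show "g = 0" if "vars_in {Suc (Suc r)..n} g" "\<And>x. x \<in> range (dominant n) \<Longrightarrow> mp_value g x = 0" for g
        using step.IH[OF that(1)] that(2) by blast
      fix x assume "x \<in> range (dominant n)"
      then obtain a where a: "x = dominant n a"
        by auto
      define t where "t s = dominant n (a(Suc r := s)) (Suc r)" for s
      have t: "t s = of_nat s + of_nat (\<Sum>k=Suc (Suc r)..n. a k)" for s
        using step.hyps by (simp add: t_def dominant_def sum.atLeast_Suc_atMost)
      have "inj t"
        by (rule injI) (simp add: t)
      then have "infinite (range t)"
        by (rule range_inj_infinite)
      moreover have "mp_value f (x(Suc r := t s)) = 0" for s
      proof -
        have "mp_value f (x(Suc r := t s)) = mp_value f (dominant n (a(Suc r := s)))"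
          by (rule mp_value_cong[OF step.prems(1)]) (auto simp: a t_def dominant_def intro!: sum.cong)
        then show ?thesis
          by (simp add: step.prems(2))
      qed
      ultimately show "infinite {t. mp_value f (x(Suc r := t)) = 0}"
        using finite_subset[of "range t" "{t. mp_value f (x(Suc r := t)) = 0}"] by auto
    qed simp
  qed
  from this[of 0 f] show ?thesis
    using assms by simp
qed

section \<open>Free generators and the comparison maps\<close>

declare One_nat_def [simp del]

text \<open>Carriers are parametrised by the polynomials \<open>P\<close> in free generators \<open>F (mp_var 1), \<dots>, F (mp_var n)\<close>.\<close>

locale free_generators =
  fixes R :: "(complex, 'a) module" and n :: nat and F :: "mpoly \<Rightarrow> 'a"
  assumes carrier_eq: "carrier R = F ` {P. vars_in {1..n} P}"
    and inj: "vars_in {1..n} P \<Longrightarrow> vars_in {1..n} Q \<Longrightarrow> F P = F Q \<Longrightarrow> P = Q"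
    and add: "vars_in {1..n} P \<Longrightarrow> vars_in {1..n} Q \<Longrightarrow> F P \<oplus>\<^bsub>R\<^esub> F Q = F (P + Q)"
    and mult: "vars_in {1..n} P \<Longrightarrow> vars_in {1..n} Q \<Longrightarrow> F P \<otimes>\<^bsub>R\<^esub> F Q = F (P * Q)"
    and smult: "vars_in {1..n} P \<Longrightarrow> c \<odot>\<^bsub>R\<^esub> F P = F (Poly_Mapping.single 0 c * P)"
    and one: "\<one>\<^bsub>R\<^esub> = F 1"

lemma vars_in_scale: "vars_in V P \<Longrightarrow> vars_in V (Poly_Mapping.single 0 c * P)"
  by (simp add: vars_in_mult)

text \<open>\<open>C\<close> abstracts the defining condition, so that three definite descriptions
  are treated at once, including the one that prescribes the value at the last generator
  separately.\<close>

lemma the_alg_hom: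
  assumes R: "free_generators R n F" and S: "free_generators S k G"
    and \<sigma>: "\<And>i. i \<in> {1..n} \<Longrightarrow> vars_in {1..k} (\<sigma> i)"
    and C: "\<And>h. C h \<longleftrightarrow> h \<in> alg_hom R S \<and> h \<in> extensional (carrier R)
      \<and> (\<forall>i\<in>{1..n}. h (F (mp_var i)) = G (\<sigma> i))"
    and P: "vars_in {1..n} P"
  shows "(THE h. C h) (F P) = G (mp_subst \<sigma> P)"
proof -
  interpret R: free_generators R n F by fact
  interpret S: free_generators S k G by fact
  have \<sigma>P: "vars_in {1..k} (mp_subst \<sigma> Q)" if "vars_in {1..n} Q" for Q
    by (rule vars_in_mp_subst[OF that \<sigma>])
  have hom_eq: "h (F Q) = G (mp_subst \<sigma> Q)" if h: "C h" and Q: "vars_in {1..n} Q" for h Q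
  proof -
    have hom: "h \<in> Ring.ring_hom R S" "\<And>c x. x \<in> carrier R \<Longrightarrow> h (c \<odot>\<^bsub>R\<^esub> x) = c \<odot>\<^bsub>S\<^esub> h x"
        "\<And>i. i \<in> {1..n} \<Longrightarrow> h (F (mp_var i)) = G (\<sigma> i)"
      using h by (auto simp: C alg_hom_def)
    have F: "F Q \<in> carrier R" if "vars_in {1..n} Q" for Q
      using that by (auto simp: R.carrier_eq)
    from Q have "vars_in {1..n} Q \<and> h (F Q) = G (mp_subst \<sigma> Q)"
    proof (induction rule: mp_poly_induct)
      case (const c)
      have "h (c \<odot>\<^bsub>R\<^esub> \<one>\<^bsub>R\<^esub>) = c \<odot>\<^bsub>S\<^esub> \<one>\<^bsub>S\<^esub>"
        using hom(2)[OF F[OF vars_in_one], of c] ring_hom_one[OF hom(1)] by (simp add: R.one)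
      then show ?case
        using R.smult[OF vars_in_one, of c] S.smult[OF vars_in_one, of c] by (simp add: R.one S.one)
    next
      case (var i)
      then show ?case
        by (simp add: hom(3))
    next
      case (add p q)
      then have "h (F p \<oplus>\<^bsub>R\<^esub> F q) = G (mp_subst \<sigma> p) \<oplus>\<^bsub>S\<^esub> G (mp_subst \<sigma> q)"
        using ring_hom_add[OF hom(1) F F, of p q] by simp
      with add show ?case
        by (simp add: R.add S.add \<sigma>P mp_subst_simps vars_in_add)
    next
      case (mult p q)
      then have "h (F p \<otimes>\<^bsub>R\<^esub> F q) = G (mp_subst \<sigma> p) \<otimes>\<^bsub>S\<^esub> G (mp_subst \<sigma> q)"
        using ring_hom_mult[OF hom(1) F F, of p q] by simp
      with mult show ?case
        by (simp add: R.mult S.mult \<sigma>P mp_subst_simps vars_in_mult)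
    qed
    then show ?thesis ..
  qed
  define h where "h = (\<lambda>A\<in>carrier R. G (mp_subst \<sigma> (THE Q. vars_in {1..n} Q \<and> F Q = A)))"
  have h: "h (F Q) = G (mp_subst \<sigma> Q)" if "vars_in {1..n} Q" for Q
  proof -
    have "(THE Q'. vars_in {1..n} Q' \<and> F Q' = F Q) = Q"
      using that R.inj by (intro the_equality) blast+
    then show ?thesis
      using that by (auto simp: h_def R.carrier_eq)
  qed
  have "C h"
    unfolding C
  proof (intro conjI ballI)
    show "h \<in> extensional (carrier R)"
      by (simp add: h_def)
    show "h (F (mp_var i)) = G (\<sigma> i)" if "i \<in> {1..n}" for i
      using h[of "mp_var i"] that by simp
    have "h \<in> Ring.ring_hom R S"
    proof (rule ring_hom_memI)
      fix x assume "x \<in> carrier R"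
      then obtain p where p: "vars_in {1..n} p" "x = F p"
        by (auto simp: R.carrier_eq)
      show "h x \<in> carrier S"
        using p by (auto simp: h S.carrier_eq \<sigma>P)
      fix y assume "y \<in> carrier R"
      then obtain q where q: "vars_in {1..n} q" "y = F q"
        by (auto simp: R.carrier_eq)
      show "h (x \<otimes>\<^bsub>R\<^esub> y) = h x \<otimes>\<^bsub>S\<^esub> h y" "h (x \<oplus>\<^bsub>R\<^esub> y) = h x \<oplus>\<^bsub>S\<^esub> h y"
        using p q by (simp_all add: R.mult S.mult R.add S.add h \<sigma>P vars_in_mult vars_in_add mp_subst_simps)
    next
      show "h \<one>\<^bsub>R\<^esub> = \<one>\<^bsub>S\<^esub>"
        using h[OF vars_in_one] by (simp add: R.one S.one mp_subst_simps)
    qed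
    moreover have "h (c \<odot>\<^bsub>R\<^esub> x) = c \<odot>\<^bsub>S\<^esub> h x" if "x \<in> carrier R" for c x
      using that by (auto simp: R.carrier_eq R.smult S.smult h \<sigma>P vars_in_scale mp_subst_simps)
    ultimately show "h \<in> alg_hom R S"
      by (simp add: alg_hom_def)
  qed
  moreover have "h' = h" if "C h'" for h'
  proof (rule extensionalityI)
    show "h' \<in> extensional (carrier R)" "h \<in> extensional (carrier R)"
      using that \<open>C h\<close> by (simp_all add: C)
    show "h' x = h x" if "x \<in> carrier R" for x
      using that hom_eq[OF \<open>C h'\<close>] h by (auto simp: R.carrier_eq)
  qed
  ultimately have "(THE h. C h) = h"
    by (rule the_equality)
  then show ?thesis
    by (simp add: h P)
qed

definition poly_filt :: "nat \<Rightarrow> nat \<Rightarrow> mpoly set"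
  where "poly_filt n m = {P. vars_in {1..n} P \<and> weight_le (\<lambda>i. i) m P}"

lemma poly_filt_vars: "P \<in> poly_filt n m \<Longrightarrow> vars_in {1..n} P"
  by (simp add: poly_filt_def)

text \<open>This is where the assumption \<open>m \<le> n\<close> of the theorem enters.\<close>

lemma poly_filt_Suc:
  assumes "m \<le> n"
  shows "poly_filt (Suc n) m = poly_filt n m"
proof -
  have "vars_in {1..n} P" if P: "vars_in {1..Suc n} P" "weight_le (\<lambda>i. i) m P" for P
    unfolding vars_in_def
  proof (intro ballI subsetI)
    fix a i assume a: "a \<in> Poly_Mapping.keys P" and i: "i \<in> Poly_Mapping.keys a"
    have "i * 1 \<le> i * Poly_Mapping.lookup a i"
      using i by (intro mult_le_mono2) (simp add: in_keys_iff Suc_le_eq)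
    also have "\<dots> \<le> mon_weight (\<lambda>i. i) a"
      unfolding mon_weight_def
      by (rule member_le_sum[where f = "\<lambda>i. i * Poly_Mapping.lookup a i"]) (use i in auto)
    also have "\<dots> \<le> m"
      using P(2) a by (simp add: weight_le_def)
    finally have "i \<le> n"
      using assms by simp
    moreover have "i \<in> {1..Suc n}"
      using P(1) a i unfolding vars_in_def by blast
    ultimately show "i \<in> {1..n}"
      by simp
  qed
  then show ?thesis
    by (auto simp: poly_filt_def intro: vars_in_mono)
qed

lemma linear_iso_betweenI:
  assumes "free_generators R n F" and "free_generators S k G"
    and sub: "poly_filt n m = poly_filt k m"
    and h: "\<And>P. P \<in> poly_filt n m \<Longrightarrow> h (F P) = G P"
  shows "linear_iso_between R (F ` poly_filt n m) S (G ` poly_filt k m) h"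
proof -
  interpret R: free_generators R n F by fact
  interpret S: free_generators S k G by fact
  have add: "P + Q \<in> poly_filt n m" if "P \<in> poly_filt n m" "Q \<in> poly_filt n m" for P Q
    using that by (simp add: poly_filt_def vars_in_add weight_le_add)
  have scale: "Poly_Mapping.single 0 c * P \<in> poly_filt n m" if "P \<in> poly_filt n m" for P c
    using that weight_le_mult[OF weight_le_const, of "\<lambda>i. i" m P 0 c] by (simp add: poly_filt_def vars_in_scale)
  have v: "vars_in {1..n} P" "vars_in {1..k} P" if "P \<in> poly_filt n m" for P
    using that poly_filt_vars[of P n m] poly_filt_vars[of P k m] by (simp_all add: sub)
  have "linear_between R (F ` poly_filt n m) S (G ` poly_filt k m) h"
    unfolding linear_between_def
  proof (intro conjI ballI allI funcsetI)
    fix x assume "x \<in> F ` poly_filt n m"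
    then obtain p where p: "p \<in> poly_filt n m" "x = F p"
      by auto
    show "h x \<in> G ` poly_filt k m"
      using p by (simp add: h flip: sub)
    show "h (c \<odot>\<^bsub>R\<^esub> x) = c \<odot>\<^bsub>S\<^esub> h x" for c
      using p by (simp only: R.smult S.smult v h scale)
    fix y assume "y \<in> F ` poly_filt n m"
    then obtain q where q: "q \<in> poly_filt n m" "y = F q"
      by auto
    show "h (x \<oplus>\<^bsub>R\<^esub> y) = h x \<oplus>\<^bsub>S\<^esub> h y"
      using p q by (simp only: R.add S.add v h add)
  qed
  moreover have "inj_on h (F ` poly_filt n m)"
  proof (rule inj_onI)
    fix x y assume "x \<in> F ` poly_filt n m" "y \<in> F ` poly_filt n m" "h x = h y"
    then obtain p q where p: "p \<in> poly_filt n m" "x = F p" and q: "q \<in> poly_filt n m" "y = F q" and "G p = G q"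
      by (auto simp: h)
    then show "x = y"
      using S.inj[OF v(2)[OF p(1)] v(2)[OF q(1)]] by simp
  qed
  moreover have "h ` F ` poly_filt n m = G ` poly_filt k m"
    unfolding image_image sub[symmetric] using h by (rule image_cong[OF refl])
  ultimately show ?thesis
    by (simp add: linear_iso_between_def bij_betw_def)
qed

lemma mutually_inverse_isosI:
  assumes R: "free_generators R n F" and S: "free_generators S k G"
    and sub: "poly_filt n m = poly_filt k m"
    and f: "\<And>P. P \<in> poly_filt n m \<Longrightarrow> f (F P) = G P"
    and g: "\<And>P. P \<in> poly_filt k m \<Longrightarrow> g (G P) = F P"
  shows "mutually_inverse_isos R (F ` poly_filt n m) S (G ` poly_filt k m) f g"
  using linear_iso_betweenI[OF R S sub, of f] linear_iso_betweenI[OF S R sub[symmetric], of g] f g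
  by (auto simp: mutually_inverse_isos_def sub)

section \<open>Shifted symmetric polynomials as polynomials in the generators\<close>

lemma mp_subst_e_star_closed: "vars_in {1..n} P \<Longrightarrow> mp_subst (e_star n) P \<in> carrier (Lambda_star n)"
  unfolding carrier_Lambda_star e_star_eq_shift_elem by (simp add: shift_sym_mp_subst)

lemma e_star_inject:
  assumes "vars_in {1..n} P" "vars_in {1..n} Q" "mp_subst (e_star n) P = mp_subst (e_star n) Q"
  shows "P = Q"
  using shift_elem_independent[OF vars_in_diff[OF assms(1,2)], of 1] assms(3)
  by (simp add: e_star_eq_shift_elem mp_subst_simps)

lemma Lambda_star_filt_eq: "Lambda_star_filt n m = mp_subst (e_star n) ` poly_filt n m"
proof (intro equalityI subsetI)
  fix f assume "f \<in> Lambda_star_filt n m"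
  then show "f \<in> mp_subst (e_star n) ` poly_filt n m"
    using shift_sym_generated[of 1 n f m]
    by (auto simp: Lambda_star_filt_weight carrier_Lambda_star e_star_eq_shift_elem poly_filt_def)
next
  fix f assume "f \<in> mp_subst (e_star n) ` poly_filt n m"
  then obtain P where P: "vars_in {1..n} P" "weight_le (\<lambda>i. i) m P" "f = mp_subst (e_star n) P"
    by (auto simp: poly_filt_def)
  have "weight_le (\<lambda>_. 1) m f"
    unfolding P(3) e_star_eq_shift_elem by (rule weight_le_mp_subst[OF P(2,1) weight_le_shift_elem])
  then show "f \<in> Lambda_star_filt n m"
    using mp_subst_e_star_closed[OF P(1)] by (simp add: Lambda_star_filt_weight P(3))
qed

lemma free_generators_Lambda_star: "free_generators (Lambda_star n) n (mp_subst (e_star n))"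
proof
  show "carrier (Lambda_star n) = mp_subst (e_star n) ` {P. vars_in {1..n} P}"
  proof (intro equalityI subsetI)
    fix f assume f: "f \<in> carrier (Lambda_star n)"
    obtain m where "weight_le (\<lambda>_. 1) m f"
      using weight_le_exists by blast
    with f have "f \<in> Lambda_star_filt n m"
      by (simp add: Lambda_star_filt_weight)
    then show "f \<in> mp_subst (e_star n) ` {P. vars_in {1..n} P}"
      unfolding Lambda_star_filt_eq using poly_filt_vars by auto
  qed (use mp_subst_e_star_closed in auto)
qed (simp_all add: Lambda_star_def monoid_subalg_def mp_subst_simps e_star_inject)

lemma Lambda_star_incl:
  "vars_in {1..n} P \<Longrightarrow> Lambda_star_incl n (mp_subst (e_star n) P) = mp_subst (e_star (Suc n)) P"
  unfolding Lambda_star_incl_def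
  using the_alg_hom[OF free_generators_Lambda_star[of n] free_generators_Lambda_star[of "Suc n"], of mp_var]
  by (simp add: mp_subst_var)

lemma Lambda_star_proj: "Lambda_star_proj n (mp_subst (e_star (Suc n)) P) = mp_subst (e_star n) P"
  unfolding Lambda_star_proj_def mp_subst_mp_subst e_star_eq_shift_elem shift_elem_last_zero ..

section \<open>The Harish-Chandra isomorphism\<close>

definition eigenpoly :: "nat \<Rightarrow> tensor set \<Rightarrow> mpoly \<Rightarrow> bool"
  where "eigenpoly n A f \<longleftrightarrow> f \<in> carrier (Lambda_star n) \<and>
    (\<forall>\<mu> V act. highest_weight_module n \<mu> V act \<longrightarrow> (\<forall>v\<in>V. act A v = vec_scale (mp_value f \<mu>) v))"

text \<open>Every dominant weight has a module containing a nonzero vector, so two candidates agree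
  on a Zariski dense set.\<close>

lemma eigenpoly_unique:
  assumes "eigenpoly n A f" "eigenpoly n A g"
  shows "f = g"
proof -
  have "mp_value (f - g) (dominant n a) = 0" for a
  proof -
    obtain V act where hw: "highest_weight_module n (dominant n a) V act"
      using highest_weight_module_exists by blast
    then obtain v where "v \<in> V" "v \<noteq> 0"
      by (auto simp: highest_weight_module_def)
    then have "mp_value f (dominant n a) = mp_value g (dominant n a)"
      using assms hw vec_scale_inject[of v] by (metis eigenpoly_def)
    then show ?thesis
      by (simp add: mp_value_simps)
  qed
  moreover have "vars_in {1..n} (f - g)"
    using assms by (intro vars_in_diff) (simp_all add: eigenpoly_def carrier_Lambda_star shift_sym_def)
  ultimately show ?thesis
    using dominant_dense[of n "f - g"] by simp
qed

lemma chi_eqI: "eigenpoly n A f \<Longrightarrow> chi n A = f"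
  unfolding chi_def eigenpoly_def[symmetric] by (rule the_equality) (auto dest: eigenpoly_unique)

lemma eigenpoly_mult:
  assumes A: "eigenpoly n A f" "A \<in> carrier (ugl n)" and B: "eigenpoly n B g" "B \<in> carrier (ugl n)"
  shows "eigenpoly n (A \<otimes>\<^bsub>ugl n\<^esub> B) (f * g)"
  unfolding eigenpoly_def
proof (intro conjI allI impI ballI)
  show "f * g \<in> carrier (Lambda_star n)"
    using A(1) B(1) by (simp add: eigenpoly_def carrier_Lambda_star shift_sym_mult)
  fix \<mu> V act v assume hw: "highest_weight_module n \<mu> V act" and v: "v \<in> V"
  have "act A w = vec_scale (mp_value f \<mu>) w" "act B w = vec_scale (mp_value g \<mu>) w" if "w \<in> V" for w
    using A(1) B(1) hw that unfolding eigenpoly_def by blast+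
  moreover have "act (A \<otimes>\<^bsub>ugl n\<^esub> B) v = act A (act B v)" "act B v \<in> V"
    using hw v A(2) B(2) by (simp_all add: highest_weight_module_def ugl_module_def)
  ultimately show "act (A \<otimes>\<^bsub>ugl n\<^esub> B) v = vec_scale (mp_value (f * g) \<mu>) v"
    using v by (simp add: vec_scale_vec_scale mp_value_simps)
qed

definition capelli_class :: "nat \<Rightarrow> mpoly \<Rightarrow> tensor set"
  where "capelli_class n P = ugl_class n (capelli_poly n P)"

lemma eigenpoly_capelli_class:
  "vars_in {1..n} P \<Longrightarrow> eigenpoly n (capelli_class n P) (mp_subst (e_star n) P)"
  by (simp add: eigenpoly_def mp_subst_e_star_closed hw_capelli_poly capelli_class_def)

lemmas chi_capelli_class = chi_eqI[OF eigenpoly_capelli_class]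

lemma tens_capelli_poly: "capelli_poly n P \<in> tens n"
  by (rule central_tens[OF central_capelli_poly])

text \<open>Independence of the Capelli elements is inherited from that of the \<open>e_star\<close>
  through \<open>chi\<close>.\<close>

lemma capelli_class_inject:
  assumes "vars_in {1..n} P" "vars_in {1..n} Q" "capelli_class n P = capelli_class n Q"
  shows "P = Q"
  using e_star_inject[OF assms(1,2)] chi_capelli_class[OF assms(1)] chi_capelli_class[OF assms(2)] assms(3)
  by simp

text \<open>The product is again a polynomial in the Capelli elements, and its eigenvalues identify it.\<close>

lemma capelli_class_mult:
  assumes "vars_in {1..n} P" "vars_in {1..n} Q"
  shows "capelli_class n P \<otimes>\<^bsub>ugl n\<^esub> capelli_class n Q = capelli_class n (P * Q)"
proof -
  have "central n (capelli_poly n P * capelli_poly n Q)"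
    by (intro central_mult central_capelli_poly)
  then have "capelli_class n P \<otimes>\<^bsub>ugl n\<^esub> capelli_class n Q \<in> carrier (zeta n)"
    by (simp add: capelli_class_def ugl_mult tens_capelli_poly central_def class_in_zeta_iff)
  then obtain R where R: "vars_in {1..n} R" "capelli_class n P \<otimes>\<^bsub>ugl n\<^esub> capelli_class n Q = capelli_class n R"
    by (auto simp: carrier_zeta capelli_class_def)
  have "capelli_class n S \<in> carrier (ugl n)" for S
    by (simp add: capelli_class_def tens_capelli_poly)
  then have "eigenpoly n (capelli_class n R) (mp_subst (e_star n) (P * Q))"
    unfolding R(2)[symmetric] mp_subst_simps
    by (intro eigenpoly_mult eigenpoly_capelli_class assms)
  then have "mp_subst (e_star n) R = mp_subst (e_star n) (P * Q)"
    by (rule eigenpoly_unique[OF eigenpoly_capelli_class[OF R(1)]])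
  then show ?thesis
    using e_star_inject[OF R(1) vars_in_mult[OF assms]] R(2) by simp
qed

lemma capelli_poly_const: "capelli_poly n (Poly_Mapping.single 0 c) = Poly_Mapping.single 0 c"
proof -
  have "capelli_mon n 0 = 1"
    by (simp add: capelli_mon_def map_replicate_const)
  then show ?thesis
    by (simp add: capelli_poly_def)
qed

lemma prod_list_power_single:
  "distinct xs \<Longrightarrow> (\<Prod>i\<leftarrow>xs. f i ^ Poly_Mapping.lookup (Poly_Mapping.single k 1) i)
    = (if k \<in> set xs then f k else (1 :: 'b::monoid_mult))"
  by (induction xs) (auto simp: lookup_single when_def)

lemma capelli_H_eq_class: "k \<in> {1..n} \<Longrightarrow> capelli_H n k = capelli_class n (mp_var k)"
  unfolding capelli_H_eq capelli_class_def capelli_poly_def mp_var_def tensor_const.meval_single capelli_mon_def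
  by (subst prod_list_power_single) (auto simp del: upt_Suc)

lemma free_generators_zeta: "free_generators (zeta n) n (capelli_class n)"
proof
  show "carrier (zeta n) = capelli_class n ` {P. vars_in {1..n} P}"
    by (auto simp: carrier_zeta capelli_class_def)
  show "c \<odot>\<^bsub>zeta n\<^esub> capelli_class n P = capelli_class n (Poly_Mapping.single 0 c * P)" if "vars_in {1..n} P" for c P
    using capelli_class_mult[OF vars_in_const that, of c]
    by (simp only: zeta_simps capelli_class_def capelli_poly_const ugl_smult[OF tens_capelli_poly]
        ugl_mult[OF tens_single_0 tens_capelli_poly])
  show "\<one>\<^bsub>zeta n\<^esub> = capelli_class n 1"
    using capelli_poly_const[of n 1] by (simp add: capelli_class_def ugl_one)
qed (simp_all add: capelli_class_mult capelli_class_inject,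
     simp add: capelli_class_def ugl_add tens_capelli_poly capelli_poly_add)

lemma zeta_filt_eq_image: "zeta_filt n m = capelli_class n ` poly_filt n m"
  by (auto simp: zeta_filt_eq capelli_class_def poly_filt_def)

lemma zeta_incl: "vars_in {1..n} P \<Longrightarrow> zeta_incl n (capelli_class n P) = capelli_class (Suc n) P"
  unfolding zeta_incl_def
  using the_alg_hom[OF free_generators_zeta[of n] free_generators_zeta[of "Suc n"], of mp_var]
  by (simp add: mp_subst_var capelli_H_eq_class)

lemma zeta_proj:
  assumes "vars_in {1..n} P"
  shows "zeta_proj n (capelli_class (Suc n) P) = capelli_class n P"
proof -
  have "zeta_proj n (capelli_class (Suc n) P) = capelli_class n (mp_subst (mp_var(Suc n := 0)) P)"
    unfolding zeta_proj_def
  proof (rule the_alg_hom[OF free_generators_zeta free_generators_zeta])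
    show "vars_in {1..n} ((mp_var(Suc n := 0)) i)" if "i \<in> {1..Suc n}" for i
      using that by auto
    show "vars_in {1..Suc n} P"
      using assms by (rule vars_in_mono) auto
    \<comment> \<open>The separate condition at \<open>Suc n\<close> is brought into the uniform
      form required by \<open>the_alg_hom\<close>, with zero as the image of the last
      variable.\<close>
    have "\<zero>\<^bsub>zeta n\<^esub> = capelli_class n 0"
      using capelli_poly_const[of n 0] by (simp add: capelli_class_def ugl_zero)
    moreover have "{1..Suc n} = insert (Suc n) {1..n}"
      by auto
    ultimately show "h \<in> alg_hom (zeta (Suc n)) (zeta n) \<and> h \<in> extensional (carrier (zeta (Suc n))) \<and>
        (\<forall>k\<in>{1..n}. h (capelli_H (Suc n) k) = capelli_H n k) \<and> h (capelli_H (Suc n) (Suc n)) = \<zero>\<^bsub>zeta n\<^esub> \<longleftrightarrow>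
      h \<in> alg_hom (zeta (Suc n)) (zeta n) \<and> h \<in> extensional (carrier (zeta (Suc n))) \<and>
        (\<forall>i\<in>{1..Suc n}. h (capelli_class (Suc n) (mp_var i)) = capelli_class n ((mp_var(Suc n := 0)) i))" for h
      by (auto simp: capelli_H_eq_class)
  qed
  also have "mp_subst (mp_var(Suc n := 0)) P = P"
    using mp_subst_cong[OF assms, of "mp_var(Suc n := 0)" mp_var] by (simp add: mp_subst_var)
  finally show ?thesis .
qed

theorem theorem7p6:
  fixes n m :: nat
  assumes "1 \<le> m" and "m \<le> n"
  shows
    "linear_iso_between (zeta n) (zeta_filt n m)
       (Lambda_star n) (Lambda_star_filt n m) (chi n) \<and>
     linear_iso_between (zeta (Suc n)) (zeta_filt (Suc n) m)
       (Lambda_star (Suc n)) (Lambda_star_filt (Suc n) m) (chi (Suc n)) \<and>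
     (\<forall>A\<in>zeta_filt (Suc n) m. chi n (zeta_proj n A) = Lambda_star_proj n (chi (Suc n) A)) \<and>
     (\<forall>A\<in>zeta_filt n m. chi (Suc n) (zeta_incl n A) = Lambda_star_incl n (chi n A)) \<and>
     mutually_inverse_isos
       (zeta (Suc n)) (zeta_filt (Suc n) m) (zeta n) (zeta_filt n m)
       (zeta_proj n) (zeta_incl n) \<and>
     mutually_inverse_isos
       (Lambda_star (Suc n)) (Lambda_star_filt (Suc n) m)
       (Lambda_star n) (Lambda_star_filt n m)
       (Lambda_star_proj n) (Lambda_star_incl n)"
proof -
  note eq = poly_filt_Suc[OF assms(2)]
  have vars: "vars_in {1..n} P" "vars_in {1..Suc n} P" if "P \<in> poly_filt n m" for P
    using that poly_filt_vars[of P "Suc n" m] poly_filt_vars[of P n m] by (simp_all add: eq)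
  show ?thesis
    unfolding zeta_filt_eq_image Lambda_star_filt_eq
  proof (intro conjI ballI linear_iso_betweenI mutually_inverse_isosI
      free_generators_zeta free_generators_Lambda_star refl eq)
    fix A assume "A \<in> capelli_class (Suc n) ` poly_filt (Suc n) m"
    then show "chi n (zeta_proj n A) = Lambda_star_proj n (chi (Suc n) A)"
      by (auto simp: eq vars zeta_proj chi_capelli_class Lambda_star_proj)
  next
    fix A assume "A \<in> capelli_class n ` poly_filt n m"
    then show "chi (Suc n) (zeta_incl n A) = Lambda_star_incl n (chi n A)"
      by (auto simp: vars zeta_incl chi_capelli_class Lambda_star_incl)
  qed (simp_all only: eq vars zeta_proj zeta_incl chi_capelli_class Lambda_star_proj Lambda_star_incl)
qed

end
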